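(* For every pair of positive integers $n\geq 4$ and $m>\frac{7}{6}n+\frac{26}{9}$, let ${\rm S}_{\rm gen}={\rm S}_{\rm gen}(m,n)$ be the value semigroup of a generic cusp in $\mathbb{C}^n$ with ramification profile $(2m,2m+2,\dots,2m+2n-2)$, and let $g=\#(\mathbb{N}\setminus{\rm S}_{\rm gen})$. Then the corresponding Severi variety $M^n_{d,g;{\rm S}_{\rm gen}}$ is of codimension strictly less than $(n-2)g$ in $M^n_d$ whenever $d\gg g$.
   Context: We work over $\mathbb{C}$. $M^n_d$ denotes the space of nondegenerate morphisms $f:\mathbb{P}^1\to\mathbb{P}^n$ of degree $d>0$, each morphism being identified with the set of coefficients of its homogeneous parameterizing polynomials. $M^n_{d,g}\subset M^n_d$ is the subvariety of morphisms whose images have arithmetic genus $g>0$. A cusp is a unibranch curve singularity, parameterized near $t=0$ by an $n$-tuple of power series $(f_1(t),\dots,f_n(t))$; its value semigroup is the set of $t$-adic valuations of elements of the image of the ring map $\mathbb{C}[[x_1,\dots,x_n]]\to\mathbb{C}[[t]]$, $x_i\mapsto f_i(t)$. $M^n_{d,g;{\rm S}}\subset M^n_{d,g}$ is the subvariety parameterizing morphisms whose image has a unique singularity, which is a cusp with value semigroup ${\rm S}$ (so $\#(\mathbb{N}\setminus{\rm S})=g$). The cusp has ramification profile $(k_1,\dots,k_n)$ if $0<k_1<\dots<k_n$ are the vanishing orders at $t=0$, together with $0$, of linear combinations of $1,f_1,\dots,f_n$. A generic cusp with ramification profile $(2m,2m+2,\dots,2m+2n-2)$ is one parameterized by power series $f_i$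 with $v_t(f_i)=2m+2i-2$ and otherwise generic coefficients. The notation $d\gg g$ means that $d$ is sufficiently large relative to $g$. *)

theory Defs
  imports
    "HOL-Analysis.Analysis"
    "HOL-Library.Function_Algebras"
    "HOL-Computational_Algebra.Computational_Algebra"
begin

section \<open>Functions as a complex vector space\<close>

definition cscale :: "complex \<Rightarrow> ('a \<Rightarrow> complex) \<Rightarrow> 'a \<Rightarrow> complex" where
  "cscale z f = (\<lambda>x. z * f x)"

global_interpretation cfun: vector_space "cscale :: complex \<Rightarrow> ('a \<Rightarrow> complex) \<Rightarrow> 'a \<Rightarrow> complex"
  by standard (auto simp: cscale_def fun_eq_iff algebra_simps)

section \<open>Zariski topology, Krull codimension\<close>

text \<open>Affine space with coordinates indexed by \<open>I\<close>, as functions vanishing outside \<open>I\<close>.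
  The index set may be infinite; a polynomial function only involves finitely many coordinates.\<close>

definition affine_space :: "'i set \<Rightarrow> ('i \<Rightarrow> complex) set" where
  "affine_space I = {x. \<forall>i. i \<notin> I \<longrightarrow> x i = 0}"

inductive_set poly_funs :: "'i set \<Rightarrow> (('i \<Rightarrow> complex) \<Rightarrow> complex) set" for I :: "'i set" where
  const: "(\<lambda>x. z) \<in> poly_funs I"
| coord: "i \<in> I \<Longrightarrow> (\<lambda>x. x i) \<in> poly_funs I"
| add: "p \<in> poly_funs I \<Longrightarrow> q \<in> poly_funs I \<Longrightarrow> (\<lambda>x. p x + q x) \<in> poly_funs I"
| mult: "p \<in> poly_funs I \<Longrightarrow> q \<in> poly_funs I \<Longrightarrow> (\<lambda>x. p x * q x) \<in> poly_funs I"

definition zariski :: "'i set \<Rightarrow> ('i \<Rightarrow> complex) topology" where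
  "zariski I = topology_generated_by {{x \<in> affine_space I. p x \<noteq> 0} |p. p \<in> poly_funs I}"

definition irreducible_closed :: "'a topology \<Rightarrow> 'a set \<Rightarrow> bool" where
  "irreducible_closed X Z \<longleftrightarrow> closedin X Z \<and> Z \<noteq> {} \<and>
     (\<forall>A B. closedin X A \<and> closedin X B \<and> Z \<subseteq> A \<union> B \<longrightarrow> Z \<subseteq> A \<or> Z \<subseteq> B)"

text \<open>Codimension of an irreducible closed set \<open>Z\<close>: the supremum of the lengths of chains of
  irreducible closed sets starting at \<open>Z\<close>.\<close>

definition irreducible_codim :: "'a topology \<Rightarrow> 'a set \<Rightarrow> enat" where
  "irreducible_codim X Z = Sup {enat k |k. \<exists>C :: nat \<Rightarrow> 'a set.
     C 0 = Z \<and> (\<forall>i\<le>k. irreducible_closed X (C i)) \<and> (\<forall>i<k. C i \<subset> C (Suc i))}"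

text \<open>An arbitrary subset has the codimension of its closure, which is the minimum of the
  codimensions of its components; the empty set has codimension \<open>\<infinity>\<close>.\<close>

definition codim :: "'a topology \<Rightarrow> 'a set \<Rightarrow> enat" where
  "codim X Y = Inf {irreducible_codim X Z |Z. irreducible_closed X Z \<and> Z \<subseteq> X closure_of Y}"

section \<open>Morphisms from the projective line\<close>

text \<open>The coefficient array \<open>c\<close> stands for the \<open>n + 1\<close> forms
  \<open>\<Sum>k\<le>d. c (i, k) x^(d-k) y^k\<close>, \<open>i \<le> n\<close>. Tuples of forms are not identified up to a common
  scalar: the space of morphisms is an open subset of the affine space of coefficients.\<close>

definition param :: "nat \<Rightarrow> (nat \<times> nat \<Rightarrow> complex) \<Rightarrow> complex \<times> complex \<Rightarrow> nat \<Rightarrow> complex" where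
  "param d c = (\<lambda>(x, y) i. \<Sum>k\<le>d. c (i, k) * x ^ (d - k) * y ^ k)"

definition P1_morphisms :: "nat \<Rightarrow> nat \<Rightarrow> (nat \<times> nat \<Rightarrow> complex) set" where
  "P1_morphisms n d = {c \<in> affine_space ({..n} \<times> {..d}).
     (\<forall>s. s \<noteq> (0, 0) \<longrightarrow> (\<exists>i\<le>n. param d c s i \<noteq> 0)) \<and>
     (\<forall>l. (\<forall>s. (\<Sum>i\<le>n. l i * param d c s i) = 0) \<longrightarrow> (\<forall>i\<le>n. l i = 0))}"

definition morphism_topology :: "nat \<Rightarrow> nat \<Rightarrow> (nat \<times> nat \<Rightarrow> complex) topology" where
  "morphism_topology n d = subtopology (zariski ({..n} \<times> {..d})) (P1_morphisms n d)"

text \<open>The affine cone over the image curve.\<close>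

definition image_cone :: "nat \<Rightarrow> (nat \<times> nat \<Rightarrow> complex) \<Rightarrow> (nat \<Rightarrow> complex) set" where
  "image_cone d c = {cscale z (param d c s) |z s. True}"

text \<open>Hilbert function of the projective variety with affine cone \<open>V\<close>: the dimension of the space
  of forms of degree \<open>k\<close> in the coordinates \<open>x\<^sub>0, \<dots>, x\<^sub>n\<close>, restricted to \<open>V\<close>.\<close>

definition hilbert_function :: "nat \<Rightarrow> (nat \<Rightarrow> complex) set \<Rightarrow> nat \<Rightarrow> nat" where
  "hilbert_function n V k = cfun.dim
     {(\<lambda>x. if x \<in> V then \<Prod>i\<le>n. x i ^ a i else 0) |a :: nat \<Rightarrow> nat. (\<Sum>i\<le>n. a i) = k}"

text \<open>The arithmetic genus of a projective curve with Hilbert polynomial \<open>e k + b\<close> is \<open>1 - b\<close>.\<close>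

definition has_arithmetic_genus :: "nat \<Rightarrow> (nat \<Rightarrow> complex) set \<Rightarrow> nat \<Rightarrow> bool" where
  "has_arithmetic_genus n V g \<longleftrightarrow>
     (\<exists>e. \<forall>\<^sub>F k in sequentially. int (hilbert_function n V k) = int e * int k + 1 - int g)"

definition P1_morphisms_genus :: "nat \<Rightarrow> nat \<Rightarrow> nat \<Rightarrow> (nat \<times> nat \<Rightarrow> complex) set" where
  "P1_morphisms_genus n d g = {c \<in> P1_morphisms n d. has_arithmetic_genus n (image_cone d c) g}"

text \<open>Zariski tangent space at \<open>p\<close> of the zero locus of all polynomials vanishing on \<open>V\<close>.\<close>

definition tangent_space :: "'i set \<Rightarrow> ('i \<Rightarrow> complex) set \<Rightarrow> ('i \<Rightarrow> complex) \<Rightarrow> ('i \<Rightarrow> complex) set" where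
  "tangent_space I V p = {v \<in> affine_space I. \<forall>P \<in> poly_funs I. (\<forall>x\<in>V. P x = 0) \<longrightarrow>
     ((\<lambda>h. P (p + cscale h v)) has_field_derivative 0) (at 0)}"

text \<open>The points of the cone, other than the vertex, that lie over a singular point of the image
  curve: the cone is two-dimensional, and it is regular at \<open>p\<close> iff the curve is regular at the
  corresponding point.\<close>

definition singular_cone :: "nat \<Rightarrow> nat \<Rightarrow> (nat \<times> nat \<Rightarrow> complex) \<Rightarrow> (nat \<Rightarrow> complex) set" where
  "singular_cone n d c =
     {p \<in> image_cone d c. p \<noteq> (\<lambda>_. 0) \<and> cfun.dim (tangent_space {..n} (image_cone d c) p) \<noteq> 2}"

section \<open>Value semigroups\<close>

text \<open>The substitution \<open>x\<^sub>i \<mapsto> f i\<close> (\<open>i \<in> I\<close>, \<open>I\<close> finite) applied to the formal power series with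
  coefficients \<open>u a\<close>, where \<open>a\<close> ranges over the exponent vectors. It is meant for series \<open>f i\<close>
  without constant term, so that only exponents of total degree at most \<open>k\<close> contribute to the
  coefficient of \<open>t^k\<close>.\<close>

definition mps_subst :: "nat set \<Rightarrow> (nat \<Rightarrow> complex fps) \<Rightarrow> ((nat \<Rightarrow> nat) \<Rightarrow> complex) \<Rightarrow> complex fps" where
  "mps_subst I f u = Abs_fps (\<lambda>k.
     \<Sum>a \<in> {a. (\<forall>i. i \<notin> I \<longrightarrow> a i = 0) \<and> (\<Sum>i\<in>I. a i) \<le> k}. u a * fps_nth (\<Prod>i\<in>I. f i ^ a i) k)"

definition value_semigroup :: "nat set \<Rightarrow> (nat \<Rightarrow> complex fps) \<Rightarrow> nat set" where
  "value_semigroup I f = {subdegree (mps_subst I f u) |u. mps_subst I f u \<noteq> 0}"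

text \<open>The power series at \<open>t = 0\<close> of the \<open>i\<close>-th form along \<open>(x, y) = s + t r\<close>; for \<open>r\<close> not
  proportional to \<open>s\<close>, \<open>t\<close> is a local parameter of the projective line at \<open>s\<close>.\<close>

definition param_fps ::
    "nat \<Rightarrow> (nat \<times> nat \<Rightarrow> complex) \<Rightarrow> complex \<times> complex \<Rightarrow> complex \<times> complex \<Rightarrow> nat \<Rightarrow> complex fps" where
  "param_fps d c s r i = (\<Sum>k\<le>d. fps_const (c (i, k)) *
     (fps_const (fst s) + fps_const (fst r) * fps_X) ^ (d - k) *
     (fps_const (snd s) + fps_const (snd r) * fps_X) ^ k)"

text \<open>The germ at \<open>s\<close> in the affine coordinates \<open>x\<^sub>i / x\<^sub>j\<close>, translated so that the point goes to the
  origin.\<close>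

definition local_germ ::
    "nat \<Rightarrow> (nat \<times> nat \<Rightarrow> complex) \<Rightarrow> complex \<times> complex \<Rightarrow> complex \<times> complex \<Rightarrow> nat \<Rightarrow> nat \<Rightarrow> complex fps" where
  "local_germ d c s r j i = param_fps d c s r i / param_fps d c s r j
     - fps_const (param d c s i / param d c s j)"

text \<open>The value semigroup of the germ does not depend on the chart \<open>j\<close> and the direction \<open>r\<close>.\<close>

definition has_value_semigroup_at ::
    "nat \<Rightarrow> nat \<Rightarrow> (nat \<times> nat \<Rightarrow> complex) \<Rightarrow> complex \<times> complex \<Rightarrow> nat set \<Rightarrow> bool" where
  "has_value_semigroup_at n d c s S \<longleftrightarrow>
     (\<exists>j r. j \<le> n \<and> param d c s j \<noteq> 0 \<and> fst s * snd r \<noteq> snd s * fst r \<and>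
        value_semigroup ({..n} - {j}) (local_germ d c s r j) = S)"

section \<open>Severi varieties and generic cusps\<close>

text \<open>The image has exactly one singular point, the image of \<open>s\<close>; it is unibranch (no further
  preimages) and the germ at \<open>s\<close> has value semigroup \<open>S\<close>.\<close>

definition severi :: "nat \<Rightarrow> nat \<Rightarrow> nat \<Rightarrow> nat set \<Rightarrow> (nat \<times> nat \<Rightarrow> complex) set" where
  "severi n d g S = {c \<in> P1_morphisms_genus n d g. \<exists>s. s \<noteq> (0, 0) \<and>
     singular_cone n d c = {cscale z (param d c s) |z. z \<noteq> 0} \<and>
     (\<forall>s' z. s' \<noteq> (0, 0) \<and> param d c s' = cscale z (param d c s) \<longrightarrow> fst s * snd s' = snd s * fst s') \<and>
     has_value_semigroup_at n d c s S}"

text \<open>Coefficient arrays of the \<open>n\<close>-tuples \<open>f\<^sub>1, \<dots>, f\<^sub>n\<close> of power series with prescribed orders of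
  vanishing \<open>ord 1, \<dots>, ord n\<close>.\<close>

definition coeff_fps :: "(nat \<times> nat \<Rightarrow> complex) \<Rightarrow> nat \<Rightarrow> complex fps" where
  "coeff_fps c i = Abs_fps (\<lambda>k. c (i, k))"

definition cusp_params :: "nat \<Rightarrow> (nat \<Rightarrow> nat) \<Rightarrow> (nat \<times> nat \<Rightarrow> complex) set" where
  "cusp_params n ord = {c \<in> affine_space ({1..n} \<times> UNIV).
     \<forall>i\<in>{1..n}. coeff_fps c i \<noteq> 0 \<and> subdegree (coeff_fps c i) = ord i}"

text \<open>\<open>S\<close> is the value semigroup for all coefficients in some nonempty Zariski open subset of the
  space of coefficients.\<close>

definition is_generic_semigroup :: "nat \<Rightarrow> (nat \<Rightarrow> nat) \<Rightarrow> nat set \<Rightarrow> bool" where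
  "is_generic_semigroup n ord S \<longleftrightarrow>
     (\<exists>U. openin (subtopology (zariski ({1..n} \<times> UNIV)) (cusp_params n ord)) U \<and> U \<noteq> {} \<and>
        (\<forall>c\<in>U. value_semigroup {1..n} (coeff_fps c) = S))"

definition S_gen :: "nat \<Rightarrow> nat \<Rightarrow> nat set" where
  "S_gen m n = (THE S. is_generic_semigroup n (\<lambda>i. 2 * m + 2 * i - 2) S)"

end

theory Submission
  imports Defs
begin

text \<open>The cusp is placed at a fixed point of the line, the point \<open>y = 0\<close> with parameter \<open>t = y\<close>. The general map
  with ramification orders \<open>0\<close> and \<open>k_i = 2 m + 2 i - 2\<close> there is, after a unitriangular change of
  coordinates, given by power series \<open>f_0, \<dots>, f_n\<close> with these orders (\<open>ram_map\<close>). The family of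
  these maps has codimension at most \<open>\<Sum> (k_i - i) = n (4 m + n - 3) / 2\<close> in the space of all maps:
  it has as many free parameters as there are coordinates in \<open>ram_index\<close>, and these coordinates stay
  algebraically independent on it (\<open>ram_map_dominant\<close>, \<open>codim_le_parametrized\<close>). The bound on
  chains of irreducible closed sets behind this is \<open>irreducible_codim_le\<close>.

  The general member of the family lies in the Severi variety of the generic semigroup. Its germ
  at the cusp is a generic one, with a semigroup whose conductor is bounded because the cancellation
  between \<open>f_1 f_3\<close> and \<open>f_2^2\<close> produces an odd order (\<open>S_gen_generic\<close>). What remains is
  that the image has no further singularity and arithmetic genus \<open>g\<close>, the number of gaps. For every
  \<open>k\<close> the forms of degree \<open>k\<close> on the image can only have orders in the semigroup. If for large \<open>k\<close>
  they have all of these orders, then they contain all binary forms divisible by the conductor, and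
  this separates points and tangent directions away from the cusp and gives the Hilbert function
  (\<open>cusp_map.in_severi\<close>). To have many orders is an open condition
  (\<open>card_orders_semicontinuous\<close>), and it follows for all large \<open>k\<close> from finitely many values of \<open>k\<close>;
  so a single curve with generic jets suffices (\<open>curve_with_full_orders\<close>, \<open>good_params_dense\<close>).

  Finally \<open>g\<close> is large: modulo a power of \<open>t\<close>, the algebra of the germ is spanned by the monomials of
  small weight, and there are few of these. This gives \<open>g \<ge> 4 m + 1 - n\<close>, and \<open>g \<ge> 6 m - 13\<close> for \<open>n = 4\<close>
  (\<open>S_gen_gaps\<close>), so that \<open>n (4 m + n - 3) / 2 < (n - 2) g\<close> under the hypothesis on \<open>m\<close>
  (\<open>codim_less_bound\<close>).\<close>

unbundle no vec_syntax

section \<open>Polynomial functions\<close>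

lemma poly_funs_sum:
  "(\<And>t. t \<in> T \<Longrightarrow> p t \<in> poly_funs I) \<Longrightarrow> (\<lambda>x. \<Sum>t\<in>T. p t x) \<in> poly_funs I"
  by (induction T rule: infinite_finite_induct) (auto intro: poly_funs.intros)

lemma poly_funs_prod:
  "(\<And>t. t \<in> T \<Longrightarrow> p t \<in> poly_funs I) \<Longrightarrow> (\<lambda>x. \<Prod>t\<in>T. p t x) \<in> poly_funs I"
  by (induction T rule: infinite_finite_induct) (auto intro: poly_funs.intros)

lemma poly_funs_power: "p \<in> poly_funs I \<Longrightarrow> (\<lambda>x. p x ^ k) \<in> poly_funs I"
  by (induction k) (auto intro: poly_funs.intros)

lemma poly_funs_scale: "p \<in> poly_funs I \<Longrightarrow> (\<lambda>x. z * p x) \<in> poly_funs I"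
  by (rule poly_funs.mult[OF poly_funs.const])

lemma poly_funs_diff:
  assumes "p \<in> poly_funs I" "q \<in> poly_funs I"
  shows "(\<lambda>x. p x - q x) \<in> poly_funs I"
  using poly_funs.add[OF assms(1) poly_funs_scale[OF assms(2), of "-1"]] by simp

lemma poly_funs_cong:
  "P \<in> poly_funs I \<Longrightarrow> (\<And>i. i \<in> I \<Longrightarrow> x i = y i) \<Longrightarrow> P x = P y"
  by (induction rule: poly_funs.induct) auto

lemma poly_funs_mono: "P \<in> poly_funs I \<Longrightarrow> I \<subseteq> J \<Longrightarrow> P \<in> poly_funs J"
  by (induction rule: poly_funs.induct) (auto intro: poly_funs.intros)

lemma poly_funs_finite_support:
  "P \<in> poly_funs I \<Longrightarrow> \<exists>J. finite J \<and> J \<subseteq> I \<and> P \<in> poly_funs J"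
proof (induction rule: poly_funs.induct)
  case (const z)
  show ?case by (rule exI[of _ "{}"]) (auto intro: poly_funs.intros)
next
  case (coord i)
  then show ?case by (intro exI[of _ "{i}"] conjI poly_funs.coord) auto
next
  case (add p q)
  then obtain J J' where "finite J" "J \<subseteq> I" "p \<in> poly_funs J" "finite J'" "J' \<subseteq> I" "q \<in> poly_funs J'"
    by auto
  then show ?case
    by (intro exI[of _ "J \<union> J'"]) (auto intro!: poly_funs.intros elim: poly_funs_mono)
next
  case (mult p q)
  then obtain J J' where "finite J" "J \<subseteq> I" "p \<in> poly_funs J" "finite J'" "J' \<subseteq> I" "q \<in> poly_funs J'"
    by auto
  then show ?case
    by (intro exI[of _ "J \<union> J'"]) (auto intro!: poly_funs.intros elim: poly_funs_mono)
qed

lemma poly_funs_subst: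
  "P \<in> poly_funs J \<Longrightarrow> (\<And>j. j \<in> J \<Longrightarrow> (\<lambda>w. q w j) \<in> poly_funs I) \<Longrightarrow> (\<lambda>w. P (q w)) \<in> poly_funs I"
  by (induction rule: poly_funs.induct) (auto intro: poly_funs.intros)

lemma poly_funs_curve:
  "P \<in> poly_funs I \<Longrightarrow> (\<And>i. i \<in> I \<Longrightarrow> \<exists>p. \<forall>h. \<gamma> h i = poly p h) \<Longrightarrow> \<exists>p. \<forall>h. P (\<gamma> h) = poly p h"
proof (induction rule: poly_funs.induct)
  case (const z)
  show ?case by (rule exI[of _ "[:z:]"]) simp
next
  case (add p q)
  then obtain p' q' where "\<forall>h. p (\<gamma> h) = poly p' h" "\<forall>h. q (\<gamma> h) = poly q' h" by auto
  then show ?case by (intro exI[of _ "p' + q'"]) simp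
next
  case (mult p q)
  then obtain p' q' where "\<forall>h. p (\<gamma> h) = poly p' h" "\<forall>h. q (\<gamma> h) = poly q' h" by auto
  then show ?case by (intro exI[of _ "p' * q'"]) simp
qed auto

lemma poly_avoid:
  fixes p q :: "complex poly"
  assumes "p \<noteq> 0" "q \<noteq> 0"
  shows "\<exists>h. poly p h \<noteq> 0 \<and> poly q h \<noteq> 0"
proof -
  have "finite {h. poly (p * q) h = 0}" using assms by (intro poly_roots_finite) simp
  then have "{h. poly (p * q) h = 0} \<noteq> UNIV" using infinite_UNIV_char_0 by metis
  then show ?thesis by auto
qed

definition line :: "('i \<Rightarrow> complex) \<Rightarrow> ('i \<Rightarrow> complex) \<Rightarrow> complex \<Rightarrow> 'i \<Rightarrow> complex" where
  "line x y h = (\<lambda>i. x i + h * (y i - x i))"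

lemma line_0 [simp]: "line x y 0 = x" and line_1 [simp]: "line x y 1 = y"
  by (auto simp: line_def)

lemma line_coord_poly: "\<exists>p. \<forall>h. line x y h i = poly p h"
  by (rule exI[of _ "[:x i, y i - x i:]"]) (simp add: line_def algebra_simps)

lemma line_avoid:
  assumes P: "\<exists>p. \<forall>h. P (line x y h) = poly p h" and Q: "\<exists>p. \<forall>h. Q (line x y h) = poly p h"
    and "P x \<noteq> 0" "Q y \<noteq> (0::complex)"
  shows "\<exists>h. P (line x y h) \<noteq> (0::complex) \<and> Q (line x y h) \<noteq> 0"
proof -
  obtain p q where pq: "\<forall>h. P (line x y h) = poly p h" "\<forall>h. Q (line x y h) = poly q h"
    using P Q by auto
  have "poly p 0 \<noteq> 0" "poly q 1 \<noteq> 0" using pq assms(3,4) by (metis line_0, metis line_1)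
  then have "p \<noteq> 0" "q \<noteq> 0" by auto
  from poly_avoid[OF this] show ?thesis using pq by simp
qed

text \<open>On the line through the two points both functions are nonzero polynomials in one variable, so
  they have finitely many zeros. This is how irreducibility is used throughout, also in
  infinitely many coordinates.\<close>

lemma poly_funs_avoid:
  assumes "P \<in> poly_funs I" "Q \<in> poly_funs I" "P x \<noteq> 0" "Q y \<noteq> 0"
  shows "\<exists>h. P (line x y h) \<noteq> 0 \<and> Q (line x y h) \<noteq> 0"
proof -
  have "\<exists>p. \<forall>h. P (line x y h) = poly p h" "\<exists>p. \<forall>h. Q (line x y h) = poly p h"
    by (rule poly_funs_curve[OF assms(1)], rule line_coord_poly)
      (rule poly_funs_curve[OF assms(2)], rule line_coord_poly)
  from line_avoid[of P x y Q, OF this assms(3,4)] show ?thesis .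
qed

lemma poly_funs_avoid_finite:
  assumes "finite T" and L: "\<And>x y h. x \<in> L \<Longrightarrow> y \<in> L \<Longrightarrow> line x y h \<in> L" and "L \<noteq> {}"
    and "\<And>t. t \<in> T \<Longrightarrow> p t \<in> poly_funs I" "\<And>t. t \<in> T \<Longrightarrow> \<exists>x\<in>L. p t x \<noteq> 0"
  shows "\<exists>x\<in>L. \<forall>t\<in>T. p t x \<noteq> 0"
  using assms(1,4,5)
proof (induction T rule: finite_induct)
  case empty
  then show ?case using \<open>L \<noteq> {}\<close> by auto
next
  case (insert t T)
  obtain x where x: "x \<in> L" "\<forall>t\<in>T. p t x \<noteq> 0" using insert by auto
  obtain y where y: "y \<in> L" "p t y \<noteq> 0" using insert.prems(2)[of t] by auto
  have "(\<lambda>x. \<Prod>t\<in>T. p t x) \<in> poly_funs I" "p t \<in> poly_funs I"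
    using insert by (auto intro: poly_funs_prod)
  moreover have "(\<Prod>t\<in>T. p t x) \<noteq> 0" using x insert(1) by simp
  ultimately obtain h where "(\<Prod>t\<in>T. p t (line x y h)) \<noteq> 0" "p t (line x y h) \<noteq> 0"
    using poly_funs_avoid[of "\<lambda>x. \<Prod>t\<in>T. p t x" I "p t" x y] y(2) by blast
  then show ?case using insert(1) L[OF x(1) y(1), of h] by (intro bexI[of _ "line x y h"]) auto
qed

lemma affine_space_line: "x \<in> affine_space I \<Longrightarrow> y \<in> affine_space I \<Longrightarrow> line x y h \<in> affine_space I"
  by (auto simp: affine_space_def line_def)

section \<open>Closed sets of the Zariski topology\<close>

lemma topspace_zariski [simp]: "topspace (zariski I) = affine_space I"
proof -
  have "affine_space I \<in> {{x \<in> affine_space I. p x \<noteq> 0} |p. p \<in> poly_funs I}"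
    unfolding mem_Collect_eq by (rule exI[of _ "\<lambda>x. 1"]) (simp add: poly_funs.const)
  then show ?thesis unfolding zariski_def topology_generated_by_topspace by blast
qed

lemma openin_zariski_basic:
  "p \<in> poly_funs I \<Longrightarrow> openin (zariski I) {x \<in> affine_space I. p x \<noteq> 0}"
  unfolding zariski_def by (rule topology_generated_by_Basis) auto

lemma openin_zariski_nbhd:
  assumes "openin (zariski I) U" "x \<in> U"
  shows "\<exists>p\<in>poly_funs I. p x \<noteq> 0 \<and> (\<forall>y\<in>affine_space I. p y \<noteq> 0 \<longrightarrow> y \<in> U)"
proof -
  have "generate_topology_on {{x \<in> affine_space I. p x \<noteq> 0} |p. p \<in> poly_funs I} U"
    using assms(1) unfolding zariski_def by (simp add: openin_topology_generated_by_iff)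
  then show ?thesis using assms(2)
  proof (induction arbitrary: x)
    case (Int a b)
    have x: "x \<in> a" "x \<in> b" using Int.prems by auto
    obtain p where "p\<in>poly_funs I" "p x \<noteq> 0" "\<forall>y\<in>affine_space I. p y \<noteq> 0 \<longrightarrow> y \<in> a"
      using Int.IH(1)[OF x(1)] by auto
    moreover obtain q where "q\<in>poly_funs I" "q x \<noteq> 0" "\<forall>y\<in>affine_space I. q y \<noteq> 0 \<longrightarrow> y \<in> b"
      using Int.IH(2)[OF x(2)] by auto
    ultimately show ?case by (intro bexI[of _ "\<lambda>x. p x * q x"] poly_funs.mult) auto
  next
    case (UN K)
    then obtain k where k: "k \<in> K" "x \<in> k" by auto
    from UN(2)[OF k] obtain p where "p\<in>poly_funs I" "p x \<noteq> 0" "\<forall>y\<in>affine_space I. p y \<noteq> 0 \<longrightarrow> y \<in> k"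
      by auto
    then show ?case using k by (intro bexI[of _ p]) auto
  next
    case (Basis s)
    then obtain p where "p \<in> poly_funs I" "s = {x \<in> affine_space I. p x \<noteq> 0}" by auto
    then show ?case using Basis(2) by (intro bexI[of _ p]) auto
  qed auto
qed

lemma closedin_zariski_separate:
  assumes "M \<subseteq> affine_space I" "closedin (subtopology (zariski I) M) Z" "x \<in> M" "x \<notin> Z"
  shows "\<exists>p\<in>poly_funs I. p x \<noteq> 0 \<and> (\<forall>z\<in>Z. p z = 0)"
proof -
  have Z: "Z \<subseteq> M" using assms(2) closedin_subset by fastforce
  have "openin (subtopology (zariski I) M) (topspace (subtopology (zariski I) M) - Z)"
    by (rule openin_diff[OF openin_topspace assms(2)])
  then obtain U where U: "openin (zariski I) U" "M \<inter> affine_space I - Z = U \<inter> M"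
    by (auto simp: openin_subtopology Int_commute)
  have "x \<in> U" using U assms by auto
  from openin_zariski_nbhd[OF U(1) this] obtain p where
    p: "p\<in>poly_funs I" "p x \<noteq> 0" "\<forall>y\<in>affine_space I. p y \<noteq> 0 \<longrightarrow> y \<in> U" by auto
  have "p z = 0" if "z \<in> Z" for z
    using p(3) U(2) Z that assms(1) by blast
  with p show ?thesis by auto
qed

lemma closedin_zariski_zeros:
  assumes "M \<subseteq> affine_space I" "p \<in> poly_funs I"
  shows "closedin (subtopology (zariski I) M) {x \<in> M. p x = 0}"
proof -
  have "closedin (zariski I) (affine_space I - {x \<in> affine_space I. p x \<noteq> 0})"
    using closedin_diff[OF closedin_topspace openin_zariski_basic[OF assms(2)]] by simp
  then have "closedin (subtopology (zariski I) M) ((affine_space I - {x \<in> affine_space I. p x \<noteq> 0}) \<inter> M)"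
    by (rule closedin_subtopology_Int_closed[where X="zariski I", THEN back_subst[of "closedin _"]]) auto
  moreover have "(affine_space I - {x \<in> affine_space I. p x \<noteq> 0}) \<inter> M = {x \<in> M. p x = 0}"
    using assms(1) by auto
  ultimately show ?thesis by simp
qed

text \<open>The zero sets of the two factors are closed and cover \<open>Z\<close>.\<close>

lemma irreducible_closed_mult:
  assumes M: "M \<subseteq> affine_space I" and Z: "irreducible_closed (subtopology (zariski I) M) Z"
    and pq: "p \<in> poly_funs I" "q \<in> poly_funs I" and 0: "\<And>z. z \<in> Z \<Longrightarrow> p z * q z = 0"
  shows "(\<forall>z\<in>Z. p z = 0) \<or> (\<forall>z\<in>Z. q z = 0)"
proof -
  have "Z \<subseteq> M" using Z closedin_subset unfolding irreducible_closed_def by fastforce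
  then have "Z \<subseteq> {x \<in> M. p x = 0} \<union> {x \<in> M. q x = 0}" using 0 by auto
  then have "Z \<subseteq> {x \<in> M. p x = 0} \<or> Z \<subseteq> {x \<in> M. q x = 0}"
    using Z closedin_zariski_zeros[OF M pq(1)] closedin_zariski_zeros[OF M pq(2)]
    unfolding irreducible_closed_def by blast
  then show ?thesis by auto
qed

section \<open>Linear dependence of finite families\<close>

lemma sum_fun_apply: "(\<Sum>a\<in>A. f a) x = (\<Sum>a\<in>A. f a x)"
  for f :: "'a \<Rightarrow> 'b \<Rightarrow> complex"
  by (induction A rule: infinite_finite_induct) auto

lemma dependent_family:
  assumes T: "finite T" and A: "finite A" and v: "\<And>a. a \<in> A \<Longrightarrow> v a \<in> cfun.span T" and c: "card T < card A"
  shows "\<exists>u. (\<exists>a\<in>A. u a \<noteq> 0) \<and> (\<forall>x. (\<Sum>a\<in>A. u a * v a x) = 0)"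
proof (cases "inj_on v A")
  case True
  have "\<not> cfun.independent (v ` A)"
  proof
    assume "cfun.independent (v ` A)"
    then have "card (v ` A) \<le> card T" using cfun.independent_span_bound[OF T, of "v ` A"] v by auto
    then show False using c card_image[OF True] by simp
  qed
  then obtain t u where t: "finite t" "t \<subseteq> v ` A" "(\<Sum>w\<in>t. cscale (u w) w) = 0" "\<exists>w\<in>t. u w \<noteq> 0"
    unfolding cfun.dependent_explicit by auto
  define u' where "u' a = (if v a \<in> t then u (v a) else 0)" for a
  have "(\<Sum>a\<in>A. cscale (u' a) (v a)) = (\<Sum>w\<in>v ` A. cscale (if w \<in> t then u w else 0) w)"
    using True by (simp add: sum.reindex u'_def)
  also have "\<dots> = (\<Sum>w\<in>t. cscale (u w) w)"
    by (rule sum.mono_neutral_cong_right) (use t A in \<open>auto simp: cscale_def zero_fun_def\<close>)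
  also have "\<dots> = 0" by (rule t(3))
  finally have eq: "(\<Sum>a\<in>A. cscale (u' a) (v a)) = 0" .
  have "(\<Sum>a\<in>A. u' a * v a x) = 0" for x
    using fun_cong[OF eq, of x] by (simp add: sum_fun_apply cscale_def)
  moreover have "\<exists>a\<in>A. u' a \<noteq> 0" using t by (auto simp: u'_def)
  ultimately show ?thesis by blast
next
  case False
  then obtain a b where ab: "a \<in> A" "b \<in> A" "a \<noteq> b" "v a = v b" by (auto simp: inj_on_def)
  define u where "u x = (if x = a then 1 else if x = b then -1 else (0::complex))" for x
  have "(\<Sum>i\<in>A. u i * v i x) = (\<Sum>i\<in>{a,b}. u i * v i x)" for x
    by (rule sum.mono_neutral_right) (use ab A in \<open>auto simp: u_def\<close>)
  then have "(\<Sum>i\<in>A. u i * v i x) = 0" for x using ab by (simp add: u_def)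
  moreover have "\<exists>a\<in>A. u a \<noteq> 0" using ab by (auto simp: u_def)
  ultimately show ?thesis by blast
qed

definition indep_fam :: "'s set \<Rightarrow> ('s \<Rightarrow> 'k \<Rightarrow> complex) \<Rightarrow> 'k set \<Rightarrow> bool" where
  "indep_fam T v K \<longleftrightarrow> (\<forall>u. (\<forall>\<kappa>\<in>K. (\<Sum>s\<in>T. u s * v s \<kappa>) = 0) \<longrightarrow> (\<forall>s\<in>T. u s = 0))"

lemma indep_fam_card_le:
  assumes "indep_fam T v K" "finite T" "finite K"
  shows "card T \<le> card K"
proof (rule ccontr)
  assume less: "\<not> card T \<le> card K"
  define w where "w s = (\<lambda>\<kappa>. if \<kappa> \<in> K then v s \<kappa> else 0)" for s
  define e where "e = (\<lambda>\<kappa>::'b. (\<lambda>x. if x = \<kappa> then 1 else (0::complex)))"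
  have "w s = (\<Sum>\<kappa>\<in>K. cscale (v s \<kappa>) (e \<kappa>))" for s
    by (rule ext) (simp add: sum_fun_apply cscale_def w_def e_def assms(3) if_distrib cong: if_cong)
  moreover have "(\<Sum>\<kappa>\<in>K. cscale (v s \<kappa>) (e \<kappa>)) \<in> cfun.span (e ` K)" for s
    by (intro cfun.span_sum cfun.span_scale cfun.span_base) auto
  ultimately have "w s \<in> cfun.span (e ` K)" for s by simp
  moreover have "card (e ` K) \<le> card K" using assms(3) by (rule card_image_le)
  ultimately obtain u where u: "\<exists>a\<in>T. u a \<noteq> 0" "\<forall>x. (\<Sum>a\<in>T. u a * w a x) = 0"
    using dependent_family[of "e ` K" T w] assms less by fastforce
  have "(\<Sum>s\<in>T. u s * v s \<kappa>) = 0" if "\<kappa> \<in> K" for \<kappa>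
    using spec[OF u(2), of \<kappa>] that by (simp add: w_def)
  then show False using assms(1) u(1) unfolding indep_fam_def by blast
qed

section \<open>Algebraic independence and codimension\<close>

definition alg_indep_on :: "('i \<Rightarrow> complex) set \<Rightarrow> nat \<Rightarrow> (nat \<Rightarrow> ('i \<Rightarrow> complex) \<Rightarrow> complex) \<Rightarrow> bool" where
  "alg_indep_on Z b q \<longleftrightarrow> (\<forall>P\<in>poly_funs {..<b}. (\<forall>x\<in>Z. P (\<lambda>j. q j x) = 0) \<longrightarrow> (\<forall>y. P y = 0))"

lemma poly_funs_expand:
  "P \<in> poly_funs (insert b J) \<Longrightarrow>
    \<exists>D Q. (\<forall>l. Q l \<in> poly_funs J) \<and> (\<forall>y. P y = (\<Sum>l\<le>(D::nat). Q l y * y b ^ l))"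
proof (induction rule: poly_funs.induct)
  case (const z)
  show ?case by (intro exI[of _ 0] exI[of _ "\<lambda>l x. z"]) (auto intro: poly_funs.intros)
next
  case (coord i)
  show ?case
  proof (cases "i = b")
    case True
    show ?thesis
      by (intro exI[of _ 1] exI[of _ "\<lambda>l x. if l = 1 then 1 else 0"]) (auto intro: poly_funs.intros simp: True)
  next
    case False
    then show ?thesis using coord
      by (intro exI[of _ 0] exI[of _ "\<lambda>l x. x i"]) (auto intro: poly_funs.intros)
  qed
next
  case (add p q)
  obtain D1 Q1 where 1: "\<forall>l. Q1 l \<in> poly_funs J" "\<forall>y. p y = (\<Sum>l\<le>(D1::nat). Q1 l y * y b ^ l)"
    using add by auto
  obtain D2 Q2 where 2: "\<forall>l. Q2 l \<in> poly_funs J" "\<forall>y. q y = (\<Sum>l\<le>(D2::nat). Q2 l y * y b ^ l)"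
    using add by auto
  define Q where "Q l y = (if l \<le> D1 then Q1 l y else 0) + (if l \<le> D2 then Q2 l y else 0)" for l y
  have "Q l \<in> poly_funs J" for l
    unfolding Q_def using 1 2 by (cases "l \<le> D1"; cases "l \<le> D2") (auto intro: poly_funs.intros)
  moreover have "p y + q y = (\<Sum>l\<le>D1 + D2. Q l y * y b ^ l)" for y
  proof -
    have "(\<Sum>l\<le>D1. Q1 l y * y b ^ l) = (\<Sum>l\<le>D1 + D2. (if l \<le> D1 then Q1 l y else 0) * y b ^ l)"
      by (rule sum.mono_neutral_cong_left) auto
    moreover have "(\<Sum>l\<le>D2. Q2 l y * y b ^ l) = (\<Sum>l\<le>D1 + D2. (if l \<le> D2 then Q2 l y else 0) * y b ^ l)"
      by (rule sum.mono_neutral_cong_left) auto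
    ultimately show ?thesis using 1 2 by (simp add: Q_def distrib_right sum.distrib)
  qed
  ultimately show ?case by blast
next
  case (mult p q)
  obtain D1 Q1 where 1: "\<forall>l. Q1 l \<in> poly_funs J" "\<forall>y. p y = (\<Sum>l\<le>(D1::nat). Q1 l y * y b ^ l)"
    using mult by auto
  obtain D2 Q2 where 2: "\<forall>l. Q2 l \<in> poly_funs J" "\<forall>y. q y = (\<Sum>l\<le>(D2::nat). Q2 l y * y b ^ l)"
    using mult by auto
  define Q where "Q l y = (\<Sum>(i,j) | i \<le> D1 \<and> j \<le> D2 \<and> i + j = l. Q1 i y * Q2 j y)" for l y
  have "Q l \<in> poly_funs J" for l
    unfolding Q_def using 1 2 by (auto intro!: poly_funs_sum poly_funs.intros)
  moreover have "p y * q y = (\<Sum>l\<le>D1 + D2. Q l y * y b ^ l)" for y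
  proof -
    have "p y * q y = (\<Sum>(i,j)\<in>{..D1}\<times>{..D2}. Q1 i y * Q2 j y * y b ^ (i + j))"
      using 1 2 by (simp add: sum_product sum.cartesian_product power_add algebra_simps)
    also have "\<dots> = (\<Sum>l\<le>D1+D2. \<Sum>(i,j) | (i,j) \<in> {..D1}\<times>{..D2} \<and> i + j = l. Q1 i y * Q2 j y * y b ^ (i + j))"
      by (subst sum.group[of "{..D1}\<times>{..D2}" "{..D1+D2}" "\<lambda>(i,j). i+j", symmetric])
        (auto intro!: sum.cong)
    also have "\<dots> = (\<Sum>l\<le>D1+D2. Q l y * y b ^ l)"
      unfolding Q_def sum_distrib_right by (intro sum.cong refl) (auto)
    finally show ?thesis .
  qed
  ultimately show ?case by blast
qed

text \<open>Expand a relation \<open>P\<close> between the \<open>q j\<close> and \<open>f\<close> in powers of \<open>f\<close>. The lowest nonzero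
  coefficient is a relation between the \<open>q j\<close> alone: on \<open>Z'\<close> the power of \<open>f\<close> in front of it can be
  cancelled, and on \<open>Z\<close> the higher terms vanish together with \<open>f\<close>.\<close>

lemma alg_indep_on_extend:
  assumes M: "M \<subseteq> affine_space I" and Z': "irreducible_closed (subtopology (zariski I) M) Z'"
    and Z: "Z \<subseteq> Z'" and q: "\<And>j. j < b \<Longrightarrow> q j \<in> poly_funs I" and f: "f \<in> poly_funs I"
    and f0: "\<And>z. z \<in> Z \<Longrightarrow> f z = 0" and f1: "x' \<in> Z'" "f x' \<noteq> 0" and ind: "alg_indep_on Z b q"
  shows "alg_indep_on Z' (Suc b) (q(b := f))"
  unfolding alg_indep_on_def
proof (intro ballI impI allI)
  fix P :: "(nat \<Rightarrow> complex) \<Rightarrow> complex" and y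
  assume P: "P \<in> poly_funs {..<Suc b}" and P0: "\<forall>x\<in>Z'. P (\<lambda>j. (q(b := f)) j x) = 0"
  obtain D Q where Q: "\<forall>l. Q l \<in> poly_funs {..<b}" "\<forall>y. P y = (\<Sum>l\<le>D. Q l y * y b ^ l)"
    using poly_funs_expand[of P b "{..<b}"] P by (auto simp: lessThan_Suc)
  have Qq: "Q l (\<lambda>j. (q(b := f)) j x) = Q l (\<lambda>j. q j x)" for l x
    by (rule poly_funs_cong[of _ "{..<b}"]) (use Q in auto)
  have sum0: "(\<Sum>l\<le>D. Q l (\<lambda>j. q j x) * f x ^ l) = 0" if "x \<in> Z'" for x
    using P0 that Q(2) Qq by simp
  have "l \<le> D \<longrightarrow> (\<forall>y. Q l y = 0)" for l
  proof (induction l rule: less_induct)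
    case (less l)
    show ?case
    proof
      assume l: "l \<le> D"
      define R where "R x = (\<Sum>l'\<in>{l..D}. Q l' (\<lambda>j. q j x) * f x ^ (l' - l))" for x
      have R: "R \<in> poly_funs I" unfolding R_def
        using Q f q by (auto intro!: poly_funs_sum poly_funs.mult poly_funs_power intro: poly_funs_subst)
      have "f x ^ l * R x = 0" if x: "x \<in> Z'" for x
      proof -
        have "(\<Sum>l'\<le>D. Q l' (\<lambda>j. q j x) * f x ^ l') = (\<Sum>l'\<in>{l..D}. Q l' (\<lambda>j. q j x) * f x ^ l')"
          by (rule sum.mono_neutral_right) (use less in auto)
        also have "\<dots> = f x ^ l * R x"
          unfolding R_def sum_distrib_left
          by (rule sum.cong) (auto simp flip: power_add)
        finally show ?thesis using sum0[OF x] by simp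
      qed
      then have "\<forall>z\<in>Z'. R z = 0"
        using irreducible_closed_mult[OF M Z' poly_funs_power[OF f] R] f1 by auto
      moreover have "R z = Q l (\<lambda>j. q j z)" if "z \<in> Z" for z
      proof -
        have "R z = (\<Sum>l'\<in>{l}. Q l' (\<lambda>j. q j z) * f z ^ (l' - l))"
          unfolding R_def by (rule sum.mono_neutral_right) (use l f0[OF that] in auto)
        then show ?thesis by simp
      qed
      ultimately have "\<forall>z\<in>Z. Q l (\<lambda>j. q j z) = 0" using Z by (metis subsetD)
      then show "\<forall>y. Q l y = 0" using ind Q(1) unfolding alg_indep_on_def by blast
    qed
  qed
  then show "P y = 0" using Q(2) by simp
qed

definition box_monomials :: "'i set \<Rightarrow> nat \<Rightarrow> (('i \<Rightarrow> complex) \<Rightarrow> complex) set" where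
  "box_monomials I D = (\<lambda>a x. \<Prod>i\<in>I. x i ^ a i) ` (PiE I (\<lambda>_. {..D}))"

lemma finite_box_monomials: "finite I \<Longrightarrow> finite (box_monomials I D)"
  by (auto simp: box_monomials_def finite_PiE)

lemma card_box_monomials: "finite I \<Longrightarrow> card (box_monomials I D) \<le> (D + 1) ^ card I"
  unfolding box_monomials_def
  by (rule order_trans[OF card_image_le]) (auto simp: finite_PiE card_PiE)

lemma box_monomialsI:
  assumes "\<And>i. i \<in> I \<Longrightarrow> a i \<le> D"
  shows "(\<lambda>x. \<Prod>i\<in>I. x i ^ a i) \<in> box_monomials I D"
proof -
  have "(\<lambda>x. \<Prod>i\<in>I. x i ^ a i) = (\<lambda>x. \<Prod>i\<in>I. x i ^ restrict a I i)"
    by (auto intro!: prod.cong)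
  then show ?thesis unfolding box_monomials_def using assms by (auto intro!: image_eqI[of _ _ "restrict a I"])
qed

lemma box_monomials_mono: "D \<le> D' \<Longrightarrow> box_monomials I D \<subseteq> box_monomials I D'"
  unfolding box_monomials_def by (intro image_mono PiE_mono) auto

lemma box_monomials_mult:
  assumes "p \<in> cfun.span (box_monomials I D)" "q \<in> cfun.span (box_monomials I D')"
  shows "(\<lambda>x. p x * q x) \<in> cfun.span (box_monomials I (D + D'))"
proof -
  have mono: "(\<lambda>x. p x * q x) \<in> cfun.span (box_monomials I (D + D'))" if pq: "p \<in> box_monomials I D" "q \<in> box_monomials I D'" for p q
  proof -
    obtain a a' where "a \<in> PiE I (\<lambda>_. {..D})" "a' \<in> PiE I (\<lambda>_. {..D'})"
      "p = (\<lambda>x. \<Prod>i\<in>I. x i ^ a i)" "q = (\<lambda>x. \<Prod>i\<in>I. x i ^ a' i)"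
      using pq unfolding box_monomials_def by blast
    then have "(\<lambda>x. p x * q x) = (\<lambda>x. \<Prod>i\<in>I. x i ^ (a i + a' i))" "\<And>i. i \<in> I \<Longrightarrow> a i + a' i \<le> D + D'"
      by (auto simp: power_add prod.distrib PiE_iff intro!: add_mono)
    then show ?thesis using box_monomialsI[of I "\<lambda>i. a i + a' i" "D + D'"] by (auto intro: cfun.span_base)
  qed
  have 1: "(\<lambda>x. p x * q x) \<in> cfun.span (box_monomials I (D + D'))" if "p \<in> box_monomials I D" for p
    using assms(2)
  proof (induction rule: cfun.span_induct_alt)
    case base
    show ?case using cfun.span_zero by (simp add: zero_fun_def)
  next
    case (step z q' r)
    have "(\<lambda>x. p x * (cscale z q' + r) x) = cscale z (\<lambda>x. p x * q' x) + (\<lambda>x. p x * r x)"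
      by (auto simp: cscale_def fun_eq_iff algebra_simps)
    then show ?case using cfun.span_add[OF cfun.span_scale[OF mono[OF that step(1)], of z] step(2)]
      by simp
  qed
  show ?thesis using assms(1)
  proof (induction rule: cfun.span_induct_alt)
    case base
    show ?case using cfun.span_zero by (simp add: zero_fun_def)
  next
    case (step z p' r)
    have "(\<lambda>x. (cscale z p' + r) x * q x) = cscale z (\<lambda>x. p' x * q x) + (\<lambda>x. r x * q x)"
      by (auto simp: cscale_def fun_eq_iff algebra_simps)
    then show ?case using cfun.span_add[OF cfun.span_scale[OF 1[OF step(1)], of z] step(2)] by simp
  qed
qed

lemma poly_funs_span_box_monomials:
  assumes "finite I"
  shows "P \<in> poly_funs I \<Longrightarrow> \<exists>D. P \<in> cfun.span (box_monomials I D)"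
proof (induction rule: poly_funs.induct)
  case (const z)
  have "cscale z (\<lambda>x. \<Prod>i\<in>I. x i ^ 0) \<in> cfun.span (box_monomials I 0)"
    by (intro cfun.span_scale cfun.span_base box_monomialsI) auto
  moreover have "cscale z (\<lambda>x. \<Prod>i\<in>I. x i ^ 0) = (\<lambda>x. z)" by (simp add: cscale_def)
  ultimately show ?case by (metis (no_types))
next
  case (coord i)
  have "(\<lambda>x. \<Prod>j\<in>I. x j ^ (if j = i then 1 else 0)) \<in> box_monomials I 1"
    by (rule box_monomialsI) auto
  moreover have "(\<Prod>j\<in>I. x j ^ (if j = i then 1 else 0)) = x i" for x :: "_ \<Rightarrow> complex"
    using coord assms by (simp add: if_distrib[of "\<lambda>e. _ ^ e"] cong: if_cong)
  ultimately show ?case by (auto intro: cfun.span_base)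
next
  case (add p q)
  then obtain D1 D2 where "p \<in> cfun.span (box_monomials I D1)" "q \<in> cfun.span (box_monomials I D2)" by auto
  then have "p \<in> cfun.span (box_monomials I (D1+D2))" "q \<in> cfun.span (box_monomials I (D1+D2))"
    using cfun.span_mono[OF box_monomials_mono[of D1 "D1+D2" I]] cfun.span_mono[OF box_monomials_mono[of D2 "D1+D2" I]]
    by auto
  then have "p + q \<in> cfun.span (box_monomials I (D1+D2))" by (rule cfun.span_add)
  then show ?case by (auto simp: plus_fun_def)
next
  case (mult p q)
  then obtain D1 D2 where "p \<in> cfun.span (box_monomials I D1)" "q \<in> cfun.span (box_monomials I D2)"
    by auto
  from box_monomials_mult[OF this] show ?case by (rule exI)
qed

lemma sum_digits: "(\<Sum>j<b. (e div k ^ j mod k) * k ^ j) = e mod k ^ b" for e k :: nat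
proof (induction b)
  case (Suc b)
  then show ?case using mod_mult2_eq[of e "k ^ b" k] by (simp add: mult.commute)
qed simp

text \<open>Of \<open>b\<close> independent polynomial functions with degrees at most \<open>D\<close> in each of the \<open>N\<close>
  variables there are \<open>k^b\<close> monomials with exponents less than \<open>k\<close>; they lie in a space of
  dimension at most \<open>(b k D + 1)^N\<close>, which for large \<open>k\<close> is only possible if \<open>b \<le> N\<close>. The
  monomials are indexed by the base-\<open>k\<close> digits of a number, so that the substitution
  \<open>y\<^sub>j = t^(k^j)\<close> turns distinct monomials into distinct powers of \<open>t\<close>.\<close>

lemma alg_indep_on_card_le:
  assumes I: "finite I" and q: "\<And>j. j < b \<Longrightarrow> q j \<in> poly_funs I" and ind: "alg_indep_on Z b q"
  shows "b \<le> card I"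
proof (rule ccontr)
  assume "\<not> b \<le> card I"
  then have b: "card I < b" by simp
  have "\<forall>j\<in>{..<b}. \<exists>D. q j \<in> cfun.span (box_monomials I D)" using poly_funs_span_box_monomials[OF I] q by auto
  then obtain Df where Df: "\<And>j. j < b \<Longrightarrow> q j \<in> cfun.span (box_monomials I (Df j))" by (metis lessThan_iff)
  define D where "D = (\<Sum>j<b. Df j)"
  have D: "q j \<in> cfun.span (box_monomials I D)" if "j < b" for j
  proof -
    have "Df j \<le> D" unfolding D_def using that by (intro member_le_sum) auto
    then show ?thesis using Df[OF that] cfun.span_mono[OF box_monomials_mono] by blast
  qed
  \<comment> \<open>The least \<open>k\<close> with \<open>(b D + 1)^N k^N < k^(N+1)\<close>, \<open>N = card I\<close>.\<close>
  define k where "k = (b * D + 1) ^ card I + 1"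
  have k: "k > 0" by (simp add: k_def)
  have pow: "(\<lambda>x. q j x ^ l) \<in> cfun.span (box_monomials I (l * D))" if "j < b" for j l
  proof (induction l)
    case 0
    have "(\<lambda>x. \<Prod>i\<in>I. x i ^ 0) \<in> box_monomials I 0" by (rule box_monomialsI) auto
    then show ?case by (auto intro: cfun.span_base)
  next
    case (Suc l)
    from box_monomials_mult[OF D[OF that] Suc] show ?case by simp
  qed
  have prod: "(\<lambda>x. \<Prod>j<b'. q j x ^ l j) \<in> cfun.span (box_monomials I (b' * k * D))"
    if "b' \<le> b" "\<And>j. l j < k" for b' and l :: "nat \<Rightarrow> nat"
    using that(1)
  proof (induction b')
    case 0
    have "(\<lambda>x. \<Prod>i\<in>I. x i ^ 0) \<in> box_monomials I 0" by (rule box_monomialsI) auto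
    then show ?case by (auto intro: cfun.span_base)
  next
    case (Suc b')
    have "(\<lambda>x. q b' x ^ l b') \<in> cfun.span (box_monomials I (k * D))"
      using pow[of b' "l b'"] Suc.prems cfun.span_mono[OF box_monomials_mono[of "l b' * D" "k * D" I]]
        that(2)[of b'] by (auto simp: less_imp_le mult_le_mono1 subset_iff)
    from box_monomials_mult[OF _ this, OF Suc.IH] Suc.prems show ?case by (simp add: algebra_simps)
  qed
  define dig where "dig e j = e div k ^ j mod k" for e j :: nat
  define v where "v e = (\<lambda>x. \<Prod>j<b. q j x ^ dig e j)" for e
  have v: "v e \<in> cfun.span (box_monomials I (b * k * D))" for e
    unfolding v_def by (rule prod) (auto simp: dig_def k)
  have "card (box_monomials I (b * k * D)) \<le> (b * k * D + 1) ^ card I" using card_box_monomials[OF I] .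
  also have "\<dots> \<le> ((b * D + 1) * k) ^ card I"
    using k by (intro power_mono) (auto simp: algebra_simps)
  also have "\<dots> = (b * D + 1) ^ card I * k ^ card I" by (rule power_mult_distrib)
  also have "\<dots> < k * k ^ card I" using k by (simp add: k_def)
  also have "\<dots> = k ^ (Suc (card I))" by simp
  also have "\<dots> \<le> k ^ b" using b k by (intro power_increasing) auto
  finally have "card (box_monomials I (b * k * D)) < card {..<k ^ b}" by simp
  with dependent_family[of "box_monomials I (b * k * D)" "{..<k^b}" v] finite_box_monomials[OF I] v
  obtain u where u: "\<exists>e<k^b. u e \<noteq> 0" "\<And>x. (\<Sum>e<k^b. u e * v e x) = 0" by auto
  define P where "P y = (\<Sum>e<k^b. u e * (\<Prod>j<b. y j ^ dig e j))" for y :: "nat \<Rightarrow> complex"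
  have "P \<in> poly_funs {..<b}" unfolding P_def
    by (intro poly_funs_sum poly_funs_scale poly_funs_prod poly_funs_power poly_funs.coord)
  moreover have "P (\<lambda>j. q j x) = 0" for x using u(2)[of x] by (simp add: P_def v_def)
  ultimately have P0: "P y = 0" for y using ind unfolding alg_indep_on_def by blast
  define p where "p = (\<Sum>e<k^b. monom (u e) e)"
  have "poly p t = 0" for t
  proof -
    have "(\<Prod>j<b. (t ^ (k ^ j)) ^ dig e j) = t ^ e" if "e < k ^ b" for e
    proof -
      have "(\<Prod>j<b. (t ^ (k ^ j)) ^ dig e j) = t ^ (\<Sum>j<b. dig e j * k ^ j)"
        by (simp add: power_sum mult.commute flip: power_mult)
      also have "(\<Sum>j<b. dig e j * k ^ j) = e" unfolding dig_def sum_digits using that by simp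
      finally show ?thesis .
    qed
    then have "P (\<lambda>j. t ^ (k ^ j)) = poly p t"
      by (simp add: P_def p_def poly_sum poly_monom)
    then show ?thesis using P0 by simp
  qed
  then have "p = 0" using poly_all_0_iff_0 by blast
  moreover have "coeff p e = u e" if "e < k ^ b" for e
    using that by (simp add: p_def coeff_sum)
  ultimately show False using u(1) by auto
qed

text \<open>Every step of a chain adds an independent function, namely one that vanishes on the smaller set
  but not on the larger one.\<close>

lemma irreducible_codim_le:
  assumes I: "finite I" and M: "M \<subseteq> affine_space I"
    and q: "\<And>j. j < b \<Longrightarrow> q j \<in> poly_funs I" and ind: "alg_indep_on Z b q"
  shows "irreducible_codim (subtopology (zariski I) M) Z \<le> enat (card I - b)"
  unfolding irreducible_codim_def
proof (rule Sup_least, clarify)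
  fix k and C :: "nat \<Rightarrow> ('a \<Rightarrow> complex) set"
  assume C: "Z = C 0" "\<forall>i\<le>k. irreducible_closed (subtopology (zariski I) M) (C i)" "\<forall>i<k. C i \<subset> C (Suc i)"
  have "\<exists>q. (\<forall>j<b + i. q j \<in> poly_funs I) \<and> alg_indep_on (C i) (b + i) q" if "i \<le> k" for i
    using that
  proof (induction i)
    case 0
    then show ?case using q ind C(1) by auto
  next
    case (Suc i)
    then obtain q where q: "\<forall>j<b + i. q j \<in> poly_funs I" "alg_indep_on (C i) (b + i) q" by auto
    have irr: "irreducible_closed (subtopology (zariski I) M) (C i)"
       "irreducible_closed (subtopology (zariski I) M) (C (Suc i))" using C Suc by auto
    have sub: "C i \<subset> C (Suc i)" using C(3) Suc.prems by auto
    obtain x where x: "x \<in> C (Suc i)" "x \<notin> C i" using sub by auto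
    have "C (Suc i) \<subseteq> M" using irr(2) closedin_subset unfolding irreducible_closed_def by fastforce
    then obtain f where f: "f \<in> poly_funs I" "f x \<noteq> 0" "\<forall>z\<in>C i. f z = 0"
      using closedin_zariski_separate[OF M _ _ x(2)] irr(1) x(1) unfolding irreducible_closed_def by blast
    have "alg_indep_on (C (Suc i)) (Suc (b + i)) (q(b + i := f))"
      using alg_indep_on_extend[OF M irr(2), of "C i" "b + i" q f x] sub q f x by auto
    then show ?case using q(1) f(1) by (intro exI[of _ "q(b + i := f)"]) (auto simp del: fun_upd_apply simp: fun_upd_def less_Suc_eq)
  qed
  then obtain q where "\<forall>j<b + k. q j \<in> poly_funs I" "alg_indep_on (C k) (b + k) q" by blast
  then have "b + k \<le> card I" using alg_indep_on_card_le[OF I, of "b + k" q "C k"] by auto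
  then show "enat k \<le> enat (card I - b)" by simp
qed

section \<open>Orders of vanishing of linear combinations of power series\<close>

definition lincomb :: "'a set \<Rightarrow> ('a \<Rightarrow> complex fps) \<Rightarrow> complex fps set" where
  "lincomb A v = {\<Sum>a\<in>A. fps_const (u a) * v a |u. True}"

definition orders :: "complex fps set \<Rightarrow> nat set" where
  "orders X = subdegree ` (X - {0})"

lemma lincombI: "(\<Sum>a\<in>A. fps_const (u a) * v a) \<in> lincomb A v"
  by (auto simp: lincomb_def)

lemma lincomb_base: "finite A \<Longrightarrow> a \<in> A \<Longrightarrow> v a \<in> lincomb A v"
  using lincombI[of "\<lambda>b. if b = a then 1 else 0" v A]
  by (simp add: if_distrib[of fps_const] if_distrib[of "\<lambda>z. z * _"] cong: if_cong)

lemma lincomb_zero: "0 \<in> lincomb A v"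
  using lincombI[of "\<lambda>_. 0" v A] by simp

lemma lincomb_add:
  assumes "x \<in> lincomb A v" "y \<in> lincomb A v"
  shows "x + y \<in> lincomb A v"
proof -
  obtain u u' where "x = (\<Sum>a\<in>A. fps_const (u a) * v a)" "y = (\<Sum>a\<in>A. fps_const (u' a) * v a)"
    using assms by (auto simp: lincomb_def)
  then have "x + y = (\<Sum>a\<in>A. fps_const (u a + u' a) * v a)"
    by (simp add: distrib_right sum.distrib flip: fps_const_add)
  then show ?thesis by (simp only: lincombI)
qed

lemma lincomb_scale:
  assumes "x \<in> lincomb A v"
  shows "fps_const z * x \<in> lincomb A v"
proof -
  obtain u where "x = (\<Sum>a\<in>A. fps_const (u a) * v a)" using assms by (auto simp: lincomb_def)
  then have "fps_const z * x = (\<Sum>a\<in>A. fps_const (z * u a) * v a)"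
    by (simp add: sum_distrib_left mult.assoc flip: fps_const_mult)
  then show ?thesis by (simp only: lincombI)
qed

lemma lincomb_sum: "(\<And>t. t \<in> T \<Longrightarrow> x t \<in> lincomb A v) \<Longrightarrow> (\<Sum>t\<in>T. x t) \<in> lincomb A v"
  by (induction T rule: infinite_finite_induct) (auto intro: lincomb_zero lincomb_add)

lemma lincomb_least:
  assumes "x \<in> lincomb A v" and "\<And>a. a \<in> A \<Longrightarrow> v a \<in> lincomb B w"
  shows "x \<in> lincomb B w"
proof -
  obtain u where "x = (\<Sum>a\<in>A. fps_const (u a) * v a)" using assms by (auto simp: lincomb_def)
  then show ?thesis using assms(2) by (auto intro!: lincomb_sum lincomb_scale)
qed

lemma lincomb_mult:
  assumes "x \<in> lincomb A v" "y \<in> lincomb B w"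
    and "\<And>a b. a \<in> A \<Longrightarrow> b \<in> B \<Longrightarrow> v a * w b \<in> lincomb C z"
  shows "x * y \<in> lincomb C z"
proof -
  obtain u u' where "x = (\<Sum>a\<in>A. fps_const (u a) * v a)" "y = (\<Sum>b\<in>B. fps_const (u' b) * w b)"
    using assms(1,2) by (auto simp: lincomb_def)
  then have "x * y = (\<Sum>a\<in>A. \<Sum>b\<in>B. fps_const (u a * u' b) * (v a * w b))"
    by (simp add: sum_product algebra_simps flip: fps_const_mult)
  then show ?thesis using assms(3) by (auto intro!: lincomb_sum lincomb_scale)
qed

lemma nth_lincomb: "(\<Sum>a\<in>A. fps_const (u a) * v a) $ \<kappa> = (\<Sum>a\<in>A. u a * v a $ \<kappa>)"
  for v :: "'a \<Rightarrow> complex fps"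
  by (simp add: fps_sum_nth)

lemma ordersE:
  assumes "s \<in> orders X"
  obtains x where "x \<in> X" "x $ s \<noteq> 0" "\<forall>\<kappa><s. x $ \<kappa> = 0"
proof -
  obtain x where x: "x \<in> X" "x \<noteq> 0" "subdegree x = s" using assms unfolding orders_def by auto
  show ?thesis
    by (rule that[OF x(1)]) (use x nth_subdegree_nonzero[OF x(2)] in \<open>auto intro: nth_less_subdegree_zero\<close>)
qed

lemma ordersI: "x \<in> X \<Longrightarrow> x \<noteq> 0 \<Longrightarrow> subdegree x \<in> orders X"
  unfolding orders_def by auto

lemma order_representatives:
  assumes "T \<subseteq> orders (lincomb A v)"
  shows "\<exists>u. \<forall>s\<in>T. (\<Sum>a\<in>A. u s a * v a $ s) \<noteq> 0 \<and> (\<forall>\<kappa><s. (\<Sum>a\<in>A. u s a * v a $ \<kappa>) = 0)"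
proof (intro bchoice ballI)
  fix s assume "s \<in> T"
  then have "s \<in> orders (lincomb A v)" using assms by blast
  then obtain x where x: "x \<in> lincomb A v" "x $ s \<noteq> 0" "\<forall>\<kappa><s. x $ \<kappa> = 0" by (rule ordersE)
  then obtain u where "x = (\<Sum>a\<in>A. fps_const (u a) * v a)" by (auto simp: lincomb_def)
  then show "\<exists>u. (\<Sum>a\<in>A. u a * v a $ s) \<noteq> 0 \<and> (\<forall>\<kappa><s. (\<Sum>a\<in>A. u a * v a $ \<kappa>) = 0)"
    using x by (intro exI[of _ u]) (simp add: nth_lincomb)
qed

lemma distinct_orders_indep:
  assumes "finite T" "T \<subseteq> K" "\<And>s. s \<in> T \<Longrightarrow> y s $ s \<noteq> 0" "\<And>s \<kappa>. s \<in> T \<Longrightarrow> \<kappa> < s \<Longrightarrow> y s $ \<kappa> = 0"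
  shows "indep_fam T (\<lambda>s \<kappa>. (y s :: complex fps) $ \<kappa>) K"
  unfolding indep_fam_def
proof (intro allI impI ballI)
  fix u s assume 0: "\<forall>\<kappa>\<in>K. (\<Sum>s\<in>T. u s * y s $ \<kappa>) = 0" and "s \<in> T"
  then show "u s = 0"
  proof (induction s rule: less_induct)
    case (less s)
    have "(\<Sum>s'\<in>T. u s' * y s' $ s) = (\<Sum>s'\<in>{s}. u s' * y s' $ s)"
      by (rule sum.mono_neutral_right) (use less assms in \<open>auto, metis linorder_neqE_nat\<close>)
    then have "u s * y s $ s = 0" using 0 less assms by auto
    then show ?case using assms less by auto
  qed
qed

text \<open>Gaussian elimination without division; the polynomial is the product of the pivots.\<close>

lemma indep_fam_open:
  assumes "finite T" "\<And>s \<kappa>. s \<in> T \<Longrightarrow> \<kappa> \<in> K \<Longrightarrow> (\<lambda>w. y w s \<kappa>) \<in> poly_funs J" "indep_fam T (y w0) K"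
  shows "\<exists>p\<in>poly_funs J. p w0 \<noteq> 0 \<and> (\<forall>w. p w \<noteq> 0 \<longrightarrow> indep_fam T (y w) K)"
  using assms
proof (induction T arbitrary: y rule: finite_induct)
  case empty
  show ?case by (rule bexI[of _ "\<lambda>_. 1"]) (simp_all add: indep_fam_def poly_funs.const)
next
  case (insert s T)
  obtain \<kappa>0 where \<kappa>0: "\<kappa>0 \<in> K" "y w0 s \<kappa>0 \<noteq> 0"
  proof (rule ccontr)
    assume "\<not> thesis"
    then have "\<forall>\<kappa>\<in>K. y w0 s \<kappa> = 0" using that by auto
    moreover have "(\<Sum>\<tau>\<in>insert s T. (if \<tau> = s then 1 else 0) * y w0 \<tau> \<kappa>) = y w0 s \<kappa>" for \<kappa>
      using insert(1,2) by (simp add: if_distrib[of "\<lambda>z. z * _"] cong: if_cong)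
    ultimately have "\<forall>\<tau>\<in>insert s T. (if \<tau> = s then 1 else 0) = (0::complex)"
      using insert.prems(2)[unfolded indep_fam_def, THEN spec, of "\<lambda>\<tau>. if \<tau> = s then 1 else 0"] by simp
    then show False by simp
  qed
  \<comment> \<open>Row \<open>s\<close> is used to clear column \<open>\<kappa>0\<close> in all other rows.\<close>
  define y' where "y' w \<tau> \<kappa> = y w s \<kappa>0 * y w \<tau> \<kappa> - y w \<tau> \<kappa>0 * y w s \<kappa>" for w \<tau> \<kappa>
  have y'_poly: "(\<lambda>w. y' w \<tau> \<kappa>) \<in> poly_funs J" if "\<tau> \<in> T" "\<kappa> \<in> K" for \<tau> \<kappa>
    unfolding y'_def using that \<kappa>0 insert.prems(1) by (intro poly_funs_diff poly_funs.mult) auto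
  have y'_sum: "(\<Sum>\<tau>\<in>T. u \<tau> * y' w \<tau> \<kappa>)
      = y w s \<kappa>0 * (\<Sum>\<tau>\<in>T. u \<tau> * y w \<tau> \<kappa>) - (\<Sum>\<tau>\<in>T. u \<tau> * y w \<tau> \<kappa>0) * y w s \<kappa>" for u w \<kappa>
    by (simp add: y'_def algebra_simps sum_subtractf sum_distrib_left sum_distrib_right)
  have "indep_fam T (y' w0) K"
    unfolding indep_fam_def
  proof (intro allI impI)
    fix u assume u: "\<forall>\<kappa>\<in>K. (\<Sum>\<tau>\<in>T. u \<tau> * y' w0 \<tau> \<kappa>) = 0"
    define u' where "u' \<tau> = (if \<tau> = s then - (\<Sum>\<tau>\<in>T. u \<tau> * y w0 \<tau> \<kappa>0) else y w0 s \<kappa>0 * u \<tau>)" for \<tau>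
    have "(\<Sum>\<tau>\<in>insert s T. u' \<tau> * y w0 \<tau> \<kappa>) = (\<Sum>\<tau>\<in>T. u \<tau> * y' w0 \<tau> \<kappa>)" for \<kappa>
    proof -
      have "(\<Sum>\<tau>\<in>T. u' \<tau> * y w0 \<tau> \<kappa>) = (\<Sum>\<tau>\<in>T. y w0 s \<kappa>0 * (u \<tau> * y w0 \<tau> \<kappa>))"
        by (rule sum.cong) (use insert(2) in \<open>auto simp: u'_def\<close>)
      then show ?thesis using insert(1,2) unfolding y'_sum
        by (simp add: u'_def[of s] sum_distrib_left)
    qed
    then have "\<forall>\<tau>\<in>insert s T. u' \<tau> = 0"
      using u insert.prems(2)[unfolded indep_fam_def, THEN spec, of u'] by simp
    then show "\<forall>\<tau>\<in>T. u \<tau> = 0" using insert(2) \<kappa>0 by (auto simp: u'_def split: if_splits)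
  qed
  from insert.IH[OF y'_poly this] obtain p where
    p: "p\<in>poly_funs J" "p w0 \<noteq> 0" "\<And>w. p w \<noteq> 0 \<Longrightarrow> indep_fam T (y' w) K" by blast
  have "indep_fam (insert s T) (y w) K" if w: "p w \<noteq> 0" "y w s \<kappa>0 \<noteq> 0" for w
    unfolding indep_fam_def
  proof (intro allI impI)
    fix u assume u: "\<forall>\<kappa>\<in>K. (\<Sum>\<tau>\<in>insert s T. u \<tau> * y w \<tau> \<kappa>) = 0"
    then have u': "(\<Sum>\<tau>\<in>T. u \<tau> * y w \<tau> \<kappa>) = - u s * y w s \<kappa>" if "\<kappa> \<in> K" for \<kappa>
      using that insert(1,2) by (simp add: eq_neg_iff_add_eq_0 add.commute)
    have "(\<Sum>\<tau>\<in>T. u \<tau> * y' w \<tau> \<kappa>) = 0" if "\<kappa> \<in> K" for \<kappa>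
      unfolding y'_sum u'[OF that] u'[OF \<kappa>0(1)] by simp
    then have T: "\<forall>\<tau>\<in>T. u \<tau> = 0" using p(3)[OF w(1)] unfolding indep_fam_def by blast
    then have "u s * y w s \<kappa>0 = 0" using u'[OF \<kappa>0(1)] by simp
    then show "\<forall>\<tau>\<in>insert s T. u \<tau> = 0" using T w(2) by simp
  qed
  moreover have "(\<lambda>w. p w * y w s \<kappa>0) \<in> poly_funs J"
    using p insert.prems(1) \<kappa>0 by (intro poly_funs.mult) auto
  ultimately show ?case using p(2) \<kappa>0(2) by (intro bexI[of _ "\<lambda>w. p w * y w s \<kappa>0"]) auto
qed

text \<open>A combination of the \<open>x s\<close> that is nonzero modulo \<open>t^j\<close> has a nonzero coefficient at its own
  order, so the coefficients at the orders below \<open>j\<close> suffice to detect independence.\<close>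

lemma card_orders_ge:
  assumes "finite T" "\<And>s. s \<in> T \<Longrightarrow> x s \<in> lincomb A v"
    and ind: "indep_fam T (\<lambda>s \<kappa>. x s $ \<kappa>) {..<j}"
  shows "card T \<le> card (orders (lincomb A v) \<inter> {..<j})"
proof (rule indep_fam_card_le)
  show "indep_fam T (\<lambda>s \<kappa>. x s $ \<kappa>) (orders (lincomb A v) \<inter> {..<j})"
    unfolding indep_fam_def
  proof (intro allI impI)
    fix u assume u: "\<forall>\<kappa>\<in>orders (lincomb A v) \<inter> {..<j}. (\<Sum>s\<in>T. u s * x s $ \<kappa>) = 0"
    define z where "z = (\<Sum>s\<in>T. fps_const (u s) * x s)"
    have z: "z \<in> lincomb A v" unfolding z_def using assms(2) by (intro lincomb_sum lincomb_scale)
    have nz: "z $ \<kappa> = (\<Sum>s\<in>T. u s * x s $ \<kappa>)" for \<kappa> unfolding z_def by (rule nth_lincomb)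
    have "z $ \<kappa> = 0" if "\<kappa> < j" for \<kappa>
    proof (cases "z = 0")
      case False
      then have "z $ subdegree z \<noteq> 0" "subdegree z \<in> orders (lincomb A v)"
        using z ordersI by auto
      then have "\<not> subdegree z < j" using u nz by auto
      then show ?thesis using that by (intro nth_less_subdegree_zero) auto
    qed simp
    then show "\<forall>s\<in>T. u s = 0" using ind unfolding indep_fam_def nz by simp
  qed
qed (use assms in auto)

text \<open>Fix combinations with distinct orders at \<open>w0\<close>. Nearby their orders may change, but they stay
  independent modulo \<open>t^j\<close>.\<close>

lemma card_orders_semicontinuous:
  assumes A: "finite A" and v: "\<And>a \<kappa>. a \<in> A \<Longrightarrow> (\<lambda>w. v w a $ \<kappa>) \<in> poly_funs J"
  shows "\<exists>p\<in>poly_funs J. p w0 \<noteq> 0 \<and> (\<forall>w. p w \<noteq> 0 \<longrightarrow>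
    card (orders (lincomb A (v w0)) \<inter> {..<j}) \<le> card (orders (lincomb A (v w)) \<inter> {..<j}))"
proof -
  define T where "T = orders (lincomb A (v w0)) \<inter> {..<j}"
  have T: "finite T" unfolding T_def by simp
  have "T \<subseteq> orders (lincomb A (v w0))" by (auto simp: T_def)
  from order_representatives[OF this] obtain u where u: "\<And>s. s \<in> T \<Longrightarrow> (\<Sum>a\<in>A. u s a * v w0 a $ s) \<noteq> 0"
     "\<And>s \<kappa>. s \<in> T \<Longrightarrow> \<kappa> < s \<Longrightarrow> (\<Sum>a\<in>A. u s a * v w0 a $ \<kappa>) = 0" by blast
  define x where "x w s = (\<Sum>a\<in>A. fps_const (u s a) * v w a)" for w s
  have nth: "x w s $ \<kappa> = (\<Sum>a\<in>A. u s a * v w a $ \<kappa>)" for w s \<kappa> unfolding x_def by (rule nth_lincomb)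
  have x_poly: "(\<lambda>w. x w s $ \<kappa>) \<in> poly_funs J" for s \<kappa>
    unfolding nth using v by (intro poly_funs_sum poly_funs_scale)
  have "indep_fam T (\<lambda>s \<kappa>. x w0 s $ \<kappa>) {..<j}"
    by (rule distinct_orders_indep) (use T u in \<open>auto simp: nth T_def\<close>)
  from indep_fam_open[OF T x_poly this] obtain p where
    p: "p\<in>poly_funs J" "p w0 \<noteq> 0" "\<And>w. p w \<noteq> 0 \<Longrightarrow> indep_fam T (\<lambda>s \<kappa>. x w s $ \<kappa>) {..<j}" by blast
  have "card T \<le> card (orders (lincomb A (v w)) \<inter> {..<j})" if "p w \<noteq> 0" for w
    by (rule card_orders_ge[OF T _ p(3)[OF that]]) (simp add: x_def lincombI)
  then show ?thesis using p(1,2) unfolding T_def by blast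
qed

text \<open>Two finite families with the same linear relations span spaces of the same dimension, and the
  dimension of a space of power series is the number of its orders.\<close>

lemma dim_eq_card_orders:
  assumes A: "finite A" and rel: "\<And>u. (\<forall>x. (\<Sum>a\<in>A. u a * h a x) = 0) \<longleftrightarrow> (\<Sum>a\<in>A. fps_const (u a) * v a) = 0"
    and fin: "finite (orders (lincomb A v))"
  shows "cfun.dim (h ` A) = card (orders (lincomb A v))"
proof (rule antisym)
  obtain B where B: "B \<subseteq> h ` A" "cfun.independent B" "h ` A \<subseteq> cfun.span B" "card B = cfun.dim (h ` A)"
    using cfun.basis_exists by metis
  have finB: "finite B" using B(1) A finite_surj by blast
  obtain j where j: "\<And>s. s \<in> orders (lincomb A v) \<Longrightarrow> s < j"
    using fin unfolding finite_nat_set_iff_bounded by auto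
  obtain A' where A': "A' \<subseteq> A" "inj_on h A'" "h ` A' = B" using B(1) subset_image_inj by metis
  have finA': "finite A'" using A' A finite_subset by auto
  have "indep_fam A' (\<lambda>a \<kappa>. v a $ \<kappa>) {..<j}"
    unfolding indep_fam_def
  proof (intro allI impI)
    fix u assume u: "\<forall>\<kappa>\<in>{..<j}. (\<Sum>a\<in>A'. u a * v a $ \<kappa>) = 0"
    define u' where "u' a = (if a \<in> A' then u a else 0)" for a
    have eq: "(\<Sum>a\<in>A. u' a * f a) = (\<Sum>a\<in>A'. u a * f a)" for f :: "'a \<Rightarrow> complex"
      by (rule sum.mono_neutral_cong_right) (use A A' in \<open>auto simp: u'_def\<close>)
    define z where "z = (\<Sum>a\<in>A. fps_const (u' a) * v a)"
    have "z = 0"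
    proof (rule ccontr)
      assume z: "z \<noteq> 0"
      then have "subdegree z < j" by (intro j ordersI) (auto simp: z_def lincombI)
      then have "z $ subdegree z = 0" using u by (simp add: z_def nth_lincomb eq)
      then show False using z by simp
    qed
    then have 0: "(\<Sum>a\<in>A'. u a * h a x) = 0" for x using rel[of u'] unfolding z_def by (simp add: eq)
    have "(\<Sum>b\<in>B. cscale (u (the_inv_into A' h b)) b) = 0"
    proof
      fix x
      show "(\<Sum>b\<in>B. cscale (u (the_inv_into A' h b)) b) x = 0 x"
        unfolding A'(3)[symmetric] using 0[of x] A'(2)
        by (simp add: sum_fun_apply sum.reindex the_inv_into_f_f cscale_def)
    qed
    then have "\<forall>b\<in>B. u (the_inv_into A' h b) = 0"
      using cfun.independentD[OF B(2) finB, of "\<lambda>b. u (the_inv_into A' h b)"] by blast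
    then show "\<forall>a\<in>A'. u a = 0" using A' by (metis imageI the_inv_into_f_f)
  qed
  then have "card A' \<le> card (orders (lincomb A v) \<inter> {..<j})"
    using A' by (intro card_orders_ge[OF finA', of v]) (auto intro: lincomb_base A)
  moreover have "card (orders (lincomb A v) \<inter> {..<j}) \<le> card (orders (lincomb A v))"
    using fin by (intro card_mono) auto
  ultimately show "cfun.dim (h ` A) \<le> card (orders (lincomb A v))"
    using B(4) A' by (metis card_image order_trans)
  define O' where "O' = orders (lincomb A v)"
  have "O' \<subseteq> orders (lincomb A v)" by (simp add: O'_def)
  from order_representatives[OF this] obtain u where u: "\<And>s. s \<in> O' \<Longrightarrow> (\<Sum>a\<in>A. u s a * v a $ s) \<noteq> 0"
     "\<And>s \<kappa>. s \<in> O' \<Longrightarrow> \<kappa> < s \<Longrightarrow> (\<Sum>a\<in>A. u s a * v a $ \<kappa>) = 0" by blast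
  show "card (orders (lincomb A v)) \<le> cfun.dim (h ` A)"
  proof (rule ccontr)
    assume less: "\<not> ?thesis"
    define g where "g s = (\<Sum>a\<in>A. cscale (u s a) (h a))" for s
    have "g s \<in> cfun.span B" for s
      unfolding g_def using B(3) by (intro cfun.span_sum cfun.span_scale) auto
    then obtain x where x: "\<exists>s\<in>O'. x s \<noteq> 0" "\<And>p. (\<Sum>s\<in>O'. x s * g s p) = 0"
      using dependent_family[OF finB, of O' g] less fin B(4) unfolding O'_def by auto
    define c where "c a = (\<Sum>s\<in>O'. x s * u s a)" for a
    have "(\<Sum>a\<in>A. c a * f a) = (\<Sum>s\<in>O'. x s * (\<Sum>a\<in>A. u s a * f a))" for f :: "'a \<Rightarrow> complex"
      unfolding c_def sum_distrib_left sum_distrib_right by (subst sum.swap) (simp add: mult.assoc)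
    note c = this
    have "(\<Sum>a\<in>A. c a * h a p) = 0" for p
      unfolding c using x(2)[of p] by (simp add: g_def sum_fun_apply cscale_def)
    then have 0: "(\<Sum>a\<in>A. fps_const (c a) * v a) = 0" using rel by blast
    define y where "y s = (\<Sum>a\<in>A. fps_const (u s a) * v a)" for s
    have "(\<Sum>s\<in>O'. x s * y s $ \<kappa>) = 0" for \<kappa>
      using arg_cong[OF 0, of "\<lambda>z. z $ \<kappa>"] unfolding y_def nth_lincomb c by simp
    moreover have "indep_fam O' (\<lambda>s \<kappa>. y s $ \<kappa>) UNIV"
      by (rule distinct_orders_indep) (use u fin in \<open>auto simp: y_def nth_lincomb O'_def\<close>)
    ultimately show False using x(1) unfolding indep_fam_def by blast
  qed
qed

section \<open>Value semigroups\<close>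

definition exponents :: "nat set \<Rightarrow> nat \<Rightarrow> (nat \<Rightarrow> nat) set" where
  "exponents I N = {a. (\<forall>i. i \<notin> I \<longrightarrow> a i = 0) \<and> (\<Sum>i\<in>I. a i) \<le> N}"

definition monomial :: "nat set \<Rightarrow> (nat \<Rightarrow> 'a::comm_monoid_mult) \<Rightarrow> (nat \<Rightarrow> nat) \<Rightarrow> 'a" where
  "monomial I f a = (\<Prod>i\<in>I. f i ^ a i)"

lemma finite_bounded_exponents:
  "finite I \<Longrightarrow> finite {a :: nat \<Rightarrow> nat. (\<forall>i. i \<notin> I \<longrightarrow> a i = 0) \<and> (\<forall>i\<in>I. a i \<le> N)}"
  by (rule finite_subset[OF _ finite_set_of_finite_funs[of I "{..N}" 0]]) auto

lemma finite_exponents: "finite I \<Longrightarrow> finite (exponents I N)"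
proof (rule finite_subset[OF _ finite_bounded_exponents[of I N]])
  assume I: "finite I"
  show "exponents I N \<subseteq> {a. (\<forall>i. i \<notin> I \<longrightarrow> a i = 0) \<and> (\<forall>i\<in>I. a i \<le> N)}"
  proof
    fix a assume a: "a \<in> exponents I N"
    have "a i \<le> N" if "i \<in> I" for i
      using member_le_sum[of i I a] that I a by (auto simp: exponents_def)
    then show "a \<in> {a. (\<forall>i. i \<notin> I \<longrightarrow> a i = 0) \<and> (\<forall>i\<in>I. a i \<le> N)}"
      using a by (auto simp: exponents_def)
  qed
qed

lemma exponents_mono: "N \<le> N' \<Longrightarrow> exponents I N \<subseteq> exponents I N'"
  by (auto simp: exponents_def)

lemma monomial_mult: "monomial I f a * monomial I f b = monomial I f (\<lambda>i. a i + b i)"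
  by (simp add: monomial_def power_add prod.distrib)

definition vanishes :: "nat \<Rightarrow> complex fps \<Rightarrow> bool" where
  "vanishes N x \<longleftrightarrow> (\<forall>\<kappa><N. x $ \<kappa> = 0)"

lemma vanishes_mult:
  assumes "vanishes N x" "vanishes M y"
  shows "vanishes (N + M) (x * y)"
  unfolding vanishes_def fps_mult_nth
proof (intro allI impI sum.neutral ballI)
  fix \<kappa> i assume "\<kappa> < N + M" "i \<in> {0..\<kappa>}"
  then have "i < N \<or> \<kappa> - i < M" by auto
  then show "x $ i * y $ (\<kappa> - i) = 0" using assms by (auto simp: vanishes_def)
qed

lemma vanishes_power: "vanishes N x \<Longrightarrow> vanishes (k * N) (x ^ k)"
  by (induction k) (auto simp: vanishes_def[of 0] intro: vanishes_mult)

lemma vanishes_monomial: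
  assumes "\<And>i. i \<in> I \<Longrightarrow> vanishes (k i) (f i)"
  shows "vanishes (\<Sum>i\<in>I. a i * k i) (monomial I f a)"
  unfolding monomial_def using assms
  by (induction I rule: infinite_finite_induct)
    (auto simp: vanishes_def[of 0] intro!: vanishes_mult vanishes_power)

text \<open>The constants are embedded by \<open>e\<close>, so that this covers power series as well as polynomials.\<close>

inductive_set subalg :: "(complex \<Rightarrow> 'a::comm_ring_1) \<Rightarrow> 'a set \<Rightarrow> 'a set" for e G where
  const: "e z \<in> subalg e G"
| gen: "x \<in> G \<Longrightarrow> x \<in> subalg e G"
| add: "x \<in> subalg e G \<Longrightarrow> y \<in> subalg e G \<Longrightarrow> x + y \<in> subalg e G"
| mult: "x \<in> subalg e G \<Longrightarrow> y \<in> subalg e G \<Longrightarrow> x * y \<in> subalg e G"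

lemma subalg_sum:
  "e 0 = 0 \<Longrightarrow> (\<And>t. t \<in> T \<Longrightarrow> x t \<in> subalg e G) \<Longrightarrow> (\<Sum>t\<in>T. x t) \<in> subalg e G"
  by (induction T rule: infinite_finite_induct) (auto intro: subalg.intros, (metis subalg.const)+)

lemma subalg_power: "e 1 = 1 \<Longrightarrow> x \<in> subalg e G \<Longrightarrow> x ^ k \<in> subalg e G"
  by (induction k) (auto intro: subalg.intros, (metis subalg.const)+)

lemma subalg_prod:
  "e 1 = 1 \<Longrightarrow> (\<And>t. t \<in> T \<Longrightarrow> x t \<in> subalg e G) \<Longrightarrow> (\<Prod>t\<in>T. x t) \<in> subalg e G"
  by (induction T rule: infinite_finite_induct) (auto intro: subalg.intros, (metis subalg.const)+)

lemma subalg_least: "x \<in> subalg e G \<Longrightarrow> G \<subseteq> subalg e H \<Longrightarrow> x \<in> subalg e H"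
  by (induction rule: subalg.induct) (auto intro: subalg.intros)

lemma subalg_fps_iff:
  assumes I: "finite I"
  shows "x \<in> subalg fps_const (f ` I) \<longleftrightarrow> (\<exists>N. x \<in> lincomb (exponents I N) (monomial I f))"
proof
  assume "x \<in> subalg fps_const (f ` I)"
  then show "\<exists>N. x \<in> lincomb (exponents I N) (monomial I f)"
  proof (induction rule: subalg.induct)
    case (const z)
    have "monomial I f (\<lambda>_. 0) \<in> lincomb (exponents I 0) (monomial I f)"
      by (intro lincomb_base finite_exponents I) (auto simp: exponents_def)
    then have "fps_const z * monomial I f (\<lambda>_. 0) \<in> lincomb (exponents I 0) (monomial I f)"
      by (rule lincomb_scale)
    moreover have "fps_const z * monomial I f (\<lambda>_. 0) = fps_const z" by (simp add: monomial_def)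
    ultimately show ?case by metis
  next
    case (gen x)
    then obtain i where i: "i \<in> I" "x = f i" by auto
    define a where "a j = (if j = i then 1 else 0 :: nat)" for j
    have "monomial I f a = x"
      using i I by (simp add: monomial_def a_def if_distrib[of "\<lambda>e. _ ^ e"] cong: if_cong)
    moreover have "a \<in> exponents I 1" using i I by (auto simp: exponents_def a_def)
    ultimately show ?case using lincomb_base[OF finite_exponents[OF I]] by metis
  next
    case (add x y)
    then obtain N M where NM: "x \<in> lincomb (exponents I N) (monomial I f)"
      "y \<in> lincomb (exponents I M) (monomial I f)" by auto
    have "x \<in> lincomb (exponents I (N + M)) (monomial I f)" "y \<in> lincomb (exponents I (N + M)) (monomial I f)"
      using exponents_mono[of N "N + M" I] exponents_mono[of M "N + M" I]
      by (auto intro!: lincomb_least[OF NM(1)] lincomb_least[OF NM(2)] lincomb_base finite_exponents I)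
    then show ?case by (auto intro: lincomb_add)
  next
    case (mult x y)
    then obtain N M where NM: "x \<in> lincomb (exponents I N) (monomial I f)"
      "y \<in> lincomb (exponents I M) (monomial I f)" by auto
    have "x * y \<in> lincomb (exponents I (N + M)) (monomial I f)"
      by (rule lincomb_mult[OF NM], unfold monomial_mult, rule lincomb_base[OF finite_exponents[OF I]])
        (auto simp: exponents_def sum.distrib intro: add_mono)
    then show ?case by blast
  qed
next
  assume "\<exists>N. x \<in> lincomb (exponents I N) (monomial I f)"
  then obtain N u where "x = (\<Sum>a\<in>exponents I N. fps_const (u a) * monomial I f a)"
    by (auto simp: lincomb_def)
  then show "x \<in> subalg fps_const (f ` I)"
    unfolding monomial_def
    by (auto intro!: subalg_sum subalg.mult subalg_prod subalg_power subalg.const intro: subalg.gen)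
qed

text \<open>A monomial of total degree greater than \<open>k\<close> vanishes to an order greater than \<open>k\<close>.\<close>

lemma mps_subst_nth:
  assumes I: "finite I" and f: "\<And>i. i \<in> I \<Longrightarrow> f i $ 0 = 0" and k: "k \<le> N"
  shows "mps_subst I f u $ k = (\<Sum>a\<in>exponents I N. u a * monomial I f a $ k)"
proof -
  have "monomial I f a $ k = 0" if "a \<in> exponents I N - exponents I k" for a
  proof -
    have "vanishes (\<Sum>i\<in>I. a i * 1) (monomial I f a)"
      using f by (intro vanishes_monomial) (auto simp: vanishes_def)
    then show ?thesis using that by (auto simp: vanishes_def exponents_def)
  qed
  then have "(\<Sum>a\<in>exponents I N. u a * monomial I f a $ k) = (\<Sum>a\<in>exponents I k. u a * monomial I f a $ k)"
    using exponents_mono[OF k, of I] by (intro sum.mono_neutral_right finite_exponents I) auto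
  then show ?thesis by (simp add: mps_subst_def exponents_def monomial_def)
qed

lemma value_semigroup_upto:
  assumes I: "finite I" and f: "\<And>i. i \<in> I \<Longrightarrow> f i $ 0 = 0"
  shows "orders (lincomb (exponents I N) (monomial I f)) \<subseteq> value_semigroup I f"
    and "value_semigroup I f \<inter> {..N} \<subseteq> orders (lincomb (exponents I N) (monomial I f))"
proof -
  show "orders (lincomb (exponents I N) (monomial I f)) \<subseteq> value_semigroup I f"
  proof
    fix s assume "s \<in> orders (lincomb (exponents I N) (monomial I f))"
    then obtain x where x: "x \<in> lincomb (exponents I N) (monomial I f)" "x \<noteq> 0" "s = subdegree x"
      by (auto simp: orders_def)
    then obtain u where u: "x = (\<Sum>a\<in>exponents I N. fps_const (u a) * monomial I f a)"
      by (auto simp: lincomb_def)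
    define u' where "u' a = (if a \<in> exponents I N then u a else 0)" for a
    have "mps_subst I f u' $ k = x $ k" for k
    proof -
      have "(\<Sum>a\<in>exponents I (max N k). u' a * monomial I f a $ k)
          = (\<Sum>a\<in>exponents I N. u a * monomial I f a $ k)"
        using exponents_mono[of N "max N k" I]
        by (intro sum.mono_neutral_cong_right finite_exponents I) (auto simp: u'_def)
      then show ?thesis using mps_subst_nth[OF I f, where k=k and N="max N k" and u=u'] by (simp add: u nth_lincomb)
    qed
    then have "mps_subst I f u' = x" by (simp add: fps_eq_iff)
    then show "s \<in> value_semigroup I f" using x unfolding value_semigroup_def by auto
  qed
  show "value_semigroup I f \<inter> {..N} \<subseteq> orders (lincomb (exponents I N) (monomial I f))"
  proof
    fix s assume "s \<in> value_semigroup I f \<inter> {..N}"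
    then obtain u where u: "s = subdegree (mps_subst I f u)" "mps_subst I f u \<noteq> 0" "s \<le> N"
      by (auto simp: value_semigroup_def)
    define x where "x = (\<Sum>a\<in>exponents I N. fps_const (u a) * monomial I f a)"
    have x: "x $ k = mps_subst I f u $ k" if "k \<le> N" for k
      using mps_subst_nth[OF I f that, where u=u] by (simp add: x_def nth_lincomb)
    have s: "x $ s \<noteq> 0" using x[OF u(3)] u by simp
    have "subdegree x = s"
      by (rule subdegreeI[OF s]) (use x u in auto)
    moreover have "x \<noteq> 0" using s by auto
    moreover have "x \<in> lincomb (exponents I N) (monomial I f)" unfolding x_def by (rule lincombI)
    ultimately show "s \<in> orders (lincomb (exponents I N) (monomial I f))" using ordersI by blast
  qed
qed

text \<open>An order \<open>s\<close> is not affected by monomials of degree greater than \<open>s\<close>, so power series in the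
  \<open>f i\<close> have no other orders than polynomials in them.\<close>

lemma value_semigroup_eq_orders:
  assumes "finite I" "\<And>i. i \<in> I \<Longrightarrow> f i $ 0 = 0"
  shows "value_semigroup I f = orders (subalg fps_const (f ` I))"
proof
  show "value_semigroup I f \<subseteq> orders (subalg fps_const (f ` I))"
  proof
    fix s assume "s \<in> value_semigroup I f"
    then have "s \<in> orders (lincomb (exponents I s) (monomial I f))"
      using value_semigroup_upto(2)[of I f s] assms by auto
    then show "s \<in> orders (subalg fps_const (f ` I))"
      unfolding orders_def using subalg_fps_iff[OF assms(1)] by blast
  qed
  show "orders (subalg fps_const (f ` I)) \<subseteq> value_semigroup I f"
  proof
    fix s assume "s \<in> orders (subalg fps_const (f ` I))"
    then obtain N where "s \<in> orders (lincomb (exponents I N) (monomial I f))"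
      unfolding orders_def using subalg_fps_iff[OF assms(1)] by blast
    then show "s \<in> value_semigroup I f" using value_semigroup_upto(1)[of I f N] assms by blast
  qed
qed

lemma zero_in_orders_subalg: "0 \<in> orders (subalg fps_const G)"
  using ordersI[OF subalg.const[of fps_const 1 G]] by simp

lemma orders_subalg_add:
  assumes "s \<in> orders (subalg fps_const G)" "s' \<in> orders (subalg fps_const G)"
  shows "s + s' \<in> orders (subalg fps_const G)"
proof -
  obtain x y where "x \<in> subalg fps_const G" "x \<noteq> 0" "s = subdegree x"
    "y \<in> subalg fps_const G" "y \<noteq> 0" "s' = subdegree y"
    using assms unfolding orders_def by auto
  then show ?thesis using ordersI[of "x * y"] by (auto intro: subalg.mult)
qed

text \<open>Modulo \<open>t^j\<close> the algebra is spanned by the monomials of weight less than \<open>j\<close>.\<close>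

lemma card_value_semigroup_le:
  assumes I: "finite I" and k: "\<And>i. i \<in> I \<Longrightarrow> 0 < k i" "\<And>i. i \<in> I \<Longrightarrow> vanishes (k i) (f i)"
    and T: "finite T" "\<And>a. (\<forall>i. i \<notin> I \<longrightarrow> a i = 0) \<Longrightarrow> (\<Sum>i\<in>I. a i * k i) < j \<Longrightarrow> a \<in> T"
  shows "card (value_semigroup I f \<inter> {..<j}) \<le> card T"
proof -
  have f0: "f i $ 0 = 0" if "i \<in> I" for i using k[OF that] by (auto simp: vanishes_def)
  define S where "S = value_semigroup I f \<inter> {..<j}"
  define A where "A = exponents I j"
  have A: "finite A" unfolding A_def by (rule finite_exponents[OF I])
  have "S \<subseteq> orders (lincomb A (monomial I f))"
    using value_semigroup_upto(2)[of I f j, OF I f0] unfolding S_def A_def by auto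
  from order_representatives[OF this]
  obtain u where u: "\<And>s. s \<in> S \<Longrightarrow> (\<Sum>a\<in>A. u s a * monomial I f a $ s) \<noteq> 0"
    "\<And>s \<kappa>. s \<in> S \<Longrightarrow> \<kappa> < s \<Longrightarrow> (\<Sum>a\<in>A. u s a * monomial I f a $ \<kappa>) = 0" by blast
  define x where "x s = (\<Sum>a\<in>A. fps_const (u s a) * monomial I f a)" for s
  have x: "x s $ \<kappa> = (\<Sum>a\<in>A. u s a * monomial I f a $ \<kappa>)" for s \<kappa> by (simp add: x_def nth_lincomb)
  have ind: "indep_fam S (\<lambda>s \<kappa>. x s $ \<kappa>) {..<j}"
    by (rule distinct_orders_indep) (use u in \<open>auto simp: x S_def\<close>)
  have "indep_fam S u (T \<inter> A)"
    unfolding indep_fam_def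
  proof (intro allI impI)
    fix c assume c: "\<forall>a\<in>T \<inter> A. (\<Sum>s\<in>S. c s * u s a) = 0"
    have "(\<Sum>s\<in>S. c s * x s $ \<kappa>) = 0" if \<kappa>: "\<kappa> < j" for \<kappa>
    proof -
      have "(\<Sum>s\<in>S. c s * x s $ \<kappa>) = (\<Sum>a\<in>A. (\<Sum>s\<in>S. c s * u s a) * monomial I f a $ \<kappa>)"
        unfolding x sum_distrib_left sum_distrib_right by (subst sum.swap) (simp add: mult.assoc)
      also have "\<dots> = 0"
      proof (rule sum.neutral, rule ballI)
        fix a assume a: "a \<in> A"
        show "(\<Sum>s\<in>S. c s * u s a) * monomial I f a $ \<kappa> = 0"
        proof (cases "a \<in> T")
          case True
          then show ?thesis using c a by simp
        next
          case False
          then have "j \<le> (\<Sum>i\<in>I. a i * k i)" using T(2)[of a] a unfolding A_def exponents_def by force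
          then show ?thesis using vanishes_monomial[of I k f a] k(2) \<kappa> by (auto simp: vanishes_def)
        qed
      qed
      finally show ?thesis .
    qed
    then show "\<forall>s\<in>S. c s = 0" using ind unfolding indep_fam_def by simp
  qed
  then have "card S \<le> card (T \<inter> A)"
    by (rule indep_fam_card_le) (use A in \<open>auto simp: S_def\<close>)
  also have "\<dots> \<le> card T" using T(1) by (intro card_mono) auto
  finally show ?thesis by (simp add: S_def)
qed

section \<open>The generic semigroup\<close>

text \<open>In contrast to \<open>cusp_params\<close> this set contains the line through any two of its points.\<close>

definition cusp_space :: "nat \<Rightarrow> (nat \<Rightarrow> nat) \<Rightarrow> (nat \<times> nat \<Rightarrow> complex) set" where
  "cusp_space n ord = {c \<in> affine_space ({1..n} \<times> UNIV). \<forall>i\<in>{1..n}. \<forall>k<ord i. c (i, k) = 0}"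

lemma cusp_params_iff:
  "c \<in> cusp_params n ord \<longleftrightarrow> c \<in> cusp_space n ord \<and> (\<forall>i\<in>{1..n}. c (i, ord i) \<noteq> 0)"
proof -
  have "coeff_fps c i \<noteq> 0 \<and> subdegree (coeff_fps c i) = ord i \<longleftrightarrow>
      (\<forall>k<ord i. c (i, k) = 0) \<and> c (i, ord i) \<noteq> 0" (is "?L = ?R") for i
  proof
    assume ?L
    then show ?R using nth_subdegree_nonzero[of "coeff_fps c i"] nth_less_subdegree_zero[of _ "coeff_fps c i"]
      by (auto simp: coeff_fps_def)
  next
    assume ?R
    then have "subdegree (coeff_fps c i) = ord i" by (intro subdegreeI) (auto simp: coeff_fps_def)
    moreover have "coeff_fps c i $ ord i \<noteq> 0" using \<open>?R\<close> by (simp add: coeff_fps_def)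
    ultimately show ?L by auto
  qed
  then show ?thesis unfolding cusp_params_def cusp_space_def by blast
qed

lemma cusp_space_line: "x \<in> cusp_space n ord \<Longrightarrow> y \<in> cusp_space n ord \<Longrightarrow> line x y h \<in> cusp_space n ord"
  unfolding cusp_space_def using affine_space_line by (auto simp: line_def)

lemma cusp_params_avoid_finite:
  assumes "finite T" "\<And>t. t \<in> T \<Longrightarrow> p t \<in> poly_funs ({1..n} \<times> UNIV)"
    and "\<And>t. t \<in> T \<Longrightarrow> \<exists>x\<in>cusp_params n ord. p t x \<noteq> 0"
  shows "\<exists>x\<in>cusp_params n ord. \<forall>t\<in>T. p t x \<noteq> 0"
proof -
  define ones where "ones = (\<lambda>(i,k). if i \<in> {1..n} \<and> k = ord i then 1 else (0::complex))"
  have ones: "ones \<in> cusp_space n ord" "\<And>i. i \<in> {1..n} \<Longrightarrow> ones (i, ord i) \<noteq> 0"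
    by (auto simp: cusp_space_def affine_space_def ones_def)
  define p' where "p' = (\<lambda>t. case t of Inl t \<Rightarrow> p t | Inr i \<Rightarrow> (\<lambda>x. x (i, ord i)))"
  have "\<exists>x\<in>cusp_space n ord. \<forall>t\<in>Inl ` T \<union> Inr ` {1..n}. p' t x \<noteq> 0"
  proof (rule poly_funs_avoid_finite)
    show "\<exists>x\<in>cusp_space n ord. p' t x \<noteq> 0" if "t \<in> Inl ` T \<union> Inr ` {1..n}" for t
      using that assms(3) ones cusp_params_iff unfolding p'_def by (auto, blast+)
    show "p' t \<in> poly_funs ({1..n} \<times> UNIV)" if "t \<in> Inl ` T \<union> Inr ` {1..n}" for t
      using that assms(2) unfolding p'_def by (auto intro!: poly_funs.coord)
  qed (use assms(1) ones cusp_space_line in auto)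
  then obtain x where x: "x \<in> cusp_space n ord" "\<forall>t\<in>Inl ` T \<union> Inr ` {1..n}. p' t x \<noteq> 0" by blast
  then have "x (i, ord i) \<noteq> 0" if "i \<in> {1..n}" for i
    using bspec[OF x(2), of "Inr i"] that by (simp add: p'_def)
  then have "x \<in> cusp_params n ord" using x(1) unfolding cusp_params_iff by blast
  moreover have "p t x \<noteq> 0" if "t \<in> T" for t
    using bspec[OF x(2), of "Inl t"] that by (simp add: p'_def)
  ultimately show ?thesis by blast
qed

text \<open>Two nonempty open subsets of \<open>cusp_params\<close> meet.\<close>

lemma generic_semigroup_unique:
  assumes "is_generic_semigroup n ord S" "is_generic_semigroup n ord S'"
  shows "S = S'"
proof -
  have *: "\<exists>p\<in>poly_funs ({1..n} \<times> UNIV). (\<exists>x\<in>cusp_params n ord. p x \<noteq> 0) \<and>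
      (\<forall>c\<in>cusp_params n ord. p c \<noteq> 0 \<longrightarrow> value_semigroup {1..n} (coeff_fps c) = S)"
    if S: "is_generic_semigroup n ord S" for S
  proof -
    from S obtain U where U: "openin (subtopology (zariski ({1..n} \<times> UNIV)) (cusp_params n ord)) U" "U \<noteq> {}"
      "\<forall>c\<in>U. value_semigroup {1..n} (coeff_fps c) = S" unfolding is_generic_semigroup_def by blast
    then obtain V where V: "openin (zariski ({1..n} \<times> UNIV)) V" "U = V \<inter> cusp_params n ord"
      by (auto simp: openin_subtopology)
    obtain x where x: "x \<in> V" "x \<in> cusp_params n ord" using U(2) V(2) by auto
    from openin_zariski_nbhd[OF V(1) x(1)] obtain p where p: "p\<in>poly_funs ({1..n} \<times> UNIV)" "p x \<noteq> 0"
      "\<forall>y\<in>affine_space ({1..n} \<times> UNIV). p y \<noteq> 0 \<longrightarrow> y \<in> V" by blast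
    have "y \<in> U" if "y \<in> cusp_params n ord" "p y \<noteq> 0" for y
      using that p(3) V(2) by (auto simp: cusp_params_def)
    then show ?thesis using p x U(3) by blast
  qed
  obtain p where p: "p\<in>poly_funs ({1..n} \<times> UNIV)" "\<exists>x\<in>cusp_params n ord. p x \<noteq> 0"
      "\<forall>c\<in>cusp_params n ord. p c \<noteq> 0 \<longrightarrow> value_semigroup {1..n} (coeff_fps c) = S" using *[OF assms(1)] by blast
  obtain q where q: "q\<in>poly_funs ({1..n} \<times> UNIV)" "\<exists>x\<in>cusp_params n ord. q x \<noteq> 0"
      "\<forall>c\<in>cusp_params n ord. q c \<noteq> 0 \<longrightarrow> value_semigroup {1..n} (coeff_fps c) = S'" using *[OF assms(2)] by blast
  have "\<exists>x\<in>cusp_params n ord. \<forall>t\<in>{True, False}. (if t then p else q) x \<noteq> 0"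
    by (rule cusp_params_avoid_finite) (use p q in auto)
  then show ?thesis using p(3) q(3) by auto
qed

lemma is_generic_semigroupI:
  assumes G: "G \<in> poly_funs ({1..n} \<times> UNIV)" "c0 \<in> cusp_params n ord" "G c0 \<noteq> 0"
    and S: "\<And>c. c \<in> cusp_params n ord \<Longrightarrow> G c \<noteq> 0 \<Longrightarrow> value_semigroup {1..n} (coeff_fps c) = S"
  shows "is_generic_semigroup n ord S"
proof -
  have "openin (subtopology (zariski ({1..n} \<times> UNIV)) (cusp_params n ord))
      ({x \<in> affine_space ({1..n} \<times> UNIV). G x \<noteq> 0} \<inter> cusp_params n ord)"
    using openin_zariski_basic[OF G(1)] by (auto simp: openin_subtopology)
  moreover have "c0 \<in> {x \<in> affine_space ({1..n} \<times> UNIV). G x \<noteq> 0} \<inter> cusp_params n ord"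
    using G by (auto simp: cusp_params_def)
  ultimately show ?thesis unfolding is_generic_semigroup_def using S by blast
qed

definition poly_fps :: "'i set \<Rightarrow> (('i \<Rightarrow> complex) \<Rightarrow> complex fps) \<Rightarrow> bool" where
  "poly_fps J x \<longleftrightarrow> (\<forall>\<kappa>. (\<lambda>w. x w $ \<kappa>) \<in> poly_funs J)"

lemma poly_fps_one: "poly_fps J (\<lambda>w. 1)"
  unfolding poly_fps_def by (auto intro: poly_funs.const)

lemma poly_fps_mult: "poly_fps J x \<Longrightarrow> poly_fps J y \<Longrightarrow> poly_fps J (\<lambda>w. x w * y w)"
  unfolding poly_fps_def fps_mult_nth by (auto intro!: poly_funs_sum poly_funs.mult)

lemma poly_fps_power: "poly_fps J x \<Longrightarrow> poly_fps J (\<lambda>w. x w ^ k)"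
  by (induction k) (auto intro: poly_fps_one poly_fps_mult)

lemma poly_fps_monomial:
  "(\<And>i. i \<in> I \<Longrightarrow> poly_fps J (\<lambda>w. f w i)) \<Longrightarrow> poly_fps J (\<lambda>w. monomial I (f w) a)"
  unfolding monomial_def
proof (induction I rule: infinite_finite_induct)
  case (insert x F)
  have "poly_fps J (\<lambda>w. f w x ^ a x)" "poly_fps J (\<lambda>w. \<Prod>i\<in>F. f w i ^ a i)"
    using insert by (auto intro: poly_fps_power)
  from poly_fps_mult[OF this] show ?case using insert(1,2) by simp
qed (auto intro: poly_fps_one)

definition cusp_ord :: "nat \<Rightarrow> nat \<Rightarrow> nat" where
  "cusp_ord m i = 2 * m + 2 * i - 2"

lemma cusp_params_vanishes:
  "c \<in> cusp_params n ord \<Longrightarrow> i \<in> {1..n} \<Longrightarrow> vanishes (ord i) (coeff_fps c i)"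
  unfolding cusp_params_iff cusp_space_def vanishes_def coeff_fps_def by auto

text \<open>Divide \<open>s / 2\<close> by \<open>m\<close> with remainder \<open>r < m\<close>: then \<open>s\<close> is a sum of \<open>r\<close> terms \<open>2 m + 2\<close> and
  further terms \<open>2 m\<close>, because the quotient is at least \<open>m\<close>.\<close>

lemma even_in_semigroup:
  assumes S: "\<And>s t. s \<in> S \<Longrightarrow> t \<in> S \<Longrightarrow> s + t \<in> S" "0 \<in> S" and g: "2 * m \<in> S" "2 * m + 2 \<in> S"
    and m: "m > 0" and s: "even s" "s \<ge> 2 * m * m"
  shows "s \<in> (S :: nat set)"
proof -
  have mult: "k * t \<in> S" if "t \<in> S" for k t by (induction k) (use S that in auto)
  define x where "x = s div 2"
  have x: "s = 2 * x" "x \<ge> m * m" using s by (auto simp: x_def)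
  define q r where "q = x div m" and "r = x mod m"
  have "q * m + r = x" by (simp add: q_def r_def)
  moreover have "r < m" using m by (simp add: r_def)
  moreover have "m \<le> q" unfolding q_def using x(2) m by (simp add: less_eq_div_iff_mult_less_eq)
  ultimately have "s = (q - r) * (2 * m) + r * (2 * m + 2)"
    using x(1) by (simp add: algebra_simps diff_mult_distrib2)
  then show ?thesis using S(1)[OF mult[OF g(1), of "q - r"] mult[OF g(2), of r]] by simp
qed

lemma cofinite_semigroup:
  assumes S: "\<And>s t. s \<in> S \<Longrightarrow> t \<in> S \<Longrightarrow> s + t \<in> S" "0 \<in> S" and g: "2 * m \<in> S" "2 * m + 2 \<in> S" "4 * m + 5 \<in> S"
    and m: "m > 0" and s: "s \<ge> 2 * m * m + 4 * m + 5"
  shows "s \<in> (S :: nat set)"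
proof (cases "even s")
  case True
  then show ?thesis using even_in_semigroup[of S m s] assms by auto
next
  case False
  then have "s - (4 * m + 5) \<in> S" using even_in_semigroup[of S m "s - (4 * m + 5)"] assms by auto
  then show ?thesis using S(1)[OF g(3), of "s - (4 * m + 5)"] s by simp
qed

text \<open>The cancellation \<open>f\<^sub>1 f\<^sub>3 - f\<^sub>2^2\<close>, with leading coefficients adjusted, produces the
  odd order \<open>4 m + 5\<close> unless this polynomial in the coefficients vanishes.\<close>

definition odd_coeff :: "nat \<Rightarrow> (nat \<times> nat \<Rightarrow> complex) \<Rightarrow> complex" where
  "odd_coeff m c = c (2, 2 * m + 2) ^ 2 * (c (1, 2 * m) * c (3, 2 * m + 5) + c (1, 2 * m + 1) * c (3, 2 * m + 4))
     - c (1, 2 * m) * c (3, 2 * m + 4) * (2 * c (2, 2 * m + 2) * c (2, 2 * m + 3))"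

lemma odd_coeff_poly: "n \<ge> 3 \<Longrightarrow> odd_coeff m \<in> poly_funs ({1..n} \<times> UNIV)"
  unfolding odd_coeff_def
  by (intro poly_funs_diff poly_funs.mult poly_funs.add poly_funs_power poly_funs.coord poly_funs.const) auto

lemma odd_in_semigroup:
  assumes n: "n \<ge> 3" and m: "m > 0" and c: "c \<in> cusp_params n (cusp_ord m)" "odd_coeff m c \<noteq> 0"
  shows "4 * m + 5 \<in> value_semigroup {1..n} (coeff_fps c)"
proof -
  define f where "f = coeff_fps c"
  define h where "h i = fps_shift (cusp_ord m i) (f i)" for i
  have f: "f i = fps_X ^ cusp_ord m i * h i" if "i \<in> {1..n}" for i
    using cusp_params_vanishes[OF c(1) that] unfolding h_def f_def vanishes_def
    by (auto simp: fps_eq_iff fps_X_power_mult_nth)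
  have h: "h i $ \<kappa> = c (i, cusp_ord m i + \<kappa>)" for i \<kappa>
    by (simp add: h_def f_def coeff_fps_def add.commute)
  have ord: "cusp_ord m 1 = 2 * m" "cusp_ord m (Suc 0) = 2 * m" "cusp_ord m 2 = 2 * m + 2" "cusp_ord m 3 = 2 * m + 4"
    by (auto simp: cusp_ord_def)
  define A where "A = c (2, 2 * m + 2) ^ 2"
  define B where "B = c (1, 2 * m) * c (3, 2 * m + 4)"
  define w where "w = fps_const A * (h 1 * h 3) - fps_const B * (h 2 * h 2)"
  define v where "v = fps_const A * (f 1 * f 3) + fps_const (-B) * (f 2 * f 2)"
  have X': "(fps_X :: complex fps) ^ a * fps_X ^ b = fps_X ^ (4 * m + 4)" if "a + b = 4 * m + 4" for a b
    by (simp only: that flip: power_add)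
  have X: "(fps_X :: complex fps) ^ (2 * m) * fps_X ^ (2 * m + 4) = fps_X ^ (4 * m + 4)"
    "(fps_X :: complex fps) ^ (2 * m + 2) * fps_X ^ (2 * m + 2) = fps_X ^ (4 * m + 4)"
    by (rule X', simp)+
  have "v = fps_const A * ((fps_X ^ (2 * m) * fps_X ^ (2 * m + 4)) * (h 1 * h 3))
      - fps_const B * ((fps_X ^ (2 * m + 2) * fps_X ^ (2 * m + 2)) * (h 2 * h 2))"
    using n by (simp add: v_def f ord mult.assoc mult.left_commute flip: fps_const_neg)
  then have v: "v = fps_X ^ (4 * m + 4) * w"
    unfolding X w_def by (simp add: algebra_simps)
  have hs: "h 1 $ 0 = c (1, 2 * m)" "h 1 $ 1 = c (1, 2 * m + 1)" "h 2 $ 0 = c (2, 2 * m + 2)"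
    "h 2 $ 1 = c (2, 2 * m + 3)" "h 3 $ 0 = c (3, 2 * m + 4)" "h 3 $ 1 = c (3, 2 * m + 5)"
    by (simp_all add: h cusp_ord_def eval_nat_numeral)
  have "w $ 0 = 0" by (simp add: w_def hs[simplified] A_def B_def power2_eq_square)
  moreover have "w $ 1 = odd_coeff m c"
    by (simp add: w_def fps_mult_nth_1 hs[simplified] A_def B_def odd_coeff_def algebra_simps)
  ultimately have v1: "v $ (4 * m + 5) \<noteq> 0 \<and> (\<forall>\<kappa><4 * m + 5. v $ \<kappa> = 0)"
    using c(2) unfolding v by (auto simp: fps_X_power_mult_nth less_Suc_eq_le)
  then have "subdegree v = 4 * m + 5" by (intro subdegreeI) auto
  moreover have "v \<noteq> 0" using v1 by auto
  moreover have "v \<in> subalg fps_const (f ` {1..n})"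
    unfolding v_def using n by (intro subalg.add subalg.mult subalg.const subalg.gen) auto
  ultimately have "4 * m + 5 \<in> orders (subalg fps_const (f ` {1..n}))" using ordersI by metis
  moreover have "f i $ 0 = 0" if "i \<in> {1..n}" for i
    using cusp_params_vanishes[OF c(1) that] m that by (auto simp: f_def vanishes_def cusp_ord_def)
  ultimately show ?thesis unfolding f_def by (subst value_semigroup_eq_orders) auto
qed

lemma cusp_semigroup_cofinite:
  assumes n: "n \<ge> 3" and m: "m > 0" and c: "c \<in> cusp_params n (cusp_ord m)" "odd_coeff m c \<noteq> 0"
    and s: "s \<ge> 2 * m * m + 4 * m + 5"
  shows "s \<in> value_semigroup {1..n} (coeff_fps c)"
proof -
  have f0: "coeff_fps c i $ 0 = 0" if "i \<in> {1..n}" for i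
    using cusp_params_vanishes[OF c(1) that] m that by (auto simp: vanishes_def cusp_ord_def)
  have eq: "value_semigroup {1..n} (coeff_fps c) = orders (subalg fps_const (coeff_fps c ` {1..n}))"
    by (rule value_semigroup_eq_orders) (use f0 in auto)
  have ord: "cusp_ord m i \<in> value_semigroup {1..n} (coeff_fps c)" if "i \<in> {1..n}" for i
    unfolding eq using c(1) that ordersI[OF subalg.gen, of "coeff_fps c i"] by (auto simp: cusp_params_def)
  have "2 * m \<in> value_semigroup {1..n} (coeff_fps c)" "2 * m + 2 \<in> value_semigroup {1..n} (coeff_fps c)"
    using ord[of 1] ord[of 2] n by (auto simp: cusp_ord_def)
  moreover note odd_in_semigroup[OF n m c]
  ultimately show ?thesis unfolding eq
    by (intro cofinite_semigroup[OF _ _ _ _ _ m s]) (auto intro: orders_subalg_add zero_in_orders_subalg)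
qed

lemma eq_of_card_eq:
  assumes "\<And>j. j \<le> N \<Longrightarrow> card (S \<inter> {..<j}) = card (S' \<inter> {..<j})" "\<And>s. s \<ge> N \<Longrightarrow> s \<in> S \<longleftrightarrow> s \<in> S'"
  shows "S = (S' :: nat set)"
proof -
  have *: "card (A \<inter> {..<Suc s}) = card (A \<inter> {..<s}) + (if s \<in> A then 1 else 0)" for A and s :: nat
  proof (cases "s \<in> A")
    case True
    then have "A \<inter> {..<Suc s} = insert s (A \<inter> {..<s})" by auto
    then show ?thesis using True by simp
  next
    case False
    then have "A \<inter> {..<Suc s} = A \<inter> {..<s}" by (auto simp: less_Suc_eq)
    then show ?thesis using False by simp
  qed
  have "s \<in> S \<longleftrightarrow> s \<in> S'" for s
  proof (cases "s < N")
    case True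
    then show ?thesis using *[of S s] *[of S' s] assms(1)[of s] assms(1)[of "Suc s"]
      by (auto split: if_splits)
  qed (use assms(2) in auto)
  then show ?thesis by auto
qed

text \<open>The numbers of orders below \<open>j\<close>, for \<open>j\<close> up to a common bound for the conductors, are
  lower semicontinuous, so that all of them take their maximal values on a nonempty open set; these
  numbers determine the semigroup.\<close>

lemma S_gen_generic:
  assumes n: "n \<ge> 3" and m: "m > 0"
  shows "\<exists>G\<in>poly_funs ({1..n} \<times> UNIV). (\<exists>c\<in>cusp_params n (cusp_ord m). G c \<noteq> 0) \<and>
    (\<forall>c\<in>cusp_params n (cusp_ord m). G c \<noteq> 0 \<longrightarrow>
       value_semigroup {1..n} (coeff_fps c) = S_gen m n \<and> odd_coeff m c \<noteq> 0)"
proof -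
  define N where "N = 2 * m * m + 4 * m + 5"
  define C where "C = cusp_params n (cusp_ord m)"
  define S where "S c = value_semigroup {1..n} (coeff_fps c)" for c
  have f0: "coeff_fps c i $ 0 = 0" if "c \<in> C" "i \<in> {1..n}" for c i
    using cusp_params_vanishes[of c n _ i] that m by (auto simp: C_def vanishes_def cusp_ord_def)
  have S: "S c \<inter> {..<j} = orders (lincomb (exponents {1..n} j) (monomial {1..n} (coeff_fps c))) \<inter> {..<j}"
    if "c \<in> C" for c j
    using value_semigroup_upto[of "{1..n}" "coeff_fps c" j] f0[OF that] unfolding S_def by auto
  \<comment> \<open>The monomials \<open>t^(ord i)\<close>, except that \<open>f 3 = t^(2 m + 4) + t^(2 m + 5)\<close>.\<close>
  define c1 where "c1 = (\<lambda>(i,k). if i \<in> {1..n} \<and> (k = cusp_ord m i \<or> i = 3 \<and> k = 2 * m + 5) then 1 else (0::complex))"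
  have c1: "c1 \<in> C" unfolding C_def cusp_params_iff cusp_space_def affine_space_def
    by (auto simp: c1_def cusp_ord_def)
  have odd1: "odd_coeff m c1 \<noteq> 0" using n by (simp add: odd_coeff_def c1_def cusp_ord_def)
  have max: "\<exists>c\<in>C. \<forall>c'\<in>C. card (S c' \<inter> {..<j}) \<le> card (S c \<inter> {..<j})" for j
  proof -
    have "card (S c \<inter> {..<j}) < Suc j" for c
      using card_mono[of "{..<j}" "S c \<inter> {..<j}"] by auto
    then show ?thesis
      using ex_has_greatest_nat[of "\<lambda>c. c \<in> C" c1 "\<lambda>c. card (S c \<inter> {..<j})" "Suc j"] c1 by auto
  qed
  have "\<exists>p\<in>poly_funs ({1..n} \<times> UNIV). (\<exists>c\<in>C. p c \<noteq> 0) \<and>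
      (\<forall>c\<in>C. p c \<noteq> 0 \<longrightarrow> (\<forall>c'\<in>C. card (S c' \<inter> {..<j}) \<le> card (S c \<inter> {..<j})))" for j
  proof -
    obtain c where c: "c \<in> C" "\<forall>c'\<in>C. card (S c' \<inter> {..<j}) \<le> card (S c \<inter> {..<j})"
      using max by blast
    have coeff: "poly_fps ({1..n} \<times> UNIV) (\<lambda>c. coeff_fps c i)" if "i \<in> {1..n}" for i
      unfolding poly_fps_def coeff_fps_def using that by (auto intro!: poly_funs.coord)
    obtain p where p: "p\<in>poly_funs ({1..n} \<times> UNIV)" "p c \<noteq> 0" "\<And>w. p w \<noteq> 0 \<Longrightarrow>
      card (orders (lincomb (exponents {1..n} j) (monomial {1..n} (coeff_fps c))) \<inter> {..<j})
      \<le> card (orders (lincomb (exponents {1..n} j) (monomial {1..n} (coeff_fps w))) \<inter> {..<j})"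
      using card_orders_semicontinuous[of "exponents {1..n} j" "\<lambda>c. monomial {1..n} (coeff_fps c)"
          "{1..n} \<times> UNIV" c j, OF finite_exponents[OF finite_atLeastAtMost]
          poly_fps_monomial[OF coeff, unfolded poly_fps_def, rule_format]] by metis
    then have "\<forall>c'\<in>C. card (S c' \<inter> {..<j}) \<le> card (S w \<inter> {..<j})" if "w \<in> C" "p w \<noteq> 0" for w
      using p(3)[OF that(2)] c(2) unfolding S[OF that(1), symmetric] S[OF c(1), symmetric]
      by (auto intro: order_trans)
    then show ?thesis using p c(1) by (intro bexI[of _ p]) auto
  qed
  then obtain p where p: "\<And>j. p j \<in> poly_funs ({1..n} \<times> UNIV)" "\<And>j. \<exists>c\<in>C. p j c \<noteq> 0"
    "\<And>j c c'. c \<in> C \<Longrightarrow> p j c \<noteq> 0 \<Longrightarrow> c' \<in> C \<Longrightarrow> card (S c' \<inter> {..<j}) \<le> card (S c \<inter> {..<j})"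
    by metis
  define G where "G c = odd_coeff m c * (\<Prod>j\<le>N. p j c)" for c
  have G: "G \<in> poly_funs ({1..n} \<times> UNIV)"
    unfolding G_def using p(1) n by (intro poly_funs.mult poly_funs_prod odd_coeff_poly)
  define q where "q = (\<lambda>t. case t of None \<Rightarrow> odd_coeff m | Some j \<Rightarrow> p j)"
  have "\<exists>x\<in>C. \<forall>t\<in>insert None (Some ` {..N}). q t x \<noteq> 0"
    unfolding C_def
  proof (rule cusp_params_avoid_finite)
    show "\<exists>x\<in>cusp_params n (cusp_ord m). q t x \<noteq> 0" for t
      using c1 odd1 p(2) unfolding C_def q_def by (auto split: option.split)
    show "q t \<in> poly_funs ({1..n} \<times> UNIV)" for t
      using odd_coeff_poly[OF n] p(1) unfolding q_def by (auto split: option.split)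
  qed auto
  then obtain c0 where c0: "c0 \<in> C" "\<forall>t\<in>insert None (Some ` {..N}). q t c0 \<noteq> 0" by blast
  then have Gc0: "G c0 \<noteq> 0" by (auto simp: G_def q_def)
  have const: "S c = S c0" if c: "c \<in> C" "G c \<noteq> 0" for c
  proof (rule eq_of_card_eq[of N])
    show "card (S c \<inter> {..<j}) = card (S c0 \<inter> {..<j})" if "j \<le> N" for j
      using p(3)[of c j c0] p(3)[of c0 j c] c Gc0 c0(1) that by (auto simp: G_def intro: antisym)
    show "s \<in> S c \<longleftrightarrow> s \<in> S c0" if "s \<ge> N" for s
      using cusp_semigroup_cofinite[OF n m, of _ s] c c0(1) Gc0 that
      unfolding C_def S_def N_def G_def by auto
  qed
  have gen: "is_generic_semigroup n (cusp_ord m) (S c0)"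
    by (rule is_generic_semigroupI[OF G _ Gc0])
      (use c0(1) const in \<open>auto simp: C_def S_def\<close>)
  have ord: "(\<lambda>i. 2 * m + 2 * i - 2) = cusp_ord m" by (auto simp: cusp_ord_def)
  have "S_gen m n = S c0"
    unfolding S_gen_def ord by (rule the_equality, rule gen, rule generic_semigroup_unique[OF _ gen])
  moreover have "odd_coeff m c \<noteq> 0" if "G c \<noteq> 0" for c using that by (auto simp: G_def)
  ultimately have "\<forall>c\<in>C. G c \<noteq> 0 \<longrightarrow> S c = S_gen m n \<and> odd_coeff m c \<noteq> 0"
    using const by metis
  then show ?thesis using G Gc0 c0(1) unfolding C_def S_def by metis
qed

section \<open>Binary forms as truncated power series\<close>

definition deg_le :: "nat \<Rightarrow> complex fps \<Rightarrow> bool" where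
  "deg_le D x \<longleftrightarrow> (\<forall>\<kappa>>D. x $ \<kappa> = 0)"

text \<open>A binary form of degree \<open>D\<close> is represented by its restriction to \<open>x = 1\<close>, a power series in
  \<open>t = y\<close> with no coefficients beyond \<open>D\<close>; this recovers the form.\<close>

definition hom_eval :: "nat \<Rightarrow> complex fps \<Rightarrow> complex \<times> complex \<Rightarrow> complex" where
  "hom_eval D x s = (\<Sum>\<kappa>\<le>D. x $ \<kappa> * fst s ^ (D - \<kappa>) * snd s ^ \<kappa>)"

lemma deg_le_mult:
  assumes "deg_le D x" "deg_le E y" shows "deg_le (D + E) (x * y)"
  unfolding deg_le_def fps_mult_nth
proof (intro allI impI sum.neutral ballI)
  fix \<kappa> i assume "D + E < \<kappa>" "i \<in> {0..\<kappa>}"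
  then have "D < i \<or> E < \<kappa> - i" by auto
  then show "x $ i * y $ (\<kappa> - i) = 0" using assms by (auto simp: deg_le_def)
qed

lemma deg_le_1: "deg_le 0 1" by (simp add: deg_le_def)

lemma deg_le_power: "deg_le D x \<Longrightarrow> deg_le (k * D) (x ^ k)"
  by (induction k) (auto simp: deg_le_1 intro: deg_le_mult)

lemma deg_le_X_power: "N \<le> D \<Longrightarrow> deg_le D (fps_X ^ N)"
  by (auto simp: deg_le_def fps_X_power_nth)

lemma hom_eval_mult:
  assumes "deg_le D x" "deg_le E y"
  shows "hom_eval (D + E) (x * y) s = hom_eval D x s * hom_eval E y s"
proof -
  obtain p q where s: "s = (p, q)" by force
  define h where "h i j = x $ i * y $ j * (p ^ (D + E - (i + j)) * q ^ (i + j))" for i j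
  have "hom_eval (D + E) (x * y) s = (\<Sum>\<kappa>\<le>D + E. \<Sum>i\<le>\<kappa>. h i (\<kappa> - i))"
    unfolding hom_eval_def s fps_mult_nth sum_distrib_right atLeast0AtMost h_def
    by (intro sum.cong refl) (auto simp: algebra_simps)
  also have "\<dots> = (\<Sum>(i,j)\<in>{(i,j). i + j \<le> D + E}. h i j)"
    by (rule sum.triangle_reindex_eq[symmetric])
  also have "\<dots> = (\<Sum>(i,j)\<in>{..D} \<times> {..E}. h i j)"
  proof (rule sum.mono_neutral_right)
    show "finite {(i, j). i + j \<le> D + E}"
      by (rule finite_subset[of _ "{..D+E} \<times> {..D+E}"]) auto
    show "\<forall>t\<in>{(i, j). i + j \<le> D + E} - {..D} \<times> {..E}. (case t of (i, j) \<Rightarrow> h i j) = 0"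
      using assms by (auto simp: h_def deg_le_def) (meson not_le)+
  qed auto
  also have "\<dots> = (\<Sum>i\<le>D. \<Sum>j\<le>E. (x $ i * p ^ (D - i) * q ^ i) * (y $ j * p ^ (E - j) * q ^ j))"
    unfolding sum.cartesian_product[symmetric]
  proof (intro sum.cong refl)
    fix i j assume "i \<in> {..D}" "j \<in> {..E}"
    then have "D + E - (i + j) = (D - i) + (E - j)" by auto
    then show "h i j = (x $ i * p ^ (D - i) * q ^ i) * (y $ j * p ^ (E - j) * q ^ j)"
      by (simp add: h_def power_add algebra_simps)
  qed
  also have "\<dots> = hom_eval D x s * hom_eval E y s"
    by (simp add: hom_eval_def s sum_product)
  finally show ?thesis .
qed

lemma hom_eval_power: "deg_le D x \<Longrightarrow> hom_eval (k * D) (x ^ k) s = hom_eval D x s ^ k"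
  by (induction k) (auto simp: hom_eval_mult deg_le_power, simp add: hom_eval_def)

lemma deg_le_monomial:
  "(\<And>i. i \<in> I \<Longrightarrow> deg_le D (f i)) \<Longrightarrow> deg_le ((\<Sum>i\<in>I. a i) * D) (monomial I f a)"
  unfolding monomial_def
  by (induction I rule: infinite_finite_induct)
    (auto simp: deg_le_1 distrib_right intro!: deg_le_mult deg_le_power)

lemma hom_eval_monomial:
  "finite I \<Longrightarrow> (\<And>i. i \<in> I \<Longrightarrow> deg_le D (f i)) \<Longrightarrow>
    hom_eval ((\<Sum>i\<in>I. a i) * D) (monomial I f a) s = monomial I (\<lambda>i. hom_eval D (f i) s) a"
proof (induction I rule: finite_induct)
  case empty
  show ?case by (simp add: monomial_def hom_eval_def)
next
  case (insert i I)
  have 1: "deg_le (a i * D) (f i ^ a i)" "deg_le ((\<Sum>i\<in>I. a i) * D) (monomial I f a)"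
    using insert.prems by (auto intro: deg_le_power deg_le_monomial)
  have "hom_eval ((\<Sum>i\<in>insert i I. a i) * D) (monomial (insert i I) f a) s
      = hom_eval (a i * D + (\<Sum>i\<in>I. a i) * D) (f i ^ a i * monomial I f a) s"
    using insert by (simp add: monomial_def distrib_right)
  also have "\<dots> = hom_eval D (f i) s ^ a i * monomial I (\<lambda>i. hom_eval D (f i) s) a"
    unfolding hom_eval_mult[OF 1] using insert by (simp add: hom_eval_power)
  also have "\<dots> = monomial (insert i I) (\<lambda>i. hom_eval D (f i) s) a"
    using insert by (simp add: monomial_def)
  finally show ?case .
qed

lemma hom_eval_lincomb:
  "hom_eval D (\<Sum>a\<in>A. fps_const (u a) * v a) s = (\<Sum>a\<in>A. u a * hom_eval D (v a) s)"
  unfolding hom_eval_def nth_lincomb sum_distrib_left sum_distrib_right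
  by (subst sum.swap) (simp add: mult.assoc)

lemma hom_eval_X_power: "N \<le> D \<Longrightarrow> hom_eval D (fps_X ^ N) s = fst s ^ (D - N) * snd s ^ N"
  by (simp add: hom_eval_def fps_X_power_nth if_distrib[of "\<lambda>z. z * _"] cong: if_cong)

lemma hom_eval_scale: "hom_eval D x (z * p, z * q) = z ^ D * hom_eval D x (p, q)"
  unfolding hom_eval_def sum_distrib_left
proof (intro sum.cong refl)
  fix \<kappa> assume "\<kappa> \<in> {..D}"
  then have "z ^ D = z ^ (D - \<kappa>) * z ^ \<kappa>" by (simp flip: power_add)
  then show "x $ \<kappa> * fst (z * p, z * q) ^ (D - \<kappa>) * snd (z * p, z * q) ^ \<kappa> =
      z ^ D * (x $ \<kappa> * fst (p, q) ^ (D - \<kappa>) * snd (p, q) ^ \<kappa>)"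
    by (simp add: power_mult_distrib algebra_simps)
qed

lemma hom_eval_eq_0_imp:
  assumes "deg_le D x" "\<And>q. hom_eval D x (1, q) = 0"
  shows "x = 0"
proof -
  define p where "p = (\<Sum>\<kappa>\<le>D. monom (x $ \<kappa>) \<kappa>)"
  have "poly p q = 0" for q using assms(2)[of q] by (simp add: p_def hom_eval_def poly_sum poly_monom)
  then have "p = 0" using poly_all_0_iff_0 by blast
  moreover have "coeff p \<kappa> = x $ \<kappa>" if "\<kappa> \<le> D" for \<kappa>
    using that by (simp add: p_def coeff_sum)
  ultimately have "x $ \<kappa> = 0" for \<kappa> using assms(1) by (cases "\<kappa> \<le> D") (auto simp: deg_le_def)
  then show ?thesis by (simp add: fps_eq_iff)
qed

lemma param_eq_hom_eval: "param d c s i = hom_eval d (coeff_fps c i) s"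
  by (cases s) (simp add: param_def hom_eval_def coeff_fps_def)

definition form_exponents :: "nat \<Rightarrow> nat \<Rightarrow> (nat \<Rightarrow> nat) set" where
  "form_exponents n k = {a. (\<forall>i. i \<notin> {..n} \<longrightarrow> a i = 0) \<and> (\<Sum>i\<le>n. a i) = k}"

definition forms :: "nat \<Rightarrow> (nat \<Rightarrow> complex fps) \<Rightarrow> nat \<Rightarrow> complex fps set" where
  "forms n F k = lincomb (form_exponents n k) (monomial {..n} F)"

lemma finite_form_exponents: "finite (form_exponents n k)"
  by (rule finite_subset[OF _ finite_exponents[of "{..n}" k]]) (auto simp: form_exponents_def exponents_def)

lemma forms_mult: "x \<in> forms n F k \<Longrightarrow> y \<in> forms n F l \<Longrightarrow> x * y \<in> forms n F (k + l)"
  unfolding forms_def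
  by (erule (1) lincomb_mult, unfold monomial_mult, rule lincomb_base[OF finite_form_exponents])
    (auto simp: form_exponents_def sum.distrib)

lemma forms_gen: "i \<le> n \<Longrightarrow> F i \<in> forms n F 1"
proof -
  assume i: "i \<le> n"
  define a where "a j = (if j = i then 1 else 0 :: nat)" for j
  have "monomial {..n} F a = F i"
    using i by (simp add: monomial_def a_def if_distrib[of "\<lambda>e. _ ^ e"] cong: if_cong)
  moreover have "a \<in> form_exponents n 1" using i by (auto simp: form_exponents_def a_def)
  ultimately show ?thesis unfolding forms_def using lincomb_base[OF finite_form_exponents] by metis
qed

lemma forms_one: "1 \<in> forms n F 0"
proof -
  have "(\<lambda>_. 0) \<in> form_exponents n 0" by (auto simp: form_exponents_def)
  moreover have "monomial {..n} F (\<lambda>_. 0) = 1" by (simp add: monomial_def)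
  ultimately show ?thesis unfolding forms_def using lincomb_base[OF finite_form_exponents] by metis
qed

lemma forms_power: "i \<le> n \<Longrightarrow> F i ^ k \<in> forms n F k"
proof (induction k)
  case (Suc k)
  then show ?case using forms_mult[OF forms_gen[of i n F] Suc.IH] by simp
qed (simp add: forms_one)

lemma forms_deg_le:
  assumes "x \<in> forms n F k" "\<And>i. i \<le> n \<Longrightarrow> deg_le d (F i)"
  shows "deg_le (d * k) x"
proof -
  obtain u where x: "x = (\<Sum>a\<in>form_exponents n k. fps_const (u a) * monomial {..n} F a)"
    using assms(1) by (auto simp: forms_def lincomb_def)
  have "monomial {..n} F a $ \<kappa> = 0" if "a \<in> form_exponents n k" "d * k < \<kappa>" for a \<kappa>
    using deg_le_monomial[of "{..n}" d F a] assms(2) that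
    by (auto simp: form_exponents_def deg_le_def mult.commute)
  then show ?thesis by (auto simp: deg_le_def x nth_lincomb)
qed

text \<open>A combination of monomials in the \<open>F i\<close> is the restriction to the curve of the same combination of
  monomials in the coordinates.\<close>

lemma forms_poly_fun:
  assumes x: "x \<in> forms n F k" and F: "\<And>i. i \<le> n \<Longrightarrow> deg_le d (F i)"
  obtains P where "P \<in> poly_funs {..n}" "\<And>s. P (\<lambda>i. hom_eval d (F i) s) = hom_eval (d * k) x s"
    "k > 0 \<Longrightarrow> P (\<lambda>i. 0) = 0"
proof -
  obtain u where x: "x = (\<Sum>a\<in>form_exponents n k. fps_const (u a) * monomial {..n} F a)"
    using assms(1) by (auto simp: forms_def lincomb_def)
  define P where "P y = (\<Sum>a\<in>form_exponents n k. u a * monomial {..n} y a)" for y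
  have "P \<in> poly_funs {..n}"
    unfolding P_def monomial_def
    by (intro poly_funs_sum poly_funs_scale poly_funs_prod poly_funs_power poly_funs.coord)
  moreover have "P (\<lambda>i. hom_eval d (F i) s) = hom_eval (d * k) x s" for s
    unfolding x hom_eval_lincomb P_def
  proof (intro sum.cong refl)
    fix a assume "a \<in> form_exponents n k"
    then have "(\<Sum>i\<in>{..n}. a i) * d = d * k" by (simp add: form_exponents_def)
    then show "u a * monomial {..n} (\<lambda>i. hom_eval d (F i) s) a = u a * hom_eval (d * k) (monomial {..n} F a) s"
      using hom_eval_monomial[of "{..n}" d F a s, OF finite_atMost] F by (metis atMost_iff)
  qed
  moreover have "P (\<lambda>i. 0) = 0" if "k > 0"
    unfolding P_def
  proof (intro sum.neutral ballI)
    fix a assume "a \<in> form_exponents n k"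
    then have "(\<Sum>i\<le>n. a i) \<noteq> 0" using that by (simp add: form_exponents_def)
    then have "\<exists>i\<le>n. a i \<noteq> 0" by (meson atMost_iff sum.neutral)
    then have "monomial {..n} (\<lambda>i. 0 :: complex) a = 0" by (auto simp: monomial_def)
    then show "u a * monomial {..n} (\<lambda>i. 0) a = 0" by simp
  qed
  ultimately show ?thesis using that by blast
qed

lemma complex_root: 
  fixes z :: complex assumes "d > 0" shows "\<exists>w. w ^ d = z"
proof (cases "z = 0")
  case False
  have "exp (Ln z / of_nat d) ^ d = z" using assms False
    by (simp flip: exp_of_nat_mult)
  then show ?thesis by blast
qed (use assms in \<open>auto intro: exI[of _ 0]\<close>)

lemma image_cone_eq_range:
  assumes "d > 0" shows "image_cone d c = range (param d c)"
proof
  show "range (param d c) \<subseteq> image_cone d c"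
  proof
    fix p assume "p \<in> range (param d c)"
    then obtain s where "p = cscale 1 (param d c s)" by (auto simp: cscale_def)
    then show "p \<in> image_cone d c" unfolding image_cone_def by blast
  qed
  show "image_cone d c \<subseteq> range (param d c)"
  proof
    fix p assume "p \<in> image_cone d c"
    then obtain z x y where p: "p = cscale z (param d c (x, y))" unfolding image_cone_def by auto
    obtain w where "w ^ d = z" using complex_root[OF assms] by blast
    then have "p = param d c (w * x, w * y)"
      by (auto simp: p param_eq_hom_eval hom_eval_scale cscale_def)
    then show "p \<in> range (param d c)" by blast
  qed
qed

section \<open>Hilbert functions\<close>

text \<open>A form vanishes on the cone iff its restriction to the curve is zero, so the monomials on the
  cone satisfy the same linear relations as the monomials in the power series.\<close>

lemma hilbert_function_eq_card_orders:
  assumes d: "d > 0" and c: "c \<in> affine_space ({..n} \<times> {..d})"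
  shows "hilbert_function n (image_cone d c) k = card (orders (forms n (coeff_fps c) k))"
proof -
  define F where "F = coeff_fps c"
  define V where "V = image_cone d c"
  define h where "h a = (\<lambda>x. if x \<in> V then monomial {..n} x a else 0)" for a
  have F: "deg_le d (F i)" for i
    using c by (auto simp: deg_le_def F_def coeff_fps_def affine_space_def)
  have "{(\<lambda>x. if x \<in> V then \<Prod>i\<le>n. x i ^ a i else 0) |a :: nat \<Rightarrow> nat. (\<Sum>i\<le>n. a i) = k}
      = h ` form_exponents n k" (is "?L = ?R")
  proof
    show "?L \<subseteq> ?R"
    proof clarify
      fix a :: "nat \<Rightarrow> nat" assume k: "k = (\<Sum>i\<le>n. a i)"
      define b where "b i = (if i \<le> n then a i else 0)" for i
      have "b \<in> form_exponents n (\<Sum>i\<le>n. a i)" by (auto simp: b_def form_exponents_def intro!: sum.cong)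
      moreover have "(\<lambda>x. if x \<in> V then \<Prod>i\<le>n. x i ^ a i else 0) = h b"
        by (auto simp: h_def b_def monomial_def fun_eq_iff intro!: prod.cong)
      ultimately show "(\<lambda>x. if x \<in> V then \<Prod>i\<le>n. x i ^ a i else 0) \<in> h ` form_exponents n (\<Sum>i\<le>n. a i)"
        by blast
    qed
    show "?R \<subseteq> ?L"
    proof
      fix y assume "y \<in> ?R"
      then obtain a where "a \<in> form_exponents n k" "y = h a" by auto
      then show "y \<in> ?L" by (auto simp: h_def monomial_def form_exponents_def intro!: exI[of _ a])
    qed
  qed
  then have "hilbert_function n V k = cfun.dim (h ` form_exponents n k)"
    by (simp add: hilbert_function_def)
  also have "\<dots> = card (orders (lincomb (form_exponents n k) (monomial {..n} F)))"
  proof (rule dim_eq_card_orders[OF finite_form_exponents])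
    fix u :: "(nat \<Rightarrow> nat) \<Rightarrow> complex"
    define x where "x = (\<Sum>a\<in>form_exponents n k. fps_const (u a) * monomial {..n} F a)"
    have x: "x \<in> forms n F k" unfolding x_def forms_def by (rule lincombI)
    have dx: "deg_le (d * k) x" by (rule forms_deg_le[OF x F])
    have eval: "(\<Sum>a\<in>form_exponents n k. u a * monomial {..n} (param d c s) a) = hom_eval (d * k) x s" for s
      unfolding x_def hom_eval_lincomb
    proof (intro sum.cong refl)
      fix a assume "a \<in> form_exponents n k"
      then have "(\<Sum>i\<in>{..n}. a i) * d = d * k" by (simp add: form_exponents_def)
      then show "u a * monomial {..n} (param d c s) a = u a * hom_eval (d * k) (monomial {..n} F a) s"
        using hom_eval_monomial[of "{..n}" d F a s, OF finite_atMost] F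
        unfolding param_eq_hom_eval[abs_def] F_def by metis
    qed
    show "(\<forall>y. (\<Sum>a\<in>form_exponents n k. u a * h a y) = 0) \<longleftrightarrow>
        (\<Sum>a\<in>form_exponents n k. fps_const (u a) * monomial {..n} F a) = 0"
    proof
      assume 0: "\<forall>y. (\<Sum>a\<in>form_exponents n k. u a * h a y) = 0"
      have "hom_eval (d * k) x s = 0" for s
      proof -
        have "param d c s \<in> V" unfolding V_def image_cone_eq_range[OF d] by simp
        then show ?thesis using spec[OF 0, of "param d c s"] eval[of s] by (simp add: h_def)
      qed
      then show "(\<Sum>a\<in>form_exponents n k. fps_const (u a) * monomial {..n} F a) = 0"
        using hom_eval_eq_0_imp[OF dx] by (simp add: x_def)
    next
      assume "(\<Sum>a\<in>form_exponents n k. fps_const (u a) * monomial {..n} F a) = 0"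
      then have x0: "x = 0" by (simp add: x_def)
      show "\<forall>y. (\<Sum>a\<in>form_exponents n k. u a * h a y) = 0"
      proof
        fix y
        show "(\<Sum>a\<in>form_exponents n k. u a * h a y) = 0"
        proof (cases "y \<in> V")
          case True
          then obtain s where "y = param d c s" unfolding V_def image_cone_eq_range[OF d] by auto
          then show ?thesis using eval[of s] True by (simp add: h_def x0 hom_eval_def)
        qed (simp add: h_def)
      qed
    qed
  next
    show "finite (orders (lincomb (form_exponents n k) (monomial {..n} F)))"
    proof (rule finite_subset[of _ "{..d * k}"])
      show "orders (lincomb (form_exponents n k) (monomial {..n} F)) \<subseteq> {..d * k}"
      proof
        fix s assume "s \<in> orders (lincomb (form_exponents n k) (monomial {..n} F))"
        then obtain x where "x \<in> lincomb (form_exponents n k) (monomial {..n} F)" "x $ s \<noteq> 0"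
          by (rule ordersE)
        then show "s \<in> {..d * k}" using forms_deg_le[of x n F k d] F
          by (auto simp: forms_def deg_le_def not_less[symmetric])
      qed
    qed simp
  qed
  finally show ?thesis by (simp add: V_def F_def forms_def)
qed

section \<open>Tangent spaces\<close>

text \<open>The first clause is the chain rule, which determines the tangent spaces off the cusp. The second one
  is the Taylor expansion along a polynomial curve whose displacement is divisible by \<open>t^M\<close>; at the
  cusp the velocity of the curve is zero, and the expansion is used instead.\<close>

definition is_gradient ::
    "'i set \<Rightarrow> (('i \<Rightarrow> complex) \<Rightarrow> complex) \<Rightarrow> ('i \<Rightarrow> complex) \<Rightarrow> ('i \<Rightarrow> complex) \<Rightarrow> bool" where
  "is_gradient I P p D \<longleftrightarrow>
    (\<forall>\<gamma> v. (\<forall>i\<in>I. ((\<lambda>h. \<gamma> h i) has_field_derivative v i) (at 0) \<and> \<gamma> 0 i = p i) \<longrightarrow>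
      ((\<lambda>h. P (\<gamma> h)) has_field_derivative (\<Sum>i\<in>I. D i * v i)) (at 0)) \<and>
    (\<forall>M \<delta>. (\<forall>i\<in>I. monom 1 M dvd \<delta> i) \<longrightarrow>
      (\<exists>r. \<forall>t. P (\<lambda>i. p i + poly (\<delta> i) t) =
        P p + (\<Sum>i\<in>I. D i * poly (\<delta> i) t) + poly (monom 1 (2 * M) * r) t))"

lemma gradient_exists:
  assumes I: "finite I"
  shows "P \<in> poly_funs I \<Longrightarrow> \<exists>D. is_gradient I P p D"
proof (induction rule: poly_funs.induct)
  case (const z)
  show ?case unfolding is_gradient_def by (intro exI[of _ "\<lambda>_. 0"]) (auto intro!: exI[of _ 0])
next
  case (coord i)
  have "(\<Sum>j\<in>I. (if j = i then 1 else 0) * f j) = f i" for f :: "_ \<Rightarrow> complex"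
    using coord I by (simp add: if_distrib[of "\<lambda>z. z * _"] cong: if_cong)
  then show ?case unfolding is_gradient_def using coord
    by (intro exI[of _ "\<lambda>j. if j = i then 1 else 0"]) (auto intro!: exI[of _ 0])
next
  case (add P Q)
  obtain D where D: "is_gradient I P p D" using add by auto
  obtain E where E: "is_gradient I Q p E" using add by auto
  show ?case
    unfolding is_gradient_def
  proof (rule exI[of _ "\<lambda>i. D i + E i"], intro conjI allI impI)
    fix \<gamma> v assume h: "\<forall>i\<in>I. ((\<lambda>h. \<gamma> h i) has_field_derivative v i) (at 0) \<and> \<gamma> 0 i = p i"
    have "((\<lambda>h. P (\<gamma> h)) has_field_derivative (\<Sum>i\<in>I. D i * v i)) (at 0)"
      "((\<lambda>h. Q (\<gamma> h)) has_field_derivative (\<Sum>i\<in>I. E i * v i)) (at 0)"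
      using D E h unfolding is_gradient_def by blast+
    from DERIV_add[OF this]
    show "((\<lambda>h. P (\<gamma> h) + Q (\<gamma> h)) has_field_derivative (\<Sum>i\<in>I. (D i + E i) * v i)) (at 0)"
      by (simp add: distrib_right sum.distrib)
  next
    fix M \<delta> assume h: "\<forall>i\<in>I. monom 1 M dvd (\<delta> i :: complex poly)"
    obtain r where r: "\<forall>t. P (\<lambda>i. p i + poly (\<delta> i) t) =
        P p + (\<Sum>i\<in>I. D i * poly (\<delta> i) t) + poly (monom 1 (2 * M) * r) t"
      using D h unfolding is_gradient_def by blast
    obtain r' where r': "\<forall>t. Q (\<lambda>i. p i + poly (\<delta> i) t) =
        Q p + (\<Sum>i\<in>I. E i * poly (\<delta> i) t) + poly (monom 1 (2 * M) * r') t"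
      using E h unfolding is_gradient_def by blast
    show "\<exists>r. \<forall>t. P (\<lambda>i. p i + poly (\<delta> i) t) + Q (\<lambda>i. p i + poly (\<delta> i) t) =
        P p + Q p + (\<Sum>i\<in>I. (D i + E i) * poly (\<delta> i) t) + poly (monom 1 (2 * M) * r) t"
      by (rule exI[of _ "r + r'"]) (simp add: r r' distrib_right distrib_left sum.distrib)
  qed
next
  case (mult P Q)
  obtain D where D: "is_gradient I P p D" using mult by auto
  obtain E where E: "is_gradient I Q p E" using mult by auto
  have lin: "(\<Sum>i\<in>I. (Q p * D i + P p * E i) * x i) = Q p * (\<Sum>i\<in>I. D i * x i) + P p * (\<Sum>i\<in>I. E i * x i)" for x
    by (simp add: distrib_right sum.distrib sum_distrib_left mult.assoc)
  show ?case
    unfolding is_gradient_def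
  proof (rule exI[of _ "\<lambda>i. Q p * D i + P p * E i"], intro conjI allI impI)
    fix \<gamma> v assume h: "\<forall>i\<in>I. ((\<lambda>h. \<gamma> h i) has_field_derivative v i) (at 0) \<and> \<gamma> 0 i = p i"
    have 1: "((\<lambda>h. P (\<gamma> h)) has_field_derivative (\<Sum>i\<in>I. D i * v i)) (at 0)"
      "((\<lambda>h. Q (\<gamma> h)) has_field_derivative (\<Sum>i\<in>I. E i * v i)) (at 0)"
      using D E h unfolding is_gradient_def by blast+
    have "P (\<gamma> 0) = P p" by (rule poly_funs_cong[OF mult.hyps(1)]) (use h in auto)
    moreover have "Q (\<gamma> 0) = Q p" by (rule poly_funs_cong[OF mult.hyps(2)]) (use h in auto)
    ultimately have 2: "P (\<gamma> 0) = P p" "Q (\<gamma> 0) = Q p" by auto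
    from DERIV_mult[OF 1]
    show "((\<lambda>h. P (\<gamma> h) * Q (\<gamma> h)) has_field_derivative (\<Sum>i\<in>I. (Q p * D i + P p * E i) * v i)) (at 0)"
      unfolding lin 2 by (simp add: mult.commute)
  next
    fix M \<delta> assume h: "\<forall>i\<in>I. monom 1 M dvd (\<delta> i :: complex poly)"
    obtain r where r: "\<forall>t. P (\<lambda>i. p i + poly (\<delta> i) t) =
        P p + (\<Sum>i\<in>I. D i * poly (\<delta> i) t) + poly (monom 1 (2 * M) * r) t"
      using D h unfolding is_gradient_def by blast
    obtain r' where r': "\<forall>t. Q (\<lambda>i. p i + poly (\<delta> i) t) =
        Q p + (\<Sum>i\<in>I. E i * poly (\<delta> i) t) + poly (monom 1 (2 * M) * r') t"
      using E h unfolding is_gradient_def by blast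
    define \<alpha> where "\<alpha> = (\<Sum>i\<in>I. smult (D i) (\<delta> i))"
    define \<beta> where "\<beta> = (\<Sum>i\<in>I. smult (E i) (\<delta> i))"
    have "monom 1 M dvd \<alpha>" "monom 1 M dvd \<beta>"
      unfolding \<alpha>_def \<beta>_def using h by (auto intro!: dvd_sum dvd_smult)
    then obtain \<alpha>' \<beta>' where \<alpha>\<beta>: "\<alpha> = monom 1 M * \<alpha>'" "\<beta> = monom 1 M * \<beta>'" by (auto elim!: dvdE)
    have "monom 1 M * monom 1 M = (monom 1 (2 * M) :: complex poly)" by (simp add: mult_monom mult_2)
    then have e: "\<alpha> * \<beta> = monom 1 (2 * M) * (\<alpha>' * \<beta>')" unfolding \<alpha>\<beta>
      by (metis mult.assoc mult.left_commute)
    have e': "poly \<alpha> t * poly \<beta> t = poly (monom 1 (2 * M)) t * (poly \<alpha>' t * poly \<beta>' t)" for t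
      using arg_cong[OF e, of "\<lambda>x. poly x t"] by simp
    have s: "(\<Sum>i\<in>I. D i * poly (\<delta> i) t) = poly \<alpha> t" "(\<Sum>i\<in>I. E i * poly (\<delta> i) t) = poly \<beta> t" for t
      by (auto simp: \<alpha>_def \<beta>_def poly_sum)
    define R where "R = \<alpha>' * \<beta>' + r * ([:Q p:] + \<beta> + monom 1 (2 * M) * r') + r' * ([:P p:] + \<alpha>)"
    show "\<exists>r. \<forall>t. P (\<lambda>i. p i + poly (\<delta> i) t) * Q (\<lambda>i. p i + poly (\<delta> i) t) =
        P p * Q p + (\<Sum>i\<in>I. (Q p * D i + P p * E i) * poly (\<delta> i) t) + poly (monom 1 (2 * M) * r) t"
    proof (rule exI[of _ R], rule allI)
      fix t
      show "P (\<lambda>i. p i + poly (\<delta> i) t) * Q (\<lambda>i. p i + poly (\<delta> i) t) =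
        P p * Q p + (\<Sum>i\<in>I. (Q p * D i + P p * E i) * poly (\<delta> i) t) + poly (monom 1 (2 * M) * R) t"
        unfolding r[rule_format] r'[rule_format] lin s R_def using e'[of t]
        by (simp add: algebra_simps)
    qed
  qed
qed

definition gradient :: "'i set \<Rightarrow> (('i \<Rightarrow> complex) \<Rightarrow> complex) \<Rightarrow> ('i \<Rightarrow> complex) \<Rightarrow> 'i \<Rightarrow> complex" where
  "gradient I P p = (SOME D. is_gradient I P p D)"

lemma is_gradient_gradient: "finite I \<Longrightarrow> P \<in> poly_funs I \<Longrightarrow> is_gradient I P p (gradient I P p)"
  unfolding gradient_def using gradient_exists[of I P p] someI_ex[of "is_gradient I P p"] by simp

lemma gradient_chain:
  assumes "finite I" "P \<in> poly_funs I"
    and "\<And>i. i \<in> I \<Longrightarrow> ((\<lambda>h. \<gamma> h i) has_field_derivative v i) (at 0)" "\<And>i. i \<in> I \<Longrightarrow> \<gamma> 0 i = p i"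
  shows "((\<lambda>h. P (\<gamma> h)) has_field_derivative (\<Sum>i\<in>I. gradient I P p i * v i)) (at 0)"
  using conjunct1[OF is_gradient_gradient[OF assms(1,2), of p, unfolded is_gradient_def],
      rule_format, of \<gamma> v] assms(3,4) by blast

lemma gradient_taylor:
  assumes "finite I" "P \<in> poly_funs I" "\<And>i. i \<in> I \<Longrightarrow> monom 1 M dvd \<delta> i"
  shows "\<exists>r. \<forall>t. P (\<lambda>i. p i + poly (\<delta> i) t) =
    P p + (\<Sum>i\<in>I. gradient I P p i * poly (\<delta> i) t) + poly (monom 1 (2 * M) * r) t"
  using conjunct2[OF is_gradient_gradient[OF assms(1,2), of p, unfolded is_gradient_def],
      rule_format, of M \<delta>] assms(3) by blast

lemma gradient_line:
  assumes "finite I" "P \<in> poly_funs I"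
  shows "((\<lambda>h. P (p + cscale h v)) has_field_derivative (\<Sum>i\<in>I. gradient I P p i * v i)) (at 0)"
  by (rule gradient_chain[OF assms]) (auto simp: cscale_def intro!: derivative_eq_intros)

lemma tangent_space_iff:
  assumes "finite I"
  shows "v \<in> tangent_space I V p \<longleftrightarrow> v \<in> affine_space I \<and>
    (\<forall>P\<in>poly_funs I. (\<forall>x\<in>V. P x = 0) \<longrightarrow> (\<Sum>i\<in>I. gradient I P p i * v i) = 0)"
proof -
  have "((\<lambda>h. P (p + cscale h v)) has_field_derivative 0) (at 0) \<longleftrightarrow> (\<Sum>i\<in>I. gradient I P p i * v i) = 0"
    if "P \<in> poly_funs I" for P
    using gradient_line[OF assms that, of p v] DERIV_unique by metis
  then show ?thesis unfolding tangent_space_def by blast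
qed

lemma tangent_space_subset: "tangent_space I V p \<subseteq> affine_space I"
  by (auto simp: tangent_space_def)

lemma affine_space_subset_span:
  assumes "finite I"
  shows "\<exists>E. finite E \<and> affine_space I \<subseteq> cfun.span E"
proof (intro exI conjI)
  define e where "e = (\<lambda>i::'a. (\<lambda>x. if x = i then 1 else (0::complex)))"
  show "finite (e ` I)" using assms by simp
  show "affine_space I \<subseteq> cfun.span (e ` I)"
  proof
    fix x assume x: "x \<in> affine_space I"
    have "x = (\<Sum>i\<in>I. cscale (x i) (e i))"
    proof
      fix j
      show "x j = (\<Sum>i\<in>I. cscale (x i) (e i)) j"
        using x assms by (auto simp: sum_fun_apply cscale_def e_def affine_space_def
            if_distrib[of "\<lambda>z. _ * z"] cong: if_cong)
    qed
    moreover have "(\<Sum>i\<in>I. cscale (x i) (e i)) \<in> cfun.span (e ` I)"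
      by (intro cfun.span_sum cfun.span_scale cfun.span_base) auto
    ultimately show "x \<in> cfun.span (e ` I)" by simp
  qed
qed

lemma finite_basis_exists:
  assumes "finite I" "X \<subseteq> affine_space I"
  obtains B where "finite B" "B \<subseteq> X" "cfun.independent B" "X \<subseteq> cfun.span B" "card B = cfun.dim X"
proof -
  obtain B where B: "B \<subseteq> X" "cfun.independent B" "X \<subseteq> cfun.span B" "card B = cfun.dim X"
    using cfun.basis_exists by metis
  obtain E where "finite E" "affine_space I \<subseteq> cfun.span E" using affine_space_subset_span[OF assms(1)] by blast
  then have "finite B" using cfun.independent_span_bound[of E B] B assms(2) by auto
  then show ?thesis using B that by blast
qed

lemma dim_ge_card:
  assumes "finite I" "X \<subseteq> affine_space I" "finite T" "indep_fam T h UNIV" "\<And>t. t \<in> T \<Longrightarrow> h t \<in> X"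
  shows "card T \<le> cfun.dim X"
proof (rule ccontr)
  assume less: "\<not> card T \<le> cfun.dim X"
  obtain B where B: "finite B" "X \<subseteq> cfun.span B" "card B = cfun.dim X"
    using finite_basis_exists[OF assms(1,2)] by metis
  have "\<exists>u. (\<exists>a\<in>T. u a \<noteq> 0) \<and> (\<forall>x. (\<Sum>a\<in>T. u a * h a x) = 0)"
    by (rule dependent_family[OF B(1) assms(3)]) (use B assms less in auto)
  then show False using assms(4) unfolding indep_fam_def by auto
qed

text \<open>The functionals \<open>L \<kappa>\<close>, \<open>\<kappa> \<in> K\<close>, embed \<open>X\<close> into a space of dimension \<open>card K\<close>.\<close>

lemma dim_le_card:
  assumes "finite I" "X \<subseteq> affine_space I" "cfun.subspace X" "finite K"
    and inj: "\<And>x. x \<in> X \<Longrightarrow> (\<And>\<kappa>. \<kappa> \<in> K \<Longrightarrow> (\<Sum>i\<in>I. L \<kappa> i * x i) = 0) \<Longrightarrow> x = 0"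
  shows "cfun.dim X \<le> card K"
proof -
  obtain B where B: "finite B" "B \<subseteq> X" "cfun.independent B" "card B = cfun.dim X"
    using finite_basis_exists[OF assms(1,2)] by metis
  have "indep_fam B (\<lambda>b \<kappa>. \<Sum>i\<in>I. L \<kappa> i * b i) K"
    unfolding indep_fam_def
  proof (intro allI impI)
    fix u assume u: "\<forall>\<kappa>\<in>K. (\<Sum>b\<in>B. u b * (\<Sum>i\<in>I. L \<kappa> i * b i)) = 0"
    define x where "x = (\<Sum>b\<in>B. cscale (u b) b)"
    have "x \<in> X" unfolding x_def using B(2) assms(3)
      by (intro cfun.subspace_sum cfun.subspace_scale) auto
    moreover have "(\<Sum>i\<in>I. L \<kappa> i * x i) = 0" if "\<kappa> \<in> K" for \<kappa>
    proof -
      have "(\<Sum>i\<in>I. L \<kappa> i * x i) = (\<Sum>b\<in>B. u b * (\<Sum>i\<in>I. L \<kappa> i * b i))"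
        unfolding x_def sum_fun_apply cscale_def sum_distrib_left
        by (subst sum.swap) (simp add: mult.left_commute)
      then show ?thesis using u that by simp
    qed
    ultimately have "x = 0" by (rule inj)
    then show "\<forall>b\<in>B. u b = 0" using cfun.independentD[OF B(3,1), of u] unfolding x_def by blast
  qed
  from indep_fam_card_le[OF this B(1) assms(4)] show ?thesis using B(4) by simp
qed

lemma subspace_tangent_space:
  assumes "finite I" shows "cfun.subspace (tangent_space I V p)"
  unfolding cfun.subspace_def
proof (intro conjI ballI allI)
  show "0 \<in> tangent_space I V p" by (simp add: tangent_space_iff[OF assms] affine_space_def)
next
  fix x y assume "x \<in> tangent_space I V p" "y \<in> tangent_space I V p"
  then show "x + y \<in> tangent_space I V p"
    by (simp add: tangent_space_iff[OF assms] affine_space_def distrib_left sum.distrib)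
next
  fix z x assume "x \<in> tangent_space I V p"
  moreover have "(\<Sum>i\<in>I. D i * (z * x i)) = z * (\<Sum>i\<in>I. D i * x i)" for D
    by (simp add: sum_distrib_left mult.left_commute)
  ultimately show "cscale z x \<in> tangent_space I V p"
    by (simp add: tangent_space_iff[OF assms] affine_space_def cscale_def)
qed

section \<open>A criterion for membership in the Severi variety\<close>

lemma card_Int_lessThan_add_gaps:
  assumes cond: "\<And>s. C \<le> s \<Longrightarrow> s \<in> S" and N: "C \<le> N"
  shows "card (S \<inter> {..<N}) + card (UNIV - S) = (N :: nat)"
proof -
  have "x < N" if "x \<notin> S" for x using cond[of x] N that by (cases "x < N") auto
  then have "UNIV - S = {..<N} - S" by auto
  moreover have "card ({..<N} \<inter> S) + card ({..<N} - S) = card {..<N}"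
    using card_Int_Diff[of "{..<N}" S] by simp
  ultimately show ?thesis by (simp add: Int_commute)
qed

text \<open>The forms of degree \<open>k\<close> in the coordinates, restricted to the curve, have at the cusp only orders
  that belong to \<open>S\<close>, so that at least \<open>g\<close> orders up to \<open>d k\<close> are missing. The assumption \<open>rank\<close> says
  that no more than these \<open>g\<close> are missing, for finitely many \<open>k\<close>; in effect, the conditions on forms
  that the curve imposes all come from the cusp. As a condition on ranks it is open in the
  coefficients. It excludes any further singularity and determines the arithmetic genus.\<close>

locale cusp_map =
  fixes n m d k1 C g :: nat and A :: "nat \<Rightarrow> nat \<Rightarrow> complex" and f :: "nat \<Rightarrow> complex fps"
    and c :: "nat \<times> nat \<Rightarrow> complex" and S :: "nat set"
  assumes n: "3 \<le> n" and m: "0 < m" and nm: "n \<le> m"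
    and A1: "\<And>i. A i i = 1"
    and fdeg: "\<And>j. j \<le> n \<Longrightarrow> deg_le d (f j)"
    and f00: "f 0 $ 0 \<noteq> 0"
    and fvan: "\<And>j. j \<in> {1..n} \<Longrightarrow> vanishes (cusp_ord m j) (f j)"
    and ford: "\<And>j. j \<in> {1..n} \<Longrightarrow> f j $ cusp_ord m j \<noteq> 0"
    and c_def: "c = (\<lambda>(i, k). if i \<le> n \<and> k \<le> d then \<Sum>j\<le>i. A i j * f j $ k else 0)"
    and semi: "value_semigroup {1..n} (\<lambda>j. f j / f 0) = S"
    and cond: "\<And>s. C \<le> s \<Longrightarrow> s \<in> S" and Cd: "C \<le> d" and d: "2 \<le> d"
    and g: "g = card (UNIV - S)" and k1: "2 \<le> k1"
    and rank: "\<And>k. k1 \<le> k \<Longrightarrow> k \<le> 2 * k1 + 1 \<Longrightarrow>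
      d * k + 1 \<le> card (orders (forms n (coeff_fps c) k) \<inter> {..<d * k + 1}) + g"
begin

abbreviation "F \<equiv> coeff_fps c"

definition "gf j = f j * inverse (f 0)"

lemma c_affine: "c \<in> affine_space ({..n} \<times> {..d})"
  by (auto simp: c_def affine_space_def)

lemma Fdeg: "deg_le d (F i)"
  by (auto simp: deg_le_def coeff_fps_def c_def)

lemma F_eq: "i \<le> n \<Longrightarrow> F i = (\<Sum>j\<le>i. fps_const (A i j) * f j)"
proof -
  assume i: "i \<le> n"
  have "(\<Sum>j\<le>i. A i j * f j $ k) = 0" if "d < k" for k
    using fdeg that i by (intro sum.neutral) (auto simp: deg_le_def)
  then show ?thesis using i by (auto simp: fps_eq_iff nth_lincomb coeff_fps_def c_def)
qed

lemma F0: "F 0 = f 0" using F_eq[of 0] A1 by simp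

lemma f_0: "j \<in> {1..n} \<Longrightarrow> f j $ 0 = 0"
  using fvan[of j] m by (auto simp: vanishes_def cusp_ord_def)

lemma param_10: "param d c (1, 0) i = c (i, 0)"
  by (simp add: param_def power_0_left if_distrib[of "\<lambda>z. _ * z"] cong: if_cong)

lemma c_i0:
  assumes "i \<le> n" shows "c (i, 0) = A i 0 * f 0 $ 0"
proof -
  have "c (i, 0) = (\<Sum>j\<le>i. A i j * f j $ 0)" using assms by (simp add: c_def)
  also have "\<dots> = (\<Sum>j\<in>{0}. A i j * f j $ 0)"
    by (rule sum.mono_neutral_right) (use assms f_0 in auto)
  finally show ?thesis by simp
qed

lemma inv0: "f 0 * inverse (f 0) = 1" "inverse (f 0) * f 0 = 1"
  using f00 by (simp_all add: inverse_mult_eq_1 inverse_mult_eq_1')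

lemma gf0: "gf 0 = 1" by (simp add: gf_def inv0)

lemma divide_f0: "x / f 0 = x * inverse (f 0)"
  using f00 by (simp add: fps_divide_unit)

lemma gf_0: "j \<in> {1..n} \<Longrightarrow> gf j $ 0 = 0" by (simp add: gf_def f_0)

lemma S_eq: "S = orders (subalg fps_const (gf ` {1..n}))"
proof -
  have "(\<lambda>j. f j / f 0) = gf" by (simp add: fun_eq_iff gf_def divide_f0)
  then show ?thesis using semi value_semigroup_eq_orders[of "{1..n}" gf] gf_0 by auto
qed

lemma F_inv: "i \<le> n \<Longrightarrow> F i * inverse (f 0) = (\<Sum>j\<le>i. fps_const (A i j) * gf j)"
  by (simp add: F_eq gf_def sum_distrib_right mult.assoc)

lemma gf_in_subalg: "j \<le> n \<Longrightarrow> gf j \<in> subalg fps_const (gf ` {1..n})"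
  using gf0 subalg.const[of fps_const 1 "gf ` {1..n}"] by (cases "j = 0") (auto intro: subalg.gen)

lemma F_inv_in_subalg: "i \<le> n \<Longrightarrow> F i * inverse (f 0) \<in> subalg fps_const (gf ` {1..n})"
  unfolding F_inv by (intro subalg_sum subalg.mult subalg.const gf_in_subalg) auto

text \<open>The germ differs from \<open>(gf 1, \<dots>, gf n)\<close> by a unitriangular linear map.\<close>

lemma germ_semigroup: "has_value_semigroup_at n d c (1, 0) S"
proof -
  define \<phi> where "\<phi> = local_germ d c (1, 0) (0, 1) 0"
  have "param_fps d c (1, 0) (0, 1) i = F i" for i
  proof -
    have "param_fps d c (1, 0) (0, 1) i = (\<Sum>k\<le>d. fps_const (c (i, k)) * fps_X ^ k)"
      by (simp add: param_fps_def)
    moreover have "\<dots> $ \<kappa> = F i $ \<kappa>" for \<kappa>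
      using Fdeg[of i] by (auto simp: nth_lincomb fps_X_power_nth coeff_fps_def deg_le_def
          if_distrib[of "\<lambda>z. _ * z"] cong: if_cong)
    ultimately show ?thesis by (simp add: fps_eq_iff)
  qed
  moreover have "c (i, 0) / c (0, 0) = A i 0" if "i \<le> n" for i
    using that A1 f00 by (simp add: c_i0)
  ultimately have \<phi>: "\<phi> i = (\<Sum>j\<in>{1..i}. fps_const (A i j) * gf j)" if "i \<le> n" for i
  proof -
    have "\<phi> i = F i * inverse (f 0) - fps_const (A i 0)"
      using that \<open>\<And>i. param_fps d c (1, 0) (0, 1) i = F i\<close>
        \<open>\<And>i. i \<le> n \<Longrightarrow> c (i, 0) / c (0, 0) = A i 0\<close>
      by (simp add: \<phi>_def local_germ_def F0 divide_f0 param_10)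
    also have "F i * inverse (f 0) = fps_const (A i 0) * gf 0 + (\<Sum>j\<in>{1..i}. fps_const (A i j) * gf j)"
      unfolding F_inv[OF that] by (simp add: atMost_atLeast0 sum.atLeast_Suc_atMost)
    finally show ?thesis by (simp add: gf0)
  qed
  have "subalg fps_const (\<phi> ` {1..n}) = subalg fps_const (gf ` {1..n})"
  proof
    show "subalg fps_const (\<phi> ` {1..n}) \<subseteq> subalg fps_const (gf ` {1..n})"
    proof (rule subsetI, erule subalg_least, clarify)
      fix i assume "i \<in> {1..n}"
      then show "\<phi> i \<in> subalg fps_const (gf ` {1..n})"
        by (subst \<phi>) (auto intro!: subalg_sum subalg.mult subalg.const gf_in_subalg[unfolded One_nat_def])
    qed
    show "subalg fps_const (gf ` {1..n}) \<subseteq> subalg fps_const (\<phi> ` {1..n})"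
    proof (rule subsetI, erule subalg_least, clarify)
      fix i assume "i \<in> {1..n}"
      then show "gf i \<in> subalg fps_const (\<phi> ` {1..n})"
      proof (induction i rule: less_induct)
        case (less i)
        have "{1..i} = insert i {1..<i}" using less.prems by auto
        then have "gf i = \<phi> i + fps_const (-1) * (\<Sum>j\<in>{1..<i}. fps_const (A i j) * gf j)"
          using \<phi>[of i] less.prems A1 by (simp flip: fps_const_neg)
        also have "\<dots> \<in> subalg fps_const (\<phi> ` {1..n})"
          using less by (intro subalg.add subalg.mult subalg.const subalg_sum) (auto intro: subalg.gen)
        finally show ?case .
      qed
    qed
  qed
  moreover have "\<phi> i $ 0 = 0" if "i \<in> {1..n}" for i
    using that gf_0 by (auto simp: \<phi> nth_lincomb intro!: sum.neutral)
  ultimately have "value_semigroup {1..n} \<phi> = S"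
    unfolding S_eq by (subst value_semigroup_eq_orders) auto
  moreover have "{..n} - {0} = {1..n}" by auto
  moreover have "param d c (1, 0) 0 \<noteq> 0"
    using f00 A1 by (simp add: param_10 c_i0)
  ultimately show ?thesis unfolding has_value_semigroup_at_def \<phi>_def
    by (intro exI[of _ 0] exI[of _ "(0, 1)"]) simp
qed

text \<open>Division by the unit \<open>F 0 ^ k\<close> moves the forms into the algebra of the germ.\<close>

lemma orders_forms_subset: "orders (forms n F k) \<subseteq> S \<inter> {..<d * k + 1}"
proof
  fix s assume "s \<in> orders (forms n F k)"
  then obtain x where x: "x \<in> forms n F k" "x \<noteq> 0" "s = subdegree x" by (auto simp: orders_def)
  have "x $ s \<noteq> 0" using x by simp
  then have s: "s < d * k + 1" using forms_deg_le[OF x(1) Fdeg] by (cases "s \<le> d * k") (auto simp: deg_le_def)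
  obtain u where u: "x = (\<Sum>a\<in>form_exponents n k. fps_const (u a) * monomial {..n} F a)"
    using x(1) by (auto simp: forms_def lincomb_def)
  define y where "y = x * inverse (f 0) ^ k"
  have "monomial {..n} F a * inverse (f 0) ^ k = (\<Prod>i\<le>n. (F i * inverse (f 0)) ^ a i)"
    if "a \<in> form_exponents n k" for a
  proof -
    have "inverse (f 0) ^ k = (\<Prod>i\<le>n. inverse (f 0) ^ a i)"
      using that by (simp add: form_exponents_def flip: power_sum)
    then show ?thesis by (simp add: monomial_def power_mult_distrib prod.distrib)
  qed
  then have "y = (\<Sum>a\<in>form_exponents n k. fps_const (u a) * (\<Prod>i\<le>n. (F i * inverse (f 0)) ^ a i))"
    by (simp add: y_def u sum_distrib_right mult.assoc)
  then have "y \<in> subalg fps_const (gf ` {1..n})"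
    by (simp only:) (intro subalg_sum F_inv_in_subalg subalg.mult subalg.const subalg_prod subalg_power, auto)
  moreover have inv: "inverse (f 0) \<noteq> 0" using inv0 by force
  then have "y \<noteq> 0" using x by (simp add: y_def)
  moreover have "subdegree y = s"
    using x inv f00 by (simp add: y_def subdegree_power)
  ultimately show "s \<in> S \<inter> {..<d * k + 1}" using s ordersI unfolding S_eq by blast
qed

lemma card_S: "C \<le> N \<Longrightarrow> card (S \<inter> {..<N}) + g = N"
  using card_Int_lessThan_add_gaps[OF cond] g by simp

text \<open>The forms of degree \<open>k\<close> contain everything that is divisible by the conductor.\<close>

definition "full k \<longleftrightarrow> (\<forall>x. vanishes C x \<longrightarrow> deg_le (d * k) x \<longrightarrow> x \<in> forms n F k)"

lemma C_le: "k > 0 \<Longrightarrow> C \<le> d * k" using Cd by (metis mult_le_mono2 mult.right_neutral Suc_leI One_nat_def order_trans)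

lemma orders_forms_base:
  assumes "k1 \<le> k" "k \<le> 2 * k1 + 1"
  shows "orders (forms n F k) = S \<inter> {..<d * k + 1}"
proof (rule card_seteq)
  have "card (S \<inter> {..<d * k + 1}) + g = d * k + 1" using C_le[of k] assms k1 by (intro card_S) auto
  moreover have "orders (forms n F k) \<inter> {..<d * k + 1} = orders (forms n F k)"
    using orders_forms_subset by auto
  ultimately show "card (S \<inter> {..<d * k + 1}) \<le> card (orders (forms n F k))"
    using rank[OF assms] by simp
qed (use orders_forms_subset in auto)

text \<open>All orders from \<open>C\<close> on are attained, so the coefficients of \<open>x\<close> can be removed one by one.\<close>

lemma full_base:
  assumes "k1 \<le> k" "k \<le> 2 * k1 + 1"
  shows "full k"
proof -
  have "x \<in> forms n F k" if "C \<le> j" "vanishes j x" "deg_le (d * k) x" for x j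
    using that
  proof (induction "d * k + 1 - j" arbitrary: x j rule: less_induct)
    case less
    show ?case
    proof (cases "j < d * k + 1")
      case False
      then have "x $ \<kappa> = 0" for \<kappa> using less.prems by (cases "\<kappa> < j") (auto simp: vanishes_def deg_le_def)
      then have "x = 0" by (simp add: fps_eq_iff)
      then show ?thesis by (simp add: forms_def lincomb_zero)
    next
      case True
      have "j \<in> orders (forms n F k)" unfolding orders_forms_base[OF assms] using cond less.prems(1) True by auto
      then obtain y where y: "y \<in> forms n F k" "y $ j \<noteq> 0" "\<forall>\<kappa><j. y $ \<kappa> = 0" by (rule ordersE)
      have dy: "deg_le (d * k) y" by (rule forms_deg_le[OF y(1) Fdeg])
      define x' where "x' = x - fps_const (x $ j / y $ j) * y"
      have "vanishes (Suc j) x'" using less.prems(2) y by (auto simp: vanishes_def x'_def less_Suc_eq)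
      moreover have "deg_le (d * k) x'" using less.prems(3) dy by (auto simp: deg_le_def x'_def)
      ultimately have "x' \<in> forms n F k"
        using less.hyps[of "Suc j" x'] less.prems True by auto
      then have "x' + fps_const (x $ j / y $ j) * y \<in> forms n F k"
        using y(1) unfolding forms_def by (intro lincomb_add lincomb_scale)
      then show ?thesis by (simp add: x'_def)
    qed
  qed
  then show ?thesis unfolding full_def by blast
qed

text \<open>Dividing by the unit \<open>F 0 ^ k1\<close> modulo a power of \<open>t\<close> writes a form divisible by \<open>t^C\<close> as a
  combination of the coprime forms \<open>F 0 ^ k1\<close> and \<open>t^(d k1)\<close>, with coefficients that are again
  divisible by \<open>t^C\<close>.\<close>

lemma full_step:
  assumes k: "full k" "k1 + 1 \<le> k"
  shows "full (k1 + k)"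
  unfolding full_def
proof (intro allI impI)
  fix x assume x: "vanishes C x" "deg_le (d * (k1 + k)) x"
  define M where "M = d * k1"
  define \<Phi> where "\<Phi> = F 0 ^ k1"
  have \<Phi>: "\<Phi> \<in> forms n F k1" unfolding \<Phi>_def by (rule forms_power) simp
  have d\<Phi>: "deg_le M \<Phi>" unfolding M_def using forms_deg_le[OF \<Phi> Fdeg] .
  have \<Phi>0: "\<Phi> $ 0 \<noteq> 0" using f00 by (simp add: \<Phi>_def F0 fps_power_zeroth)
  have "vanishes C (fps_X ^ M)" "deg_le (d * k1) (fps_X ^ M)"
    using C_le[of k1] k1 by (auto simp: M_def vanishes_def fps_X_power_nth intro: deg_le_X_power)
  then have XM: "fps_X ^ M \<in> forms n F k1" using full_base[of k1] by (auto simp: full_def)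
  \<comment> \<open>The cutoff is at \<open>M + C\<close> so that the quotient by \<open>t^M\<close> is still divisible by \<open>t^C\<close>.\<close>
  define u where "u = fps_cutoff (M + C) (x * inverse \<Phi>)"
  have MC: "M + C \<le> d * k"
    using mult_le_mono2[OF k(2), of d] Cd by (simp add: M_def algebra_simps)
  have xi: "vanishes C (x * inverse \<Phi>)"
    using vanishes_mult[OF x(1), of 0 "inverse \<Phi>"] by (simp add: vanishes_def)
  then have "vanishes C u" unfolding u_def vanishes_def by simp
  moreover have du: "deg_le (d * k) u" unfolding u_def deg_le_def using MC by auto
  ultimately have u: "u \<in> forms n F k" using k(1) by (auto simp: full_def)
  have "x - \<Phi> * u = \<Phi> * (x * inverse \<Phi> - u)"
    using inverse_mult_eq_1'[OF \<Phi>0] by (simp add: right_diff_distrib mult.left_commute[of \<Phi> x])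
  moreover have "vanishes (M + C) (x * inverse \<Phi> - u)" by (simp add: u_def vanishes_def)
  ultimately have van: "vanishes (M + C) (x - \<Phi> * u)"
    using vanishes_mult[of 0 \<Phi> "M + C"] by (simp add: vanishes_def[of 0])
  define v where "v = fps_shift M (x - \<Phi> * u)"
  have "vanishes C v" using van by (auto simp: vanishes_def v_def)
  moreover have "deg_le (d * (k1 + k)) (\<Phi> * u)"
    using deg_le_mult[OF d\<Phi> du] by (simp add: M_def distrib_left)
  then have "deg_le (d * k) v" using x(2) by (auto simp: deg_le_def v_def M_def distrib_left)
  ultimately have v: "v \<in> forms n F k" using k(1) by (auto simp: full_def)
  have "x - \<Phi> * u = fps_X ^ M * v"
    using van by (auto simp: fps_eq_iff fps_X_power_mult_nth v_def vanishes_def)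
  then have "x = \<Phi> * u + fps_X ^ M * v" by (simp add: algebra_simps)
  then show "x \<in> forms n F (k1 + k)"
    using forms_mult[OF \<Phi> u] forms_mult[OF XM v] unfolding forms_def by (simp add: lincomb_add)
qed

lemma full: "k1 \<le> k \<Longrightarrow> full k"
proof (induction k rule: less_induct)
  case (less k)
  show ?case
  proof (cases "k \<le> 2 * k1 + 1")
    case True
    then show ?thesis using full_base less by simp
  next
    case False
    then have "full (k1 + (k - k1))" using less k1 by (intro full_step less.IH) auto
    then show ?thesis using False by simp
  qed
qed

lemma X_power_in_forms: "k1 \<le> k \<Longrightarrow> C \<le> N \<Longrightarrow> N \<le> d * k \<Longrightarrow> fps_X ^ N \<in> forms n F k"
  using full[of k] deg_le_X_power[of N "d * k"] unfolding full_def
  by (auto simp: vanishes_def fps_X_power_nth)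

lemma orders_forms:
  assumes k: "k1 \<le> k" shows "orders (forms n F k) = S \<inter> {..<d * k + 1}"
proof
  show "orders (forms n F k) \<subseteq> S \<inter> {..<d * k + 1}" by (rule orders_forms_subset)
  show "S \<inter> {..<d * k + 1} \<subseteq> orders (forms n F k)"
  proof
    fix s assume s: "s \<in> S \<inter> {..<d * k + 1}"
    show "s \<in> orders (forms n F k)"
    proof (cases "C \<le> s")
      case True
      then show ?thesis using ordersI[OF X_power_in_forms[OF k True]] s by simp
    next
      case False
      then have "s \<in> orders (forms n F k1)"
        using orders_forms_base[of k1] s C_le[of k1] k1 by auto
      then obtain x where x: "x \<in> forms n F k1" "x \<noteq> 0" "subdegree x = s" by (auto simp: orders_def)
      have "x * F 0 ^ (k - k1) \<in> forms n F (k1 + (k - k1))"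
        by (rule forms_mult[OF x(1) forms_power]) simp
      moreover have "F 0 \<noteq> 0" "subdegree (F 0) = 0" using f00 by (auto simp: F0)
      ultimately show ?thesis using ordersI[of "x * F 0 ^ (k - k1)"] x k by (simp add: subdegree_power)
    qed
  qed
qed

lemma arithmetic_genus: "has_arithmetic_genus n (image_cone d c) g"
  unfolding has_arithmetic_genus_def
proof (rule exI[of _ d], rule eventually_sequentiallyI[of k1])
  fix k assume k: "k1 \<le> k"
  have "hilbert_function n (image_cone d c) k = card (S \<inter> {..<d * k + 1})"
    using hilbert_function_eq_card_orders[OF _ c_affine] d orders_forms[OF k] by simp
  moreover have "card (S \<inter> {..<d * k + 1}) + g = d * k + 1" using C_le[of k] k k1 by (intro card_S) auto
  ultimately show "int (hilbert_function n (image_cone d c) k) = int d * int k + 1 - int g"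
    by (metis add_diff_cancel_right' of_nat_1 of_nat_add of_nat_mult)
qed

text \<open>Beyond the conductor every monomial is a form in the coordinates of the curve. The first two
  monomials have quotient \<open>x / y\<close>, and the third one is a power of \<open>y\<close> that clears denominators.\<close>

lemma coordinate_polys:
  obtains Ta Tb Tc where "Ta \<in> poly_funs {..n}" "Tb \<in> poly_funs {..n}" "Tc \<in> poly_funs {..n}"
    "\<And>x y. Ta (param d c (x, y)) = x * y ^ (d * k1 - 1)" "\<And>x y. Tb (param d c (x, y)) = y ^ (d * k1)"
    "\<And>x y. Tc (param d c (x, y)) = y ^ (d * (d * k1 - 1))" "Ta (\<lambda>_. 0) = 0" "Tb (\<lambda>_. 0) = 0"
proof -
  have 4: "4 \<le> d * k1" using mult_le_mono[OF d k1] by simp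
  have 2: "2 * d \<le> d * k1" "2 * k1 \<le> d * k1" using k1 d by auto
  have F: "\<And>i. i \<le> n \<Longrightarrow> deg_le d (F i)" by (rule Fdeg)
  have a: "fps_X ^ (d * k1 - 1) \<in> forms n F k1"
    by (rule X_power_in_forms) (use 2 Cd d in linarith)+
  have b: "fps_X ^ (d * k1) \<in> forms n F k1"
    by (rule X_power_in_forms) (use 2 Cd d in linarith)+
  have c: "fps_X ^ (d * (d * k1 - 1)) \<in> forms n F (d * k1 - 1)"
  proof (rule X_power_in_forms)
    show "k1 \<le> d * k1 - 1" using 2 k1 by linarith
    show "C \<le> d * (d * k1 - 1)" using 4 by (intro C_le) linarith
  qed simp
  obtain Ta where Ta: "Ta \<in> poly_funs {..n}" "\<And>s. Ta (\<lambda>i. hom_eval d (F i) s) = hom_eval (d * k1) (fps_X ^ (d * k1 - 1)) s"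
    "k1 > 0 \<Longrightarrow> Ta (\<lambda>i. 0) = 0" using forms_poly_fun[OF a F] by metis
  obtain Tb where Tb: "Tb \<in> poly_funs {..n}" "\<And>s. Tb (\<lambda>i. hom_eval d (F i) s) = hom_eval (d * k1) (fps_X ^ (d * k1)) s"
    "k1 > 0 \<Longrightarrow> Tb (\<lambda>i. 0) = 0" using forms_poly_fun[OF b F] by metis
  obtain Tc where Tc: "Tc \<in> poly_funs {..n}"
    "\<And>s. Tc (\<lambda>i. hom_eval d (F i) s) = hom_eval (d * (d * k1 - 1)) (fps_X ^ (d * (d * k1 - 1))) s"
    using forms_poly_fun[OF c F] by metis
  show ?thesis
  proof (rule that[OF Ta(1) Tb(1) Tc(1)])
    have "d * k1 - (d * k1 - 1) = 1" using 4 by simp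
    then show "Ta (param d c (x, y)) = x * y ^ (d * k1 - 1)" for x y
      unfolding param_eq_hom_eval[abs_def] Ta(2) by (simp add: hom_eval_X_power)
    show "Tb (param d c (x, y)) = y ^ (d * k1)" for x y
      unfolding param_eq_hom_eval[abs_def] Tb(2) by (simp add: hom_eval_X_power)
    show "Tc (param d c (x, y)) = y ^ (d * (d * k1 - 1))" for x y
      unfolding param_eq_hom_eval[abs_def] Tc(2) by (simp add: hom_eval_X_power)
  qed (use Ta(3) Tb(3) k1 in auto)
qed

text \<open>At \<open>y = 0\<close> the first coordinate is nonzero, elsewhere the function with values \<open>y^(d k1)\<close> shows that
  not all coordinates vanish. A linear relation between the coordinates is zero because the \<open>f j\<close>
  have distinct orders and the matrix is unitriangular.\<close>

lemma morphism: "c \<in> P1_morphisms n d"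
  unfolding P1_morphisms_def mem_Collect_eq
proof (intro conjI allI impI)
  show "c \<in> affine_space ({..n} \<times> {..d})" by (rule c_affine)
next
  fix s :: "complex \<times> complex" assume s: "s \<noteq> (0, 0)"
  obtain x y where xy: "s = (x, y)" by force
  show "\<exists>i\<le>n. param d c s i \<noteq> 0"
  proof (cases "y = 0")
    case True
    have "param d c s 0 = c (0, 0) * x ^ d"
      by (simp add: xy True param_def power_0_left if_distrib[of "\<lambda>z. _ * z"] cong: if_cong)
    then show ?thesis using True s xy f00 A1 by (auto simp: c_def)
  next
    case False
    obtain Tb where Tb: "Tb \<in> poly_funs {..n}" "\<And>x y. Tb (param d c (x, y)) = y ^ (d * k1)" "Tb (\<lambda>_. 0) = 0"
      using coordinate_polys by metis
    show ?thesis
    proof (rule ccontr)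
      assume "\<not> ?thesis"
      then have "Tb (param d c (x, y)) = Tb (\<lambda>_. 0)" by (intro poly_funs_cong[OF Tb(1)]) (auto simp: xy)
      then show False using False Tb by simp
    qed
  qed
next
  fix l i assume l: "\<forall>s. (\<Sum>i\<le>n. l i * param d c s i) = 0" and i: "i \<le> n"
  define x where "x = (\<Sum>i\<le>n. fps_const (l i) * F i)"
  have "deg_le d x" using Fdeg by (auto simp: x_def deg_le_def nth_lincomb)
  moreover have "hom_eval d x s = 0" for s
    unfolding x_def hom_eval_lincomb using spec[OF l, of s] by (simp add: param_eq_hom_eval)
  ultimately have x0: "x = 0" by (rule hom_eval_eq_0_imp)
  define A' where "A' i j = (if j \<le> i then A i j else 0)" for i j
  define e where "e j = (\<Sum>i\<le>n. l i * A' i j)" for j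
  have "F i = (\<Sum>j\<le>n. fps_const (A' i j) * f j)" if "i \<le> n" for i
    unfolding F_eq[OF that] by (rule sum.mono_neutral_cong_left) (use that in \<open>auto simp: A'_def\<close>)
  then have "F i $ \<kappa> = (\<Sum>j\<le>n. A' i j * f j $ \<kappa>)" if "i \<le> n" for i \<kappa>
    using that by (simp add: nth_lincomb)
  then have "x $ \<kappa> = (\<Sum>i\<le>n. \<Sum>j\<le>n. l i * A' i j * f j $ \<kappa>)" for \<kappa>
    by (simp add: x_def nth_lincomb sum_distrib_left mult.assoc)
  then have x: "x $ \<kappa> = (\<Sum>j\<le>n. e j * f j $ \<kappa>)" for \<kappa>
    by (subst (asm) sum.swap) (simp add: e_def sum_distrib_right)
  have e0: "j \<le> n \<longrightarrow> e j = 0" for j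
  proof (induction j rule: less_induct)
    case (less j)
    show ?case
    proof
      assume j: "j \<le> n"
      define \<kappa> where "\<kappa> = (if j = 0 then 0 else cusp_ord m j)"
      have "f j $ \<kappa> \<noteq> 0" using ford[of j] f00 j by (auto simp: \<kappa>_def)
      have "f j' $ \<kappa> = 0" if "j < j'" "j' \<le> n" for j'
        using fvan[of j'] that m by (auto simp: vanishes_def \<kappa>_def cusp_ord_def)
      then have "x $ \<kappa> = (\<Sum>j\<in>{j}. e j * f j $ \<kappa>)"
        unfolding x using less j by (intro sum.mono_neutral_right) (auto, metis linorder_neqE_nat)
      then show "e j = 0" using x0 \<open>f j $ \<kappa> \<noteq> 0\<close> by simp
    qed
  qed
  have "j \<le> n \<longrightarrow> l (n - j) = 0" for j
  proof (induction j rule: less_induct)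
    case (less j)
    show ?case
    proof
      assume j: "j \<le> n"
      have "l i * A' i (n - j) = 0" if "i \<in> {..n} - {n - j}" for i
      proof (cases "n - j < i")
        case True
        then show ?thesis using less[of "n - i"] that j by auto
      qed (use that in \<open>auto simp: A'_def\<close>)
      then have "e (n - j) = (\<Sum>i\<in>{n - j}. l i * A' i (n - j))"
        unfolding e_def by (intro sum.mono_neutral_right) auto
      then show "l (n - j) = 0" using e0[of "n - j"] A1 by (simp add: A'_def)
    qed
  qed
  from this[of "n - i"] show "l i = 0" using i by simp
qed

lemma param_deriv:
  "\<exists>a b. \<forall>\<alpha> \<beta>. ((\<lambda>h. param d c (x + h * \<alpha>, y + h * \<beta>) i) has_field_derivative \<alpha> * a + \<beta> * b) (at 0)"
proof -
  define a where "a = (\<Sum>k\<le>d. c (i, k) * (of_nat (d - k) * x ^ (d - k - 1)) * y ^ k)"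
  define b where "b = (\<Sum>k\<le>d. c (i, k) * x ^ (d - k) * (of_nat k * y ^ (k - 1)))"
  have "((\<lambda>h. param d c (x + h * \<alpha>, y + h * \<beta>) i) has_field_derivative \<alpha> * a + \<beta> * b) (at 0)" for \<alpha> \<beta>
    unfolding param_def prod.case a_def b_def sum_distrib_left sum.distrib[symmetric]
    by (rule DERIV_sum) (auto intro!: derivative_eq_intros simp: algebra_simps)
  then show ?thesis by blast
qed

text \<open>Off the cusp, the coordinates are rational functions of \<open>x y^(M-1)\<close> and \<open>y^M\<close>, \<open>M = d k1\<close>, so a
  tangent vector is determined by the derivatives of these two. For a formulation without
  denominators, each coordinate is multiplied by the power \<open>y^(d (M-1))\<close>, which is algebraic over
  \<open>y^M\<close>.\<close>

lemma tangent_space_smooth: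
  assumes y: "y \<noteq> 0"
  shows "cfun.dim (tangent_space {..n} (image_cone d c) (param d c (x, y))) = 2"
proof -
  define M where "M = d * k1"
  have M: "4 \<le> M" using mult_le_mono[OF d k1] by (simp add: M_def)
  define V where "V = image_cone d c"
  have V: "V = range (param d c)" unfolding V_def using d by (intro image_cone_eq_range) auto
  define p where "p = param d c (x, y)"
  define T where "T = tangent_space {..n} V p"
  obtain Ta Tb Tc where T: "Ta \<in> poly_funs {..n}" "Tb \<in> poly_funs {..n}" "Tc \<in> poly_funs {..n}"
    "\<And>x y. Ta (param d c (x, y)) = x * y ^ (M - 1)" "\<And>x y. Tb (param d c (x, y)) = y ^ M"
    "\<And>x y. Tc (param d c (x, y)) = y ^ (d * (M - 1))"
    using coordinate_polys unfolding M_def by metis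
  obtain a b where ab: "\<And>i \<alpha> \<beta>. ((\<lambda>h. param d c (x + h * \<alpha>, y + h * \<beta>) i) has_field_derivative \<alpha> * a i + \<beta> * b i) (at 0)"
    using param_deriv[of x y] by metis
  define w where "w \<alpha> \<beta> = (\<lambda>i. if i \<le> n then \<alpha> * a i + \<beta> * b i else 0)" for \<alpha> \<beta>
  have chain: "((\<lambda>h. P (param d c (x + h * \<alpha>, y + h * \<beta>))) has_field_derivative
      (\<Sum>i\<le>n. gradient {..n} P p i * w \<alpha> \<beta> i)) (at 0)" if "P \<in> poly_funs {..n}" for P \<alpha> \<beta>
    by (rule gradient_chain[OF _ that]) (use ab in \<open>auto simp: w_def p_def\<close>)
  have wT: "w \<alpha> \<beta> \<in> T" for \<alpha> \<beta>
    unfolding T_def tangent_space_iff[OF finite_atMost]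
  proof (intro conjI ballI impI)
    show "w \<alpha> \<beta> \<in> affine_space {..n}" by (simp add: w_def affine_space_def)
    fix P assume P: "P \<in> poly_funs {..n}" "\<forall>x\<in>V. P x = 0"
    then have "((\<lambda>h. P (param d c (x + h * \<alpha>, y + h * \<beta>))) has_field_derivative 0) (at 0)"
      by (simp add: V)
    then show "(\<Sum>i\<le>n. gradient {..n} P p i * w \<alpha> \<beta> i) = 0"
      using chain[OF P(1)] DERIV_unique by blast
  qed
  have ga: "(\<Sum>i\<le>n. gradient {..n} Ta p i * w \<alpha> \<beta> i) = \<alpha> * y ^ (M - 1) + x * (of_nat (M - 1) * y ^ (M - 2) * \<beta>)" for \<alpha> \<beta>
  proof (rule DERIV_unique[OF chain[OF T(1)]])
    have e: "M - 1 - Suc 0 = M - 2" by simp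
    show "((\<lambda>h. Ta (param d c (x + h * \<alpha>, y + h * \<beta>))) has_field_derivative
      \<alpha> * y ^ (M - 1) + x * (of_nat (M - 1) * y ^ (M - 2) * \<beta>)) (at 0)"
      unfolding T(4) by (rule derivative_eq_intros refl)+ (simp add: e mult_ac numeral_2_eq_2)
  qed
  have gb: "(\<Sum>i\<le>n. gradient {..n} Tb p i * w \<alpha> \<beta> i) = of_nat M * y ^ (M - 1) * \<beta>" for \<alpha> \<beta>
  proof (rule DERIV_unique[OF chain[OF T(2)]])
    show "((\<lambda>h. Tb (param d c (x + h * \<alpha>, y + h * \<beta>))) has_field_derivative
      of_nat M * y ^ (M - 1) * \<beta>) (at 0)"
      unfolding T(5) by (rule derivative_eq_intros refl)+ simp
  qed
  have "indep_fam {0, 1 :: nat} (\<lambda>j. if j = 0 then w 1 0 else w 0 1) UNIV"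
    unfolding indep_fam_def
  proof (intro allI impI)
    fix u assume u: "\<forall>\<kappa>\<in>UNIV. (\<Sum>j\<in>{0, 1 :: nat}. u j * (if j = 0 then w 1 0 else w 0 1) \<kappa>) = 0"
    have "w (u 0) (u 1) \<kappa> = 0" for \<kappa> using bspec[OF u, of \<kappa>] by (auto simp: w_def split: if_splits)
    then have "u 0 * y ^ (M - 1) + x * (of_nat (M - 1) * y ^ (M - 2) * u 1) = 0" "of_nat M * y ^ (M - 1) * u 1 = 0"
      using ga[of "u 0" "u 1"] gb[of "u 0" "u 1"] by simp_all
    then show "\<forall>j\<in>{0, 1}. u j = 0" using y M by auto
  qed
  then have "card {0, 1 :: nat} \<le> cfun.dim T"
    using wT by (intro dim_ge_card[of "{..n}" T "{0, 1}" "\<lambda>j. if j = 0 then w 1 0 else w 0 1"])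
      (auto simp: T_def tangent_space_subset)
  moreover have "cfun.dim T \<le> card {0, 1 :: nat}"
    unfolding T_def
  proof (rule dim_le_card[OF finite_atMost[of n] tangent_space_subset subspace_tangent_space[OF finite_atMost],
        where L = "\<lambda>\<kappa>::nat. gradient {..n} (if \<kappa> = 0 then Ta else Tb) p"])
    fix v assume v: "v \<in> tangent_space {..n} V p"
      and L: "\<And>\<kappa>::nat. \<kappa> \<in> {0, 1} \<Longrightarrow> (\<Sum>i\<le>n. gradient {..n} (if \<kappa> = 0 then Ta else Tb) p i * v i) = 0"
    define l where "l h = p + cscale h v" for h
    have l0: "l 0 = p" by (simp add: l_def cscale_def fun_eq_iff)
    have da: "((\<lambda>h. Ta (l h)) has_field_derivative 0) (at 0)"
      using gradient_line[OF finite_atMost T(1), of p v] L[of 0] by (simp add: l_def)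
    have db: "((\<lambda>h. Tb (l h)) has_field_derivative 0) (at 0)"
      using gradient_line[OF finite_atMost T(2), of p v] L[of "1::nat"] by (simp add: l_def)
    define dc where "dc = (\<Sum>i\<le>n. gradient {..n} Tc p i * v i)"
    have dc: "((\<lambda>h. Tc (l h)) has_field_derivative dc) (at 0)"
      using gradient_line[OF finite_atMost T(3), of p v] by (simp add: l_def dc_def)
    have Tcp: "Tc (l 0) \<noteq> 0" using y by (simp add: l0 p_def T(6))
    have zero: "((\<lambda>h. P (l h)) has_field_derivative 0) (at 0)"
      if "P \<in> poly_funs {..n}" "\<And>x y. P (param d c (x, y)) = 0" for P
      using v that unfolding tangent_space_def l_def by (auto simp: V)
    have "((\<lambda>h. Tc (l h) ^ k1 - Tb (l h) ^ (M - 1)) has_field_derivative 0) (at 0)"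
    proof (rule zero)
      show "(\<lambda>h. Tc h ^ k1 - Tb h ^ (M - 1)) \<in> poly_funs {..n}"
        by (intro poly_funs_diff poly_funs_power T)
      show "Tc (param d c (x, y)) ^ k1 - Tb (param d c (x, y)) ^ (M - 1) = 0" for x y
      proof -
        have e: "d * (M - 1) * k1 = M * (M - 1)" by (simp add: M_def)
        show ?thesis unfolding T(5,6) power_mult[symmetric] e by simp
      qed
    qed
    moreover have "((\<lambda>h. Tc (l h) ^ k1 - Tb (l h) ^ (M - 1)) has_field_derivative
        of_nat k1 * Tc (l 0) ^ (k1 - 1) * dc) (at 0)"
      by (rule derivative_eq_intros dc db refl)+ simp
    ultimately have "of_nat k1 * Tc (l 0) ^ (k1 - 1) * dc = 0" by (rule DERIV_unique[symmetric])
    then have dc0: "dc = 0" using Tcp k1 by simp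
    show "v = 0"
    proof
      fix i
      show "v i = 0 i"
      proof (cases "i \<le> n")
        case False
        moreover have "v \<in> affine_space {..n}" using v tangent_space_subset by blast
        ultimately show ?thesis by (simp add: affine_space_def)
      next
        case True
        define Q where "Q q = (\<Sum>k\<le>d. c (i, k) * Ta q ^ (d - k) * Tb q ^ k)" for q
        have "((\<lambda>h. l h i * Tc (l h) - Q (l h)) has_field_derivative 0) (at 0)"
        proof (rule zero)
          show "(\<lambda>q. q i * Tc q - Q q) \<in> poly_funs {..n}"
            unfolding Q_def using True
            by (intro poly_funs_diff poly_funs.mult poly_funs_power poly_funs_sum poly_funs.const T poly_funs.coord) auto
          show "param d c (x, y) i * Tc (param d c (x, y)) - Q (param d c (x, y)) = 0" for x y
          proof -
            have "y ^ (M - 1) * y = y ^ M" using M by (intro power_minus_mult) simp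
            then have "Q (param d c (x, y)) = hom_eval d (F i) (y ^ (M - 1) * x, y ^ (M - 1) * y)"
              unfolding Q_def T(4,5) hom_eval_def
              by (auto simp: coeff_fps_def mult.commute[of x] simp del: One_nat_def)
            also have "\<dots> = y ^ (d * (M - 1)) * param d c (x, y) i"
              unfolding hom_eval_scale param_eq_hom_eval by (simp add: power_mult[symmetric] mult.commute)
            finally show ?thesis by (simp add: T(6))
          qed
        qed
        moreover have "((\<lambda>h. Q (l h)) has_field_derivative (\<Sum>k\<le>d. 0)) (at 0)"
          unfolding Q_def by (rule DERIV_sum) (rule derivative_eq_intros da db refl | simp)+
        then have "((\<lambda>h. l h i * Tc (l h) - Q (l h)) has_field_derivative v i * Tc (l 0)) (at 0)"
          using dc unfolding dc0 l_def plus_fun_apply cscale_def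
          by (auto intro!: derivative_eq_intros)
        ultimately have "v i * Tc (l 0) = 0" by (rule DERIV_unique[symmetric])
        then show ?thesis using Tcp by simp
      qed
    qed
  qed simp
  ultimately show ?thesis by (simp add: T_def V_def p_def)
qed

text \<open>A polynomial that vanishes on the cone is zero along the curve, so its linear part at the cusp
  vanishes there to order \<open>4 m\<close>. As the orders of the \<open>f j\<close>, \<open>j > 0\<close>, are distinct and less than \<open>4 m\<close>,
  the gradient is orthogonal to all columns of \<open>A\<close> but the first.\<close>

lemma tangent_space_cusp:
  assumes z: "z \<noteq> 0"
  shows "3 \<le> cfun.dim (tangent_space {..n} (image_cone d c) (cscale z (param d c (1, 0))))"
proof -
  define V where "V = image_cone d c"
  define p where "p = cscale z (param d c (1, 0))"
  define h where "h j = (\<lambda>i. if i \<le> n \<and> j \<le> i then A i j else 0)" for j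
  have col: "h j \<in> tangent_space {..n} V p" if j: "j \<in> {1..n}" for j
    unfolding tangent_space_iff[OF finite_atMost]
  proof (intro conjI ballI impI)
    show "h j \<in> affine_space {..n}" by (simp add: h_def affine_space_def)
    fix P assume P: "P \<in> poly_funs {..n}" "\<forall>x\<in>V. P x = 0"
    define D where "D = gradient {..n} P p"
    define N where "N = 4 * m"
    \<comment> \<open>Rescaling the curve by \<open>q\<close> makes its first coordinate constant up to order \<open>4 m\<close>.\<close>
    define q where "q = (\<Sum>k<N. monom (inverse (f 0) $ k) k)"
    define pf where "pf i = (\<Sum>k\<le>d. monom (c (i, k)) k)" for i
    define z' where "z' = z * f 0 $ 0"
    define \<delta> where "\<delta> i = smult z' (q * pf i) - [:p i:]" for i
    have q: "fps_of_poly q = fps_cutoff N (inverse (f 0))"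
      by (simp add: fps_eq_iff q_def coeff_sum)
    have pf: "fps_of_poly (pf i) = F i" for i
      using Fdeg[of i] by (auto simp: fps_eq_iff pf_def coeff_sum deg_le_def coeff_fps_def)
    have qf0: "vanishes N (fps_of_poly q * f 0 - 1)"
    proof -
      have "vanishes N (inverse (f 0) - fps_of_poly q)" by (simp add: q vanishes_def)
      then have "vanishes N (f 0 * (inverse (f 0) - fps_of_poly q))"
        using vanishes_mult[of 0 "f 0" N] by (simp add: vanishes_def[of 0])
      then show ?thesis unfolding right_diff_distrib inv0 by (simp add: vanishes_def mult.commute)
    qed
    have pi: "p i = z' * A i 0" if "i \<le> n" for i
      using that by (simp add: p_def cscale_def z'_def param_10 c_i0)
    have \<delta>: "fps_of_poly (\<delta> i) = fps_const z' * (fps_const (A i 0) * (fps_of_poly q * f 0 - 1)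
        + (\<Sum>j\<in>{1..i}. fps_const (A i j) * (fps_of_poly q * f j)))" if i: "i \<le> n" for i
    proof -
      have "fps_of_poly (\<delta> i) = fps_const z' * (fps_of_poly q * F i) - fps_const (z' * A i 0)"
        using pi[OF i] by (simp add: \<delta>_def fps_of_poly_diff fps_of_poly_smult fps_of_poly_mult pf fps_of_poly_const)
      also have "F i = fps_const (A i 0) * f 0 + (\<Sum>j\<in>{1..i}. fps_const (A i j) * f j)"
        unfolding F_eq[OF i] by (simp add: atMost_atLeast0 sum.atLeast_Suc_atMost)
      finally show ?thesis
        by (simp add: algebra_simps sum_distrib_left flip: fps_const_mult)
    qed
    have qfj: "vanishes (cusp_ord m j) (fps_of_poly q * f j)" if "j \<in> {1..n}" for j
      using vanishes_mult[of 0 "fps_of_poly q", OF _ fvan[OF that]] by (simp add: vanishes_def[of 0])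
    have "monom 1 (2 * m) dvd \<delta> i" if i: "i \<in> {..n}" for i
    proof -
      have "(fps_of_poly q * f j) $ k = 0" if "j \<in> {1..i}" "k < 2 * m" for j k
        using qfj[of j] that i by (auto simp: vanishes_def cusp_ord_def)
      then have "fps_of_poly (\<delta> i) $ k = 0" if "k < 2 * m" for k
        using qf0 that \<delta>[of i] i by (auto simp: nth_lincomb N_def vanishes_def intro!: sum.neutral)
      then show ?thesis unfolding monom_1_dvd_iff' by simp
    qed
    then obtain r where r: "\<And>t. P (\<lambda>i. p i + poly (\<delta> i) t) = P p + (\<Sum>i\<le>n. D i * poly (\<delta> i) t)
        + poly (monom 1 (2 * (2 * m)) * r) t"
      using gradient_taylor[OF finite_atMost P(1), of "2 * m" \<delta> p] unfolding D_def by auto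
    have "P p = 0" using P(2) unfolding V_def p_def image_cone_def by blast
    moreover have "P (\<lambda>i. p i + poly (\<delta> i) t) = 0" for t
    proof -
      have "P (\<lambda>i. p i + poly (\<delta> i) t) = P (cscale (z' * poly q t) (param d c (1, t)))"
        by (rule poly_funs_cong[OF P(1)])
          (simp add: \<delta>_def cscale_def pf_def param_def poly_sum poly_monom)
      moreover have "cscale (z' * poly q t) (param d c (1, t)) \<in> V" unfolding V_def image_cone_def by blast
      ultimately show ?thesis using P(2) by simp
    qed
    ultimately have "poly ((\<Sum>i\<le>n. smult (D i) (\<delta> i)) + monom 1 N * r) t = 0" for t
      using r[of t] by (simp add: poly_sum N_def)
    then have "(\<Sum>i\<le>n. smult (D i) (\<delta> i)) + monom 1 N * r = 0" using poly_all_0_iff_0 by blast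
    then have "coeff (\<Sum>i\<le>n. smult (D i) (\<delta> i)) k = 0" if "k < N" for k
      using that by (metis (no_types) add_eq_0_iff coeff_minus dvd_triv_left monom_1_dvd_iff' neg_0_equal_iff_equal)
    then have sum0: "(\<Sum>i\<le>n. D i * fps_of_poly (\<delta> i) $ k) = 0" if "k < N" for k
      using that by (simp add: coeff_sum)
    define E where "E j = (\<Sum>i\<le>n. D i * h j i)" for j
    have E: "(\<Sum>j\<in>{1..n}. E j * (fps_of_poly q * f j) $ k) = 0" if k: "k < N" for k
    proof -
      have "fps_of_poly (\<delta> i) $ k = z' * (\<Sum>j\<in>{1..n}. h j i * (fps_of_poly q * f j) $ k)" if i: "i \<le> n" for i
      proof -
        have "fps_of_poly (\<delta> i) $ k = z' * (\<Sum>j\<in>{1..i}. A i j * (fps_of_poly q * f j) $ k)"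
          using qf0 k unfolding \<delta>[OF i] by (simp add: nth_lincomb vanishes_def)
        also have "(\<Sum>j\<in>{1..i}. A i j * (fps_of_poly q * f j) $ k) = (\<Sum>j\<in>{1..n}. h j i * (fps_of_poly q * f j) $ k)"
          by (rule sum.mono_neutral_cong_left) (use i in \<open>auto simp: h_def\<close>)
        finally show ?thesis .
      qed
      then have "0 = (\<Sum>i\<le>n. D i * (z' * (\<Sum>j\<in>{1..n}. h j i * (fps_of_poly q * f j) $ k)))"
        using sum0[OF k] by simp
      also have "\<dots> = (\<Sum>i\<le>n. \<Sum>j\<in>{1..n}. z' * (D i * h j i * (fps_of_poly q * f j) $ k))"
        by (simp add: sum_distrib_left mult_ac)
      also have "\<dots> = (\<Sum>j\<in>{1..n}. \<Sum>i\<le>n. z' * (D i * h j i * (fps_of_poly q * f j) $ k))"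
        by (rule sum.swap)
      also have "\<dots> = z' * (\<Sum>j\<in>{1..n}. E j * (fps_of_poly q * f j) $ k)"
        by (simp add: E_def sum_distrib_left sum_distrib_right)
      finally show ?thesis using z f00 by (simp add: z'_def)
    qed
    have "j \<in> {1..n} \<longrightarrow> E j = 0" for j
    proof (induction j rule: less_induct)
      case (less j)
      show ?case
      proof
        assume j: "j \<in> {1..n}"
        define \<kappa> where "\<kappa> = cusp_ord m j"
        have \<kappa>: "\<kappa> < N" using j nm by (auto simp: \<kappa>_def cusp_ord_def N_def)
        have "(fps_of_poly q * f j') $ \<kappa> = 0" if "j' \<in> {1..n}" "j < j'" for j'
          using qfj[OF that(1)] that(2) j by (auto simp: vanishes_def \<kappa>_def cusp_ord_def)
        then have "(\<Sum>j\<in>{1..n}. E j * (fps_of_poly q * f j) $ \<kappa>) = (\<Sum>j\<in>{j}. E j * (fps_of_poly q * f j) $ \<kappa>)"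
          using less j by (intro sum.mono_neutral_right) (auto, metis linorder_neqE_nat)
        then have "E j * (fps_of_poly q * f j) $ \<kappa> = 0" using E[OF \<kappa>] by simp
        moreover have "(fps_of_poly q * f j) $ \<kappa> = fps_of_poly q $ 0 * f j $ \<kappa>"
        proof -
          have "(fps_of_poly q * f j) $ \<kappa> = (\<Sum>i\<in>{0}. fps_of_poly q $ i * f j $ (\<kappa> - i))"
            unfolding fps_mult_nth
            by (rule sum.mono_neutral_right) (use fvan[OF j] in \<open>auto simp: vanishes_def \<kappa>_def\<close>)
          then show ?thesis by simp
        qed
        moreover have "fps_of_poly q $ 0 \<noteq> 0" unfolding q using m f00 by (simp add: N_def)
        ultimately show "E j = 0" using ford[OF j] by (simp add: \<kappa>_def)
      qed
    qed
    then show "(\<Sum>i\<le>n. gradient {..n} P p i * h j i) = 0" using j by (simp add: E_def D_def)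
  qed
  have "indep_fam {1, 2, 3 :: nat} h UNIV"
    unfolding indep_fam_def
  proof (intro allI impI)
    fix u assume u: "\<forall>\<kappa>\<in>UNIV. (\<Sum>j\<in>{1, 2, 3 :: nat}. u j * h j \<kappa>) = 0"
    have "u 1 = 0" using bspec[OF u, of 1] n A1[of 1] by (simp add: h_def)
    moreover from this have "u 2 = 0" using bspec[OF u, of 2] n A1[of 2] by (simp add: h_def)
    moreover from calculation have "u 3 = 0" using bspec[OF u, of 3] n A1[of 3] by (simp add: h_def)
    ultimately show "\<forall>j\<in>{1, 2, 3}. u j = 0" by simp
  qed
  then have "card {1, 2, 3 :: nat} \<le> cfun.dim (tangent_space {..n} V p)"
    using col n by (intro dim_ge_card[of "{..n}" _ "{1, 2, 3}" h]) (auto simp: tangent_space_subset)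
  then show ?thesis by (simp add: V_def p_def)
qed

lemma in_severi: "c \<in> severi n d g S"
proof -
  have ray: "param d c (x, 0) = cscale (x ^ d) (param d c (1, 0))" for x
    by (auto simp: param_eq_hom_eval cscale_def hom_eval_scale[of d _ x 1 0, simplified])
  have p0: "param d c (1, 0) \<noteq> (\<lambda>_. 0)"
  proof
    assume "param d c (1, 0) = (\<lambda>_. 0)"
    then have "param d c (1, 0) 0 = 0" by simp
    then show False using f00 A1 by (simp add: param_10 c_i0)
  qed
  have sing: "singular_cone n d c = {cscale z (param d c (1, 0)) |z. z \<noteq> 0}" (is "?L = ?R")
  proof
    show "?L \<subseteq> ?R"
    proof
      fix p assume p: "p \<in> ?L"
      then obtain x y where xy: "p = param d c (x, y)"
        unfolding singular_cone_def using image_cone_eq_range[of d c] d by auto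
      have "y = 0" using p tangent_space_smooth[of y x] unfolding singular_cone_def xy by auto
      then have "p = cscale (x ^ d) (param d c (1, 0))" using ray[of x] xy by metis
      moreover have "x ^ d \<noteq> 0" using p calculation unfolding singular_cone_def by (auto simp: cscale_def)
      ultimately show "p \<in> ?R" by blast
    qed
    show "?R \<subseteq> ?L"
    proof clarify
      fix z :: complex assume z: "z \<noteq> 0"
      have "cscale z (param d c (1, 0)) \<noteq> (\<lambda>_. 0)" using p0 z by (auto simp: cscale_def fun_eq_iff)
      moreover have "cscale z (param d c (1, 0)) \<in> image_cone d c" unfolding image_cone_def by blast
      ultimately show "cscale z (param d c (1, 0)) \<in> singular_cone n d c"
        using tangent_space_cusp[OF z] unfolding singular_cone_def by auto
    qed
  qed
  have unibranch: "snd s' = 0" if s': "param d c s' = cscale z (param d c (1, 0))" for s' z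
  proof -
    obtain x y where xy: "s' = (x, y)" by force
    obtain w where w: "w ^ d = z" using complex_root[of d z] d by auto
    obtain Tb where Tb: "\<And>x y. Tb (param d c (x, y)) = y ^ (d * k1)"
      using coordinate_polys by metis
    have "param d c (x, y) = param d c (w, 0)" using s' ray[of w] w xy by simp
    then have "y ^ (d * k1) = 0 ^ (d * k1)" using Tb by metis
    then show ?thesis using d k1 xy by (simp add: power_0_left)
  qed
  have uni: "\<forall>s' z. s' \<noteq> (0, 0) \<and> param d c s' = cscale z (param d c (1, 0)) \<longrightarrow>
      fst (1 :: complex, 0 :: complex) * snd s' = snd (1 :: complex, 0 :: complex) * fst s'"
    by (intro allI impI) (drule conjunct2, drule unibranch, simp)
  have ne: "(1 :: complex, 0 :: complex) \<noteq> (0, 0)" by simp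
  have "\<exists>s. s \<noteq> (0, 0) \<and> singular_cone n d c = {cscale z (param d c s) |z. z \<noteq> 0} \<and>
     (\<forall>s' z. s' \<noteq> (0, 0) \<and> param d c s' = cscale z (param d c s) \<longrightarrow> fst s * snd s' = snd s * fst s') \<and>
     has_value_semigroup_at n d c s S"
    by (rule exI[of _ "(1, 0)"]) (intro conjI ne sing uni germ_semigroup)
  then show ?thesis
    unfolding severi_def P1_morphisms_genus_def using morphism arithmetic_genus by blast
qed

end

section \<open>A curve with prescribed jets and no further singularities\<close>

abbreviation pconst :: "complex \<Rightarrow> complex poly" where
  "pconst z \<equiv> [:z:]"

lemma subalg_smult: "x \<in> subalg pconst G \<Longrightarrow> smult z x \<in> subalg pconst G"
  using subalg.mult[OF subalg.const[of pconst z G]] by simp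

lemma subalg_diff_smult:
  "x \<in> subalg pconst G \<Longrightarrow> y \<in> subalg pconst G \<Longrightarrow> x - smult z y \<in> subalg pconst G"
  using subalg.add[OF _ subalg_smult[of y G "- z"], of x] by simp

lemma subalg_diff:
  "x \<in> subalg pconst G \<Longrightarrow> y \<in> subalg pconst G \<Longrightarrow> x - y \<in> subalg pconst G"
  using subalg_diff_smult[of x G y 1] by simp

lemma subalg_0: "0 \<in> subalg pconst G"
  using subalg.const[of pconst 0 G] by simp

text \<open>Round \<open>D / d\<close> up to \<open>s\<close>; then \<open>s d\<close> exceeds \<open>D\<close> by some \<open>\<beta> < d \<le> s\<close>, which is corrected by taking
  \<open>\<beta>\<close> of the \<open>s\<close> summands to be \<open>d - 1\<close>.\<close>

lemma consecutive_combination: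
  assumes d: "d > 0" and D: "d * d \<le> D" "D \<le> d * k"
  shows "\<exists>\<alpha> \<beta>. \<alpha> + \<beta> \<le> k \<and> \<alpha> * d + \<beta> * (d - 1) = (D :: nat)"
proof -
  define s where "s = (D + (d - 1)) div d"
  define \<beta> where "\<beta> = s * d - D"
  have s: "s * d \<le> D + (d - 1)" unfolding s_def by simp
  have s': "D \<le> s * d"
  proof -
    have "D + (d - 1) < (s + 1) * d" unfolding s_def using d dividend_less_div_times[of d "D + (d - 1)"]
      by (simp add: algebra_simps)
    then show ?thesis using d by simp
  qed
  have "\<beta> < d" using s d by (auto simp: \<beta>_def)
  moreover have "d \<le> s" using s' D(1) d by (metis le_trans mult_le_cancel2)
  ultimately have \<beta>: "\<beta> \<le> s" by simp
  have "s * d < (k + 1) * d" using s D(2) d by (simp add: algebra_simps)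
  then have "s \<le> k" using d by (metis Suc_eq_plus1 less_Suc_eq_le mult_less_cancel2)
  moreover have "(s - \<beta>) * d + \<beta> * (d - 1) = D"
  proof -
    obtain d' where d': "d = Suc d'" using d by (cases d) auto
    obtain s1 where s1: "s = \<beta> + s1" using \<beta> le_Suc_ex by blast
    have "s * d = D + \<beta>" using s' by (simp add: \<beta>_def)
    then show ?thesis by (simp add: d' s1 algebra_simps)
  qed
  ultimately show ?thesis using \<beta> by (intro exI[of _ "s - \<beta>"] exI[of _ \<beta>]) simp
qed

lemma degree_cancel:
  fixes u x :: "complex poly"
  assumes "x \<noteq> 0" "degree x = degree u"
  defines "v \<equiv> u - smult (lead_coeff u / lead_coeff x) x"
  shows "v = 0 \<or> degree v < degree u"
proof -
  have "degree v \<le> degree u" unfolding v_def using assms by (intro degree_diff_le) (auto intro: order_trans[OF degree_smult_le])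
  moreover have "coeff x (degree u) \<noteq> 0" using assms(1) unfolding assms(2)[symmetric] by simp
  then have "coeff v (degree u) = 0" unfolding v_def using assms(2) by simp
  ultimately show ?thesis using leading_coeff_0_iff[of v] by (cases "degree v = degree u") auto
qed

text \<open>A subalgebra of finite codimension contains an ideal. Here \<open>e\<close> and \<open>e + 1\<close> are
  the degrees of two generators, which make the codimension finite; the ideal is found by linear
  algebra on the free \<open>\<complex>[f\<^sub>1]\<close>-module \<open>\<complex>[t]\<close>.\<close>

lemma conductor_exists:
  fixes f1 f2 :: "complex poly"
  assumes e: "degree f1 = e" "degree f2 = Suc e" "e > 0"
  shows "\<exists>h. h \<noteq> 0 \<and> (\<forall>u. h * u \<in> subalg pconst {f1, f2})"
proof -
  define A where "A = subalg pconst {f1, f2}"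
  have A: "f1 \<in> A" "f2 \<in> A" "\<And>x y. x \<in> A \<Longrightarrow> y \<in> A \<Longrightarrow> x * y \<in> A" "\<And>x y. x \<in> A \<Longrightarrow> y \<in> A \<Longrightarrow> x + y \<in> A"
    "\<And>x k. x \<in> A \<Longrightarrow> x ^ k \<in> A" "\<And>x z. x \<in> A \<Longrightarrow> smult z x \<in> A"
    unfolding A_def by (auto intro: subalg.intros subalg_power subalg_smult simp: one_pCons)
  have A_sum: "(\<And>t. t \<in> T \<Longrightarrow> x t \<in> A) \<Longrightarrow> (\<Sum>t\<in>T. x t) \<in> A" for T :: "nat set" and x
    unfolding A_def by (rule subalg_sum) auto
  have A_prod: "(\<And>t. t \<in> T \<Longrightarrow> x t \<in> A) \<Longrightarrow> (\<Prod>t\<in>T. x t) \<in> A" for T :: "nat set" and x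
    unfolding A_def by (rule subalg_prod) (auto simp: one_pCons)
  have f: "f1 \<noteq> 0" "f2 \<noteq> 0" using e by auto
  define N where "N = Suc e * Suc e"
  have deg: "\<exists>x\<in>A. x \<noteq> 0 \<and> degree x = D" if "N \<le> D" for D
  proof -
    have "D \<le> Suc e * D" "Suc e * Suc e \<le> D" using that by (simp_all add: N_def)
    then obtain \<alpha> \<beta> where "\<alpha> * Suc e + \<beta> * (Suc e - 1) = D"
      using consecutive_combination[of "Suc e" D D] zero_less_Suc[of e] by blast
    then have "degree (f2 ^ \<alpha> * f1 ^ \<beta>) = D" using e f by (simp add: degree_mult_eq degree_power_eq)
    then show ?thesis using A f by (intro bexI[of _ "f2 ^ \<alpha> * f1 ^ \<beta>"]) auto
  qed
  have reduce: "\<exists>r. degree r < N \<and> u - r \<in> A" for u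
  proof (induction "degree u" arbitrary: u rule: less_induct)
    case less
    show ?case
    proof (cases "degree u < N")
      case True
      moreover have "u - u \<in> A" by (simp add: A_def subalg_0)
      ultimately show ?thesis by blast
    next
      case False
      then obtain x where x: "x \<in> A" "x \<noteq> 0" "degree x = degree u" using deg[of "degree u"] by auto
      define v where "v = u - smult (lead_coeff u / lead_coeff x) x"
      have "v = 0 \<or> degree v < degree u" unfolding v_def by (rule degree_cancel[OF x(2,3)])
      then have "degree v < degree u" using False by (auto simp: N_def)
      then obtain r where r: "degree r < N" "v - r \<in> A" using less.hyps by blast
      have "(v - r) + smult (lead_coeff u / lead_coeff x) x \<in> A" by (intro A(4) A(6) r x)
      then show ?thesis using r(1) by (intro exI[of _ r]) (simp add: v_def)
    qed
  qed
  have "\<exists>Q\<in>A. Q \<noteq> 0 \<and> Q * monom 1 i \<in> A" for i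
  proof -
    obtain r where r: "\<And>l. degree (r l) < N" "\<And>l. f1 ^ l * monom 1 i - r l \<in> A"
      using reduce[of "f1 ^ _ * monom 1 i"] by metis
    have "\<not> indep_fam {..N} (\<lambda>l \<kappa>. coeff (r l) \<kappa>) {..<N}"
      using indep_fam_card_le[of "{..N}" _ "{..<N}"] by auto
    then obtain u where u: "\<forall>\<kappa>\<in>{..<N}. (\<Sum>l\<le>N. u l * coeff (r l) \<kappa>) = 0" "\<not> (\<forall>l\<in>{..N}. u l = 0)"
      unfolding indep_fam_def by blast
    have r0: "(\<Sum>l\<le>N. smult (u l) (r l)) = 0"
    proof (rule poly_eqI)
      fix \<kappa>
      have "coeff (r l) \<kappa> = 0" if "N \<le> \<kappa>" for l
        using r(1)[of l] that by (intro coeff_eq_0) simp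
      then show "coeff (\<Sum>l\<le>N. smult (u l) (r l)) \<kappa> = coeff 0 \<kappa>"
        using bspec[OF u(1), of \<kappa>] by (cases "\<kappa> < N") (simp_all add: coeff_sum)
    qed
    define q where "q = (\<Sum>l\<le>N. monom (u l) l)"
    define Q where "Q = (\<Sum>l\<le>N. smult (u l) (f1 ^ l))"
    have "coeff q l = u l" if "l \<le> N" for l using that by (simp add: q_def coeff_sum)
    then have q0: "q \<noteq> 0" using u(2) by fastforce
    have "Q = pcompose q f1"
      unfolding poly_eq_poly_eq_iff[symmetric]
      by (auto simp: Q_def q_def poly_pcompose poly_sum poly_monom)
    then have "Q \<noteq> 0" using q0 pcompose_eq_0[of q f1] e by auto
    moreover have "Q \<in> A" unfolding Q_def using A by (intro A_sum) auto
    moreover have "Q * monom 1 i = (\<Sum>l\<le>N. smult (u l) (f1 ^ l * monom 1 i - r l))"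
    proof -
      have "(\<Sum>l\<le>N. smult (u l) (f1 ^ l * monom 1 i - r l)) =
          (\<Sum>l\<le>N. smult (u l) (f1 ^ l * monom 1 i)) - (\<Sum>l\<le>N. smult (u l) (r l))"
        by (simp add: smult_diff_right sum_subtractf)
      then show ?thesis by (simp add: r0 Q_def sum_distrib_right)
    qed
    then have "Q * monom 1 i \<in> A" using A r(2) by (auto intro: A_sum)
    ultimately show ?thesis by blast
  qed
  then obtain Q where Q: "\<And>i. Q i \<in> A" "\<And>i. Q i \<noteq> 0" "\<And>i. Q i * monom 1 i \<in> A" by metis
  define h where "h = (\<Prod>i<e. Q i)"
  have h_monom: "h * monom 1 i \<in> A" if "i < e" for i
  proof -
    have "h = Q i * (\<Prod>j\<in>{..<e} - {i}. Q j)" unfolding h_def using that by (intro prod.remove) auto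
    then have "h * monom 1 i = (Q i * monom 1 i) * (\<Prod>j\<in>{..<e} - {i}. Q j)" by (simp add: mult_ac)
    also have "\<dots> \<in> A" by (intro A(3) Q A_prod)
    finally show ?thesis .
  qed
  have h_small: "h * u \<in> A" if "degree u < e" for u
  proof -
    have "u = (\<Sum>i<e. monom (coeff u i) i)"
      by (rule poly_eqI) (use that in \<open>auto simp: coeff_sum coeff_eq_0 not_less\<close>)
    then have "h * u = h * (\<Sum>i<e. monom (coeff u i) i)" by simp
    also have "\<dots> = (\<Sum>i<e. smult (coeff u i) (h * monom 1 i))"
      by (simp add: sum_distrib_left smult_monom flip: mult_smult_right)
    also have "\<dots> \<in> A" using h_monom A by (intro A_sum) auto
    finally show ?thesis .
  qed
  have "h * u \<in> A" for u
  proof (induction "degree u" arbitrary: u rule: less_induct)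
    case less
    show ?case
    proof (cases "degree u < e")
      case False
      define q r where "q = u div f1" and "r = u mod f1"
      have u: "u = f1 * q + r" by (simp add: q_def r_def)
      have r: "degree r < e" using degree_mod_less'[of f1 u] e f by (cases "r = 0") (auto simp: r_def)
      have "degree q < degree u"
      proof (cases "q = 0")
        case True
        then show ?thesis using False e by simp
      next
        case q: False
        have "e + degree q = degree (u - r)" using q f e by (simp add: u degree_mult_eq)
        also have "\<dots> \<le> degree u" using r False by (intro degree_diff_le) auto
        finally show ?thesis using e by simp
      qed
      then have "f1 * (h * q) + h * r \<in> A" using less A h_small[OF r] by blast
      then show ?thesis by (simp add: u algebra_simps)
    qed (rule h_small)
  qed
  moreover have "h \<noteq> 0" using Q by (simp add: h_def)
  ultimately show ?thesis unfolding A_def by blast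
qed

lemma monom_power: "monom 1 k = ([:0, 1:] :: complex poly) ^ k"
  by (simp add: monom_altdef)

lemma pcompose_in_subalg: "x \<in> subalg pconst G \<Longrightarrow> pcompose u x \<in> subalg pconst G"
proof (induction u)
  case 0
  then show ?case by (simp add: subalg_0)
next
  case (pCons c u)
  then show ?case unfolding pcompose_pCons by (intro subalg.add subalg.mult subalg.const) auto
qed

text \<open>A third generator congruent to \<open>t\<close> modulo \<open>h1\<close>, the part of the conductor prime to \<open>t\<close>, removes that
  part: its powers span \<open>\<complex>[t] / h1\<close>, and it is nilpotent modulo \<open>t^a\<close>. This
  generator also gets degree \<open>d\<close>, and a fourth one gets degree \<open>d - 1\<close>, which takes care of the point
  at infinity.\<close>

lemma curve_with_jets:
  fixes c :: "nat \<times> nat \<Rightarrow> complex"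
  assumes n: "n \<ge> 4" and N: "N > 0" and c0: "\<And>i. c (i, 0) = 0"
  shows "\<exists>d0. \<forall>d\<ge>d0. \<exists>f :: nat \<Rightarrow> complex poly. (\<forall>i\<in>{1..n}. degree (f i) \<le> d \<and> (\<forall>\<kappa><N. coeff (f i) \<kappa> = c (i, \<kappa>))) \<and>
     degree (f 3) = d \<and> degree (f 4) = d - 1 \<and> (\<exists>a. \<forall>u. monom 1 a * u \<in> subalg pconst (f ` {1..n}))"
proof -
  define p where "p i = (\<Sum>\<kappa><N. monom (c (i, \<kappa>)) \<kappa>)" for i
  have p: "coeff (p i) \<kappa> = (if \<kappa> < N then c (i, \<kappa>) else 0)" for i \<kappa>
    by (simp add: p_def coeff_sum)
  have degp: "degree (p i) < N" for i
  proof -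
    have "degree (p i) \<le> N - 1" by (rule degree_le) (use N in \<open>auto simp: p\<close>)
    then show ?thesis using N by simp
  qed
  define f1 where "f1 = p 1 + monom 1 N"
  define f2 where "f2 = p 2 + monom 1 (Suc N)"
  have d12: "degree f1 = N" "degree f2 = Suc N"
    unfolding f1_def f2_def using degp[of 1] degp[of 2] by (auto simp: degree_add_eq_right degree_monom_eq)
  obtain h where h: "h \<noteq> 0" "\<And>u. h * u \<in> subalg pconst {f1, f2}"
    using conductor_exists[OF d12 N] by blast
  define a where "a = order 0 h"
  obtain h1 where h1: "h = monom 1 a * h1" "\<not> [:0, 1:] dvd h1"
    using order_decomp[OF h(1), of 0] by (auto simp: a_def monom_power)
  have h10: "poly h1 0 \<noteq> 0" using h1(2) by (simp add: poly_eq_0_iff_dvd)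
  define h0 where "h0 = coeff h1 0"
  have h0: "h0 \<noteq> 0" using h10 by (simp add: h0_def poly_0_coeff_0)
  obtain k where k: "h1 = [:h0:] + [:0, 1:] * k" by (cases h1) (auto simp: h0_def)
  \<comment> \<open>An inverse of \<open>t\<close> modulo \<open>h1\<close>.\<close>
  define \<tau> where "\<tau> = smult (- inverse h0) k"
  have \<tau>: "h1 dvd 1 - [:0, 1:] * \<tau>"
  proof
    show "1 - [:0, 1:] * \<tau> = h1 * [:inverse h0:]"
      using h0 by (simp add: k \<tau>_def one_pCons)
  qed
  have \<tau>_pow: "h1 dvd 1 - monom 1 l * \<tau> ^ l" for l
  proof -
    have "1 - [:0, 1:] * \<tau> dvd 1 ^ l - ([:0, 1:] * \<tau>) ^ l" by (simp only: power_diff_sumr2 dvd_triv_left)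
    then have "1 - [:0, 1:] * \<tau> dvd 1 - monom 1 l * \<tau> ^ l"
      by (simp only: power_one power_mult_distrib monom_power)
    with \<tau> show ?thesis by (rule dvd_trans)
  qed
  have cancel: "h1 dvd w" if "h1 dvd monom 1 l * w" for l w
  proof -
    have "w = (1 - monom 1 l * \<tau> ^ l) * w + \<tau> ^ l * (monom 1 l * w)" by (simp add: algebra_simps)
    then show ?thesis using \<tau>_pow[of l] that by (metis dvd_add dvd_mult dvd_mult2)
  qed
  define d0 where "d0 = 2 * N + degree h1 + 3"
  have "\<exists>f :: nat \<Rightarrow> complex poly. (\<forall>i\<in>{1..n}. degree (f i) \<le> d \<and> (\<forall>\<kappa><N. coeff (f i) \<kappa> = c (i, \<kappa>))) \<and>
     degree (f 3) = d \<and> degree (f 4) = d - 1 \<and> (\<exists>a. \<forall>u. monom 1 a * u \<in> subalg pconst (f ` {1..n}))"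
    if d: "d0 \<le> d" for d
  proof -
    define v where "v = [:0, 1:] - p 3 - monom 1 d"
    \<comment> \<open>Chosen such that \<open>t^N q\<close> is congruent to \<open>v\<close> modulo \<open>h1\<close>, hence \<open>f3\<close> to \<open>t\<close>.\<close>
    define q where "q = (\<tau> ^ N * v) mod h1"
    have degq: "degree q \<le> degree h1" using degree_mod_less[of h1 "\<tau> ^ N * v"] h1 h by (auto simp: q_def)
    have "h1 dvd monom 1 N * (\<tau> ^ N * v) - monom 1 N * q"
      unfolding q_def right_diff_distrib[symmetric] by (simp add: dvd_mult)
    moreover have "h1 dvd (1 - monom 1 N * \<tau> ^ N) * v" using \<tau>_pow by (rule dvd_mult2)
    ultimately have "h1 dvd - (monom 1 N * (\<tau> ^ N * v) - monom 1 N * q) - (1 - monom 1 N * \<tau> ^ N) * v"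
      by (simp only: dvd_diff dvd_minus_iff)
    then have q: "h1 dvd monom 1 N * q - v" by (simp add: algebra_simps)
    define f3 where "f3 = p 3 + monom 1 N * q + monom 1 d"
    have f3: "h1 dvd f3 - [:0, 1:]" using q by (simp add: f3_def v_def algebra_simps)
    have degNq: "degree (monom 1 N * q) < d"
      using degree_mult_le[of "monom 1 N" q] degq d by (simp add: degree_monom_eq d0_def)
    have "degree (p 3 + monom 1 N * q) < d"
      using degp[of 3] degNq d by (intro degree_add_less) (auto simp: d0_def)
    then have df3: "degree f3 = d" unfolding f3_def by (simp add: degree_add_eq_right degree_monom_eq)
    define f4 where "f4 = p 4 + monom 1 (d - 1)"
    have df4: "degree f4 = d - 1" unfolding f4_def using degp[of 4] d
      by (simp add: degree_add_eq_right degree_monom_eq d0_def)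
    define f where "f i = (if i = 1 then f1 else if i = 2 then f2 else if i = 3 then f3 else if i = 4 then f4 else p i)" for i
    have "degree (f i) \<le> d" for i
      using d12 df3 df4 degp[of i] d by (auto simp: f_def d0_def)
    moreover have "coeff (f i) \<kappa> = c (i, \<kappa>)" if "\<kappa> < N" for i \<kappa>
    proof -
      have "\<kappa> \<noteq> d" "\<kappa> \<noteq> d - 1" "\<kappa> \<noteq> N" "\<kappa> \<noteq> Suc N" using that d by (auto simp: d0_def)
      then show ?thesis using that by (simp add: f_def f1_def f2_def f3_def f4_def p coeff_monom_mult del: One_nat_def)
    qed
    moreover have "monom 1 a * u \<in> subalg pconst (f ` {1..n})" for u
    proof -
      define A where "A = subalg pconst (f ` {1..n})"
      have "f 1 \<in> A" "f 2 \<in> A" "f 3 \<in> A" unfolding A_def using n by (auto intro: subalg.gen)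
      then have fA: "f1 \<in> A" "f2 \<in> A" "f3 \<in> A" by (auto simp: f_def)
      have hA: "h * w \<in> A" for w
        using subalg_least[OF h(2)[of w], of "f ` {1..n}"] fA unfolding A_def by auto
      have "h1 dvd pcompose u f3 - u" for u
      proof (induction u)
        case (pCons c u)
        have "pcompose (pCons c u) f3 - pCons c u = f3 * (pcompose u f3 - u) + (f3 - [:0, 1:]) * u"
          by (simp add: pcompose_pCons algebra_simps)
        then show ?case using pCons f3 by (simp add: dvd_mult dvd_mult2)
      qed simp
      from this[of "monom 1 a * u"] have 1: "h1 dvd pcompose (monom 1 a * u) f3 - monom 1 a * u" .
      have comp: "pcompose (monom 1 a * u) f3 = f3 ^ a * pcompose u f3"
        unfolding pcompose_mult
        by (induction a) (simp_all add: monom_Suc pcompose_pCons pcompose_mult mult.assoc one_pCons)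
      have "coeff f3 0 = 0" using c0 d N by (simp add: f3_def p d0_def coeff_monom_mult)
      then have "monom 1 1 dvd f3" unfolding monom_1_dvd_iff' by simp
      then have "[:0, 1:] dvd f3" by (simp add: monom_power)
      then have "monom 1 a dvd f3 ^ a" unfolding monom_power by (rule dvd_power_same)
      then obtain w where w: "pcompose (monom 1 a * u) f3 - monom 1 a * u = monom 1 a * w"
        unfolding comp by (metis dvd_def dvd_diff dvd_mult2 dvd_triv_left)
      then have "h1 dvd w" using 1 cancel by metis
      then obtain w' where "pcompose (monom 1 a * u) f3 - monom 1 a * u = h * w'"
        using w by (auto simp: h1 mult.assoc)
      then have "monom 1 a * u = pcompose (monom 1 a * u) f3 - h * w'" by (simp add: algebra_simps)
      also have "\<dots> \<in> A" using hA[of w'] pcompose_in_subalg[of f3] fA(3) unfolding A_def by (intro subalg_diff) auto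
      finally show ?thesis by (simp add: A_def)
    qed
    ultimately show ?thesis using df3 df4 by (intro exI[of _ f]) (auto simp: f_def)
  qed
  then show ?thesis by blast
qed

lemma subalg_fps_of_poly:
  "y \<in> subalg fps_const ((\<lambda>i. fps_of_poly (f i)) ` I) \<Longrightarrow> \<exists>v\<in>subalg pconst (f ` I). y = fps_of_poly v"
proof (induction rule: subalg.induct)
  case (const z)
  then show ?case by (intro bexI[of _ "[:z:]"] subalg.const) (simp add: fps_of_poly_const)
next
  case (gen x)
  then show ?case by (auto intro: subalg.gen)
next
  case (add x y)
  then show ?case by (metis fps_of_poly_add subalg.add)
next
  case (mult x y)
  then show ?case by (metis fps_of_poly_mult subalg.mult)
qed

lemma forms_mono:
  assumes "F 0 = 1" "k \<le> l" "x \<in> forms n F k"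
  shows "x \<in> forms n F l"
  using forms_mult[OF assms(3) forms_power[of 0 n F "l - k"]] assms by simp

text \<open>Because of the degrees \<open>d\<close> and \<open>d - 1\<close> the forms of degree \<open>k\<close> attain every degree
  attained by the algebra up to \<open>d k\<close>, hence exhaust the part of the algebra of degree at most
  \<open>d k\<close>.\<close>

lemma forms_exhaust:
  fixes f :: "nat \<Rightarrow> complex poly"
  assumes n: "n \<ge> 4" and d: "d > 1" and f0: "f 0 = 1" and deg: "degree (f 3) = d" "degree (f 4) = d - 1"
  defines "F \<equiv> \<lambda>i. fps_of_poly (f i)"
  shows "\<exists>k1. \<forall>k\<ge>k1. \<forall>v\<in>subalg pconst (f ` {1..n}). degree v \<le> d * k \<longrightarrow> fps_of_poly v \<in> forms n F k"
proof -
  define A where "A = subalg pconst (f ` {1..n})"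
  have F0: "F 0 = 1" by (simp add: F_def f0)
  have f34: "f 3 \<noteq> 0" "f 4 \<noteq> 0" "f 3 \<in> A" "f 4 \<in> A" using deg d n by (auto simp: A_def intro: subalg.gen)
  have ex: "\<exists>k. fps_of_poly v \<in> forms n F k" if "v \<in> A" for v
    using that unfolding A_def
  proof (induction rule: subalg.induct)
    case (const z)
    have "fps_const z * 1 \<in> forms n F 0"
      using forms_one[of n F] unfolding forms_def by (rule lincomb_scale)
    then show ?case by (auto simp: fps_of_poly_const)
  next
    case (gen x)
    then obtain i where "i \<le> n" "x = f i" by auto
    then have "fps_of_poly x \<in> forms n F 1" using forms_gen[of i n F] by (simp add: F_def)
    then show ?case by (rule exI)
  next
    case (add x y)
    then obtain k l where kl: "fps_of_poly x \<in> forms n F k" "fps_of_poly y \<in> forms n F l" by auto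
    have "fps_of_poly x \<in> forms n F (k + l)" "fps_of_poly y \<in> forms n F (k + l)"
      using forms_mono[OF F0 _ kl(1)] forms_mono[OF F0 _ kl(2)] by auto
    then show ?case unfolding forms_def by (metis fps_of_poly_add lincomb_add)
  next
    case (mult x y)
    then show ?case using forms_mult by (metis fps_of_poly_mult)
  qed
  define low where "low = {v. v \<in> A \<and> v \<noteq> 0 \<and> degree v < d * d}"
  have "\<exists>k. \<forall>\<delta>\<in>degree ` low. \<exists>b\<in>A. b \<noteq> 0 \<and> degree b = \<delta> \<and> fps_of_poly b \<in> forms n F k"
  proof -
    have fin: "finite (degree ` low)" by (rule finite_subset[of _ "{..<d * d}"]) (auto simp: low_def)
    have "\<forall>\<delta>\<in>degree ` low. \<exists>k. \<exists>b\<in>A. b \<noteq> 0 \<and> degree b = \<delta> \<and> fps_of_poly b \<in> forms n F k"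
      using ex unfolding low_def by blast
    then obtain K where K: "\<forall>\<delta>\<in>degree ` low. \<exists>b\<in>A. b \<noteq> 0 \<and> degree b = \<delta> \<and> fps_of_poly b \<in> forms n F (K \<delta>)"
      by metis
    have "K \<delta> \<le> (\<Sum>\<delta>\<in>degree ` low. K \<delta>)" if "\<delta> \<in> degree ` low" for \<delta>
      using fin that by (intro member_le_sum) auto
    then show ?thesis using K forms_mono[where F = F, OF F0] by meson
  qed
  then obtain k1 where k1: "\<And>\<delta>. \<delta> \<in> degree ` low \<Longrightarrow> \<exists>b\<in>A. b \<noteq> 0 \<and> degree b = \<delta> \<and> fps_of_poly b \<in> forms n F k1"
    by blast
  have step: "\<exists>b\<in>A. b \<noteq> 0 \<and> degree b = degree v \<and> fps_of_poly b \<in> forms n F k"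
    if v: "v \<in> A" "v \<noteq> 0" "degree v \<le> d * k" and k: "k1 \<le> k" for v k
  proof (cases "degree v < d * d")
    case True
    then obtain b where "b\<in>A" "b \<noteq> 0" "degree b = degree v" "fps_of_poly b \<in> forms n F k1"
      using k1[of "degree v"] v unfolding low_def by blast
    then show ?thesis using forms_mono[of F k1 k] F0 k by blast
  next
    case False
    then obtain \<alpha> \<beta> where \<alpha>\<beta>: "\<alpha> + \<beta> \<le> k" "\<alpha> * d + \<beta> * (d - 1) = degree v"
      using consecutive_combination[of d "degree v" k] v(3) d by auto
    define b where "b = f 3 ^ \<alpha> * f 4 ^ \<beta>"
    have "degree b = degree v" using f34 deg \<alpha>\<beta>(2) by (simp add: b_def degree_mult_eq degree_power_eq)
    moreover have "b \<in> A" unfolding b_def A_def using f34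
      by (intro subalg.mult subalg_power) (auto simp: A_def one_pCons)
    moreover have "fps_of_poly b = F 3 ^ \<alpha> * F 4 ^ \<beta>"
      by (simp add: b_def F_def fps_of_poly_mult fps_of_poly_power)
    moreover have "F 3 ^ \<alpha> * F 4 ^ \<beta> \<in> forms n F k"
      using F0 \<alpha>\<beta>(1) n by (intro forms_mono[of F "\<alpha> + \<beta>" k] forms_mult forms_power) auto
    ultimately show ?thesis using f34 by (intro bexI[of _ b]) (auto simp: b_def)
  qed
  have "fps_of_poly v \<in> forms n F k" if "v \<in> A" "degree v \<le> d * k" "k1 \<le> k" for v k
    using that
  proof (induction "degree v" arbitrary: v rule: less_induct)
    case less
    have zero: "fps_of_poly 0 \<in> forms n F k" by (simp add: forms_def lincomb_zero)
    show ?case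
    proof (cases "v = 0")
      case False
      obtain b where b: "b\<in>A" "b \<noteq> 0" "degree b = degree v" "fps_of_poly b \<in> forms n F k"
        using step[of v k] less False by auto
      define z where "z = lead_coeff v / lead_coeff b"
      define v' where "v' = v - smult z b"
      have "v' = 0 \<or> degree v' < degree v" unfolding v'_def z_def by (rule degree_cancel[OF b(2,3)])
      moreover have "v' \<in> A" unfolding v'_def A_def using less b by (intro subalg_diff_smult) (auto simp: A_def)
      ultimately have "fps_of_poly v' \<in> forms n F k" using less zero by (cases "v' = 0") auto
      then have "fps_of_poly v' + fps_const z * fps_of_poly b \<in> forms n F k"
        using b(4) unfolding forms_def by (intro lincomb_add lincomb_scale)
      then show ?thesis by (simp add: v'_def fps_of_poly_diff fps_of_poly_smult)
    qed (use zero in simp)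
  qed
  then show ?thesis unfolding A_def by blast
qed

lemma curve_with_full_orders:
  fixes c :: "nat \<times> nat \<Rightarrow> complex"
  assumes n: "n \<ge> 4" and N: "N > 0" and c0: "\<And>i. c (i, 0) = 0"
  shows "\<exists>d0. \<forall>d\<ge>d0. \<exists>f :: nat \<Rightarrow> complex fps. f 0 = 1 \<and>
    (\<forall>i\<in>{1..n}. deg_le d (f i) \<and> (\<forall>\<kappa><N. f i $ \<kappa> = c (i, \<kappa>))) \<and>
    (\<exists>k1. \<forall>k\<ge>k1. orders (subalg fps_const (f ` {1..n})) \<inter> {..<d * k + 1} \<subseteq> orders (forms n f k))"
proof -
  obtain d0 where d0: "\<And>d. d0 \<le> d \<Longrightarrow> \<exists>f :: nat \<Rightarrow> complex poly. (\<forall>i\<in>{1..n}. degree (f i) \<le> d \<and> (\<forall>\<kappa><N. coeff (f i) \<kappa> = c (i, \<kappa>))) \<and>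
     degree (f 3) = d \<and> degree (f 4) = d - 1 \<and> (\<exists>a. \<forall>u. monom 1 a * u \<in> subalg pconst (f ` {1..n}))"
    using curve_with_jets[of n N c] assms by blast
  show ?thesis
  proof (rule exI[of _ "d0 + 2"], intro allI impI)
    fix d assume "d0 + 2 \<le> d"
    then have d: "d0 \<le> d" "d > 1" by auto
    obtain f' a where f': "\<And>i. i \<in> {1..n} \<Longrightarrow> degree (f' i) \<le> d" "\<And>i \<kappa>. i \<in> {1..n} \<Longrightarrow> \<kappa> < N \<Longrightarrow> coeff (f' i) \<kappa> = c (i, \<kappa>)"
      "degree (f' 3) = d" "degree (f' 4) = d - 1" "\<And>u. monom 1 a * u \<in> subalg pconst (f' ` {1..n})"
      using d0[OF d(1)] by blast
    define f where "f = f'(0 := 1)"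
    have im: "f ` {1..n} = f' ` {1..n}" by (auto simp: f_def)
    define A where "A = subalg pconst (f ` {1..n})"
    define F where "F i = fps_of_poly (f i)" for i
    obtain k1 where k1: "\<And>k v. k1 \<le> k \<Longrightarrow> v \<in> A \<Longrightarrow> degree v \<le> d * k \<Longrightarrow> fps_of_poly v \<in> forms n F k"
      using forms_exhaust[OF n d(2), of f] f'(3,4) unfolding A_def F_def by (auto simp: f_def)
    have a: "monom 1 a * u \<in> A" for u using f'(5)[of u] unfolding A_def im .
    have "orders (subalg fps_const (F ` {1..n})) \<inter> {..<d * k + 1} \<subseteq> orders (forms n F k)"
      if k: "k1 + a \<le> k" for k
    proof
      fix s assume "s \<in> orders (subalg fps_const (F ` {1..n})) \<inter> {..<d * k + 1}"
      then have s: "s \<in> orders (subalg fps_const (F ` {1..n}))" "s \<le> d * k" by auto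
      have "a \<le> d * k" using k d by (metis add_leD2 le_trans less_imp_le mult.commute mult_le_mono2 nat_mult_1_right)
      obtain y where y: "y \<in> subalg fps_const (F ` {1..n})" "y $ s \<noteq> 0" "\<forall>\<kappa><s. y $ \<kappa> = 0"
        using s(1) by (rule ordersE)
      then obtain v where v: "v \<in> A" "y = fps_of_poly v"
        using subalg_fps_of_poly[of y f "{1..n}"] unfolding A_def F_def by blast
      have "\<exists>w\<in>A. degree w \<le> d * k \<and> coeff w s \<noteq> 0 \<and> (\<forall>\<kappa><s. coeff w \<kappa> = 0)"
      proof (cases "a \<le> s")
        case True
        have "monom 1 a * monom 1 (s - a) = (monom 1 s :: complex poly)" using True by (simp add: mult_monom)
        then have "monom 1 s \<in> A" using a[of "monom 1 (s - a)"] by simp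
        then show ?thesis using s(2) by (intro bexI[of _ "monom 1 s"]) (auto simp: degree_monom_eq)
      next
        case False
        define w where "w = (\<Sum>\<kappa><a. monom (coeff v \<kappa>) \<kappa>)"
        have w: "coeff w \<kappa> = (if \<kappa> < a then coeff v \<kappa> else 0)" for \<kappa> by (simp add: w_def coeff_sum)
        have "monom 1 a dvd v - w" unfolding monom_1_dvd_iff' by (simp add: w)
        then obtain u where "v - w = monom 1 a * u" by (auto elim: dvdE)
        then have "w = v - monom 1 a * u" by (simp add: algebra_simps)
        then have "w \<in> A" using v(1) a unfolding A_def by (simp add: subalg_diff)
        moreover have "degree w \<le> d * k"
          using degree_le[of "d * k" w] \<open>a \<le> d * k\<close> by (simp add: w)
        ultimately show ?thesis using y v False by (intro bexI[of _ w]) (auto simp: w)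
      qed
      then obtain w where w: "w\<in>A" "degree w \<le> d * k" "coeff w s \<noteq> 0" "\<forall>\<kappa><s. coeff w \<kappa> = 0" by blast
      have "fps_of_poly w \<in> forms n F k" using k1[of k w] w k by simp
      moreover have "subdegree (fps_of_poly w) = s" using w by (intro subdegreeI) auto
      moreover have "fps_of_poly w \<noteq> 0" using w(3) by auto
      ultimately show "s \<in> orders (forms n F k)" using ordersI by blast
    qed
    moreover have "F 0 = 1" by (simp add: F_def f_def)
    moreover have "deg_le d (F i) \<and> (\<forall>\<kappa><N. F i $ \<kappa> = c (i, \<kappa>))" if "i \<in> {1..n}" for i
      using f'(1,2)[OF that] that by (auto simp: F_def f_def deg_le_def coeff_eq_0)
    ultimately show "\<exists>f :: nat \<Rightarrow> complex fps. f 0 = 1 \<and>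
    (\<forall>i\<in>{1..n}. deg_le d (f i) \<and> (\<forall>\<kappa><N. f i $ \<kappa> = c (i, \<kappa>))) \<and>
    (\<exists>k1. \<forall>k\<ge>k1. orders (subalg fps_const (f ` {1..n})) \<inter> {..<d * k + 1} \<subseteq> orders (forms n f k))"
      by (intro exI[of _ F] conjI ballI exI[of _ "k1 + a"]) auto
  qed
qed

section \<open>Codimension of a parametrized family\<close>

text \<open>The coordinates are replaced by those of \<open>\<phi> w\<close> one after the other. In each step a nonzero value
  of \<open>P\<close> is kept by solving the equation of the new coordinate, which is linear in \<open>w b\<close>.\<close>

lemma triangular_dominant:
  fixes \<rho> :: "'i \<Rightarrow> nat"
  assumes B: "finite B" and \<rho>: "inj_on \<rho> B"
    and u: "\<And>b. b \<in> B \<Longrightarrow> u b \<in> poly_funs {b' \<in> B. \<rho> b' < \<rho> b}" "\<And>b. b \<in> B \<Longrightarrow> \<exists>w. u b w \<noteq> 0"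
    and v: "\<And>b. b \<in> B \<Longrightarrow> v b \<in> poly_funs {b' \<in> B. \<rho> b' < \<rho> b}"
    and \<phi>: "\<And>b w. b \<in> B \<Longrightarrow> \<phi> w b = u b w * w b + v b w"
    and P: "P \<in> poly_funs B" "P y \<noteq> 0"
  shows "\<exists>w. P (\<phi> w) \<noteq> 0"
proof -
  define mix where "mix t w = (\<lambda>b. if \<rho> b < t then \<phi> w b else w b)" for t w
  have uv: "u b \<in> poly_funs B" "v b \<in> poly_funs B" if "b \<in> B" for b
    using u(1)[OF that] v[OF that] by (auto elim: poly_funs_mono)
  have mix_poly: "(\<lambda>w. P (mix t w)) \<in> poly_funs B" for t
  proof (rule poly_funs_subst[OF P(1)])
    fix b assume b: "b \<in> B"
    have "(\<lambda>w. u b w * w b + v b w) \<in> poly_funs B"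
      using uv[OF b] b by (intro poly_funs.add poly_funs.mult poly_funs.coord)
    then show "(\<lambda>w. mix t w b) \<in> poly_funs B"
      using b \<phi>[OF b] by (cases "\<rho> b < t") (auto simp: mix_def intro: poly_funs.coord)
  qed
  have "\<exists>w. P (mix t w) \<noteq> 0" for t
  proof (induction t)
    case 0
    have "mix 0 y = y" by (simp add: mix_def)
    then show ?case using P(2) by metis
  next
    case (Suc t)
    then obtain w0 where w0: "P (mix t w0) \<noteq> 0" by blast
    show ?case
    proof (cases "\<exists>b\<in>B. \<rho> b = t")
      case False
      have "P (mix (Suc t) w0) = P (mix t w0)"
        by (rule poly_funs_cong[OF P(1)]) (use False in \<open>auto simp: mix_def less_Suc_eq\<close>)
      then show ?thesis using w0 by metis
    next
      case True
      then obtain b where b: "b \<in> B" "\<rho> b = t" by blast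
      obtain w1 where "u b w1 \<noteq> 0" using u(2)[OF b(1)] by blast
      then obtain w where w: "P (mix t w) \<noteq> 0" "u b w \<noteq> 0"
        using poly_funs_avoid[OF mix_poly[of t] uv(1)[OF b(1)], of w0 w1] w0 by blast
      define w' where "w' = w(b := (w b - v b w) / u b w)"
      have before: "p w' = p w" if "p \<in> poly_funs {b'' \<in> B. \<rho> b'' < \<rho> b'}" "\<rho> b' \<le> t" for p b'
        by (rule poly_funs_cong[OF that(1)]) (use that(2) b in \<open>auto simp: w'_def\<close>)
      have "P (mix (Suc t) w') = P (mix t w)"
      proof (rule poly_funs_cong[OF P(1)])
        fix b' assume b': "b' \<in> B"
        consider "\<rho> b' < t" | "b' = b" | "t < \<rho> b'" using b b' \<rho> by (metis inj_onD linorder_neqE_nat)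
        then show "mix (Suc t) w' b' = mix t w b'"
        proof cases
          case 1
          then have "w' b' = w b'" using b by (auto simp: w'_def)
          then show ?thesis using 1 \<phi>[OF b'] before[OF u(1)[OF b']] before[OF v[OF b']]
            by (simp add: mix_def)
        next
          case 2
          have "w' b = (w b - v b w) / u b w" by (simp add: w'_def)
          then show ?thesis using 2 b w(2) \<phi>[OF b(1)] before[OF u(1)[OF b(1)]] before[OF v[OF b(1)]]
            by (simp add: mix_def)
        next
          case 3
          then show ?thesis using b by (auto simp: mix_def w'_def)
        qed
      qed
      then show ?thesis using w(1) by metis
    qed
  qed
  then obtain w where w: "P (mix (Suc (\<Sum>b\<in>B. \<rho> b)) w) \<noteq> 0" by blast
  have "\<rho> b < Suc (\<Sum>b\<in>B. \<rho> b)" if "b \<in> B" for b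
    using member_le_sum[of b B \<rho>] that B by auto
  then have "P (mix (Suc (\<Sum>b\<in>B. \<rho> b)) w) = P (\<phi> w)"
    by (intro poly_funs_cong[OF P(1)]) (simp add: mix_def)
  then show ?thesis using w by metis
qed

text \<open>The closure of a dense part of the image of \<open>\<phi>\<close> is irreducible, and the coordinates in
  \<open>B\<close> are algebraically independent on it.\<close>

lemma codim_le_parametrized:
  assumes I: "finite I" and M: "M \<subseteq> affine_space I" and B: "B \<subseteq> I"
    and \<phi>: "\<And>i. i \<in> I \<Longrightarrow> (\<lambda>w. \<phi> w i) \<in> poly_funs B"
    and dense: "\<And>P w. P \<in> poly_funs B \<Longrightarrow> P w \<noteq> 0 \<Longrightarrow> \<exists>w\<in>W. P w \<noteq> 0"
    and dominant: "\<And>P y. P \<in> poly_funs B \<Longrightarrow> P y \<noteq> 0 \<Longrightarrow> \<exists>w. P (\<phi> w) \<noteq> 0"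
    and Y: "\<And>w. w \<in> W \<Longrightarrow> \<phi> w \<in> Y" "Y \<subseteq> M"
  shows "codim (subtopology (zariski I) M) Y \<le> enat (card I - card B)"
proof -
  define X where "X = subtopology (zariski I) M"
  define K where "K = {p \<in> poly_funs I. \<forall>w\<in>W. p (\<phi> w) = 0}"
  define Z where "Z = (\<Inter>p\<in>K. {x \<in> M. p x = 0})"
  have pull: "(\<lambda>w. p (\<phi> w)) \<in> poly_funs B" if "p \<in> poly_funs I" for p
    using that \<phi> by (rule poly_funs_subst)
  have "(\<lambda>_. 0) \<in> K" by (auto simp: K_def intro: poly_funs.const)
  then have Kne: "K \<noteq> {}" by blast
  have Zc: "closedin X Z" unfolding Z_def X_def
    using Kne by (intro closedin_Inter) (auto simp: K_def intro!: closedin_zariski_zeros[OF M])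
  have \<phi>Z: "\<phi> w \<in> Z" if "w \<in> W" for w using Y that by (auto simp: Z_def K_def)
  obtain w0 where w0: "w0 \<in> W" using dense[of "\<lambda>_. 1" undefined] poly_funs.const by auto
  have ZM: "Z \<subseteq> M" using Kne by (auto simp: Z_def)
  have nonzero: "\<exists>p\<in>poly_funs I. (\<forall>z\<in>C. p z = 0) \<and> (\<exists>w\<in>W. p (\<phi> w) \<noteq> 0)" if C: "closedin X C" "\<not> Z \<subseteq> C" for C
  proof -
    have "\<exists>x. x \<in> Z \<and> x \<notin> C" using C(2) by blast
    then obtain x where x: "x \<in> Z" "x \<notin> C" by blast
    then obtain p where p: "p \<in> poly_funs I" "p x \<noteq> 0" "\<forall>z\<in>C. p z = 0"
      using closedin_zariski_separate[OF M, of C x] C(1) ZM unfolding X_def by blast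
    then have "p \<notin> K" using x(1) by (auto simp: Z_def)
    then show ?thesis using p by (auto simp: K_def)
  qed
  have irr: "irreducible_closed X Z"
    unfolding irreducible_closed_def
  proof (intro conjI allI impI)
    show "Z \<noteq> {}" using \<phi>Z w0 by auto
    fix C D assume CD: "closedin X C \<and> closedin X D \<and> Z \<subseteq> C \<union> D"
    show "Z \<subseteq> C \<or> Z \<subseteq> D"
    proof (rule ccontr)
      assume "\<not> (Z \<subseteq> C \<or> Z \<subseteq> D)"
      then have C: "closedin X C" "\<not> Z \<subseteq> C" and D: "closedin X D" "\<not> Z \<subseteq> D" using CD by auto
      obtain p w where p: "p \<in> poly_funs I" "\<forall>z\<in>C. p z = 0" "p (\<phi> w) \<noteq> 0"
        using nonzero[OF C] by blast
      obtain q w' where q: "q \<in> poly_funs I" "\<forall>z\<in>D. q z = 0" "q (\<phi> w') \<noteq> 0"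
        using nonzero[OF D] by blast
      have pqB: "(\<lambda>w. p (\<phi> w)) \<in> poly_funs B" "(\<lambda>w. q (\<phi> w)) \<in> poly_funs B"
        using pull p(1) q(1) by auto
      obtain w1 where w1: "p (\<phi> w1) \<noteq> 0" "q (\<phi> w1) \<noteq> 0"
        using poly_funs_avoid[of "\<lambda>w. p (\<phi> w)" B "\<lambda>w. q (\<phi> w)" w w'] pqB p(3) q(3) by blast
      have "(\<lambda>w. p (\<phi> w) * q (\<phi> w)) \<in> poly_funs B" by (rule poly_funs.mult[OF pqB])
      then obtain w2 where w2: "w2 \<in> W" "p (\<phi> w2) * q (\<phi> w2) \<noteq> 0"
        using dense[of "\<lambda>w. p (\<phi> w) * q (\<phi> w)" w1] w1 by auto
      have "\<phi> w2 \<in> C \<union> D" using \<phi>Z[OF w2(1)] CD by blast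
      then show False using p(2) q(2) w2(2) by auto
    qed
  qed (rule Zc)
  have "Z \<subseteq> X closure_of Y"
  proof (rule ccontr)
    assume n: "\<not> ?thesis"
    have cl: "closedin X (X closure_of Y)" by (rule closedin_closure_of)
    obtain p where "p \<in> poly_funs I" and p: "\<forall>z\<in>X closure_of Y. p z = 0" "\<exists>w\<in>W. p (\<phi> w) \<noteq> 0"
      using nonzero[OF cl n] by blast
    moreover have "Y \<subseteq> X closure_of Y"
      by (rule closure_of_subset) (use Y(2) M in \<open>simp add: X_def\<close>)
    ultimately show False using Y(1) by blast
  qed
  then have "codim X Y \<le> irreducible_codim X Z"
    unfolding codim_def using irr by (intro Inf_lower CollectI exI[of _ Z]) simp
  also have "\<dots> \<le> enat (card I - card B)"
  proof -
    have finB: "finite B" using B I finite_subset by blast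
    then obtain e where e: "bij_betw e {..<card B} B"
      using ex_bij_betw_nat_finite[of B] by (auto simp: atLeast0LessThan)
    define q where "q = (\<lambda>j x. x (e j) :: complex)"
    have eB: "e j \<in> B" if "j < card B" for j using e that by (auto simp: bij_betw_def)
    have qI: "q j \<in> poly_funs I" if "j < card B" for j
      unfolding q_def using eB[OF that] B by (auto intro: poly_funs.coord)
    have "alg_indep_on Z (card B) q"
      unfolding alg_indep_on_def
    proof (intro ballI impI allI)
      fix P :: "(nat \<Rightarrow> complex) \<Rightarrow> complex" and y
      assume P: "P \<in> poly_funs {..<card B}" and P0: "\<forall>x\<in>Z. P (\<lambda>j. q j x) = 0"
      show "P y = 0"
      proof (rule ccontr)
        assume Py: "P y \<noteq> 0"
        define P' where "P' x = P (\<lambda>j. x (e j))" for x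
        have P': "P' \<in> poly_funs B" unfolding P'_def
          by (rule poly_funs_subst[OF P]) (auto intro: poly_funs.coord eB)
        define x where "x i = y (the_inv_into {..<card B} e i)" for i
        have "P' x = P y" unfolding P'_def
          by (rule poly_funs_cong[OF P]) (use e in \<open>auto simp: x_def bij_betw_def the_inv_into_f_f\<close>)
        then obtain w where "P' (\<phi> w) \<noteq> 0" using dominant[OF P', of x] Py by metis
        then obtain w' where "w' \<in> W" "P' (\<phi> w') \<noteq> 0"
          using dense[of "\<lambda>w. P' (\<phi> w)"] pull[OF poly_funs_mono[OF P' B]] by blast
        then show False using P0 \<phi>Z[of w'] by (auto simp: P'_def q_def)
      qed
    qed
    with qI show ?thesis unfolding X_def by (rule irreducible_codim_le[OF I M])
  qed
  finally show ?thesis by (simp add: X_def)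
qed

section \<open>The family of maps with the given ramification at a fixed point\<close>

definition ram_ord :: "nat \<Rightarrow> nat \<Rightarrow> nat" where
  "ram_ord m j = (if j = 0 then 0 else cusp_ord m j)"

lemma ram_ord_mono: "m > 0 \<Longrightarrow> i < j \<Longrightarrow> ram_ord m i < ram_ord m j"
  by (auto simp: ram_ord_def cusp_ord_def)

lemma ram_ord_inj: "m > 0 \<Longrightarrow> ram_ord m i = ram_ord m j \<longleftrightarrow> i = j"
  by (auto simp: ram_ord_def cusp_ord_def split: if_splits)

text \<open>The entry \<open>w (i, k)\<close> is the coefficient of \<open>t^k\<close> in \<open>f\<^sub>i\<close> for
  \<open>k \<ge> ram_ord m i\<close>, and the entry \<open>(i, j)\<close> of a lower unitriangular matrix for
  \<open>k = ram_ord m j\<close> with \<open>j < i\<close>. With this indexing the parameters are as many as the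
  coordinates of the image in the same positions.\<close>

definition ram_index :: "nat \<Rightarrow> nat \<Rightarrow> nat \<Rightarrow> (nat \<times> nat) set" where
  "ram_index n m d = {(i, k). i \<le> n \<and> k \<le> d \<and> (ram_ord m i \<le> k \<or> (\<exists>j<i. k = ram_ord m j))}"

definition ram_matrix :: "nat \<Rightarrow> (nat \<times> nat \<Rightarrow> complex) \<Rightarrow> nat \<Rightarrow> nat \<Rightarrow> complex" where
  "ram_matrix m w i j = (if i = j then 1 else w (i, ram_ord m j))"

definition ram_fps :: "nat \<Rightarrow> nat \<Rightarrow> (nat \<times> nat \<Rightarrow> complex) \<Rightarrow> nat \<Rightarrow> complex fps" where
  "ram_fps m d w j = Abs_fps (\<lambda>k. if ram_ord m j \<le> k \<and> k \<le> d then w (j, k) else 0)"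

definition ram_map :: "nat \<Rightarrow> nat \<Rightarrow> nat \<Rightarrow> (nat \<times> nat \<Rightarrow> complex) \<Rightarrow> nat \<times> nat \<Rightarrow> complex" where
  "ram_map n m d w = (\<lambda>(i, k). if i \<le> n \<and> k \<le> d
     then \<Sum>j\<le>i. ram_matrix m w i j * ram_fps m d w j $ k else 0)"

lemma ram_index_subset: "ram_index n m d \<subseteq> {..n} \<times> {..d}"
  by (auto simp: ram_index_def)

lemma ram_matrix_poly:
  assumes "m > 0" "j \<le> i" "i \<le> n" "ram_ord m n \<le> d"
  shows "(\<lambda>w. ram_matrix m w i j) \<in> poly_funs (ram_index n m d)"
proof (cases "i = j")
  case False
  then have "ram_ord m j < ram_ord m i" "ram_ord m i \<le> ram_ord m n"
    using assms ram_ord_mono[of m j i] ram_ord_mono[of m i n] by (auto simp: le_less)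
  moreover have "j < i" using False assms(2) by simp
  ultimately have "(i, ram_ord m j) \<in> ram_index n m d" using assms by (auto simp: ram_index_def)
  then show ?thesis using False by (simp add: ram_matrix_def poly_funs.coord)
qed (simp add: ram_matrix_def poly_funs.const)

lemma ram_fps_poly: "j \<le> n \<Longrightarrow> (\<lambda>w. ram_fps m d w j $ k) \<in> poly_funs (ram_index n m d)"
  by (cases "ram_ord m j \<le> k \<and> k \<le> d")
    (auto simp: ram_fps_def ram_index_def intro!: poly_funs.coord poly_funs.const)

lemma ram_map_poly:
  assumes "m > 0" "ram_ord m n \<le> d"
  shows "(\<lambda>w. ram_map n m d w (i, k)) \<in> poly_funs (ram_index n m d)"
proof (cases "i \<le> n \<and> k \<le> d")
  case True
  then show ?thesis unfolding ram_map_def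
    by (auto intro!: poly_funs_sum poly_funs.mult ram_matrix_poly ram_fps_poly assms)
next
  case False
  then have "(\<lambda>w. ram_map n m d w (i, k)) = (\<lambda>w. 0)" by (auto simp: ram_map_def)
  then show ?thesis by (simp add: poly_funs.const)
qed

lemma ram_map_dominant:
  assumes m: "m > 0" and d: "ram_ord m n \<le> d" and P: "P \<in> poly_funs (ram_index n m d)" "P y \<noteq> 0"
  shows "\<exists>w. P (ram_map n m d w) \<noteq> 0"
proof -
  define B where "B = ram_index n m d"
  define \<rho> where "\<rho> = (\<lambda>(i, k). i * (d + 1) + k)"
  have \<rho>_lex: "\<rho> (i', k') < \<rho> (i, k)" if "i' < i" "k' \<le> d" for i i' k k' :: nat
  proof -
    have "(i' + 1) * (d + 1) \<le> i * (d + 1)" using that(1) by (intro mult_le_mono1) simp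
    then show ?thesis using that(2) by (simp add: \<rho>_def)
  qed
  have \<rho>_row: "\<rho> (i, k') < \<rho> (i, k) \<longleftrightarrow> k' < k" for i k k' by (simp add: \<rho>_def)
  define lo where "lo b = {b' \<in> B. \<rho> b' < \<rho> b}" for b
  define u where "u = (\<lambda>(i, k) w. if ram_ord m i \<le> k then 1 else w (SOME j. j < i \<and> k = ram_ord m j, k) :: complex)"
  define v where "v = (\<lambda>(i, k) w. if ram_ord m i \<le> k then \<Sum>j<i. ram_matrix m w i j * ram_fps m d w j $ k
      else \<Sum>j<(SOME j. j < i \<and> k = ram_ord m j). ram_matrix m w i j * ram_fps m d w j $ k)"
  have some: "(SOME j. j < i \<and> ram_ord m j0 = ram_ord m j) = j0" if "j0 < i" for i j0
    using that ram_ord_inj[OF m] by (intro some_equality) auto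
  have fps_lo: "(\<lambda>w. ram_fps m d w j $ k) \<in> poly_funs (lo (i, k))" if "j < i" "(i, k) \<in> B" for i j k
  proof (cases "ram_ord m j \<le> k")
    case True
    then have "(j, k) \<in> lo (i, k)"
      using that \<rho>_lex[of j i k k] by (auto simp: lo_def B_def ram_index_def)
    then show ?thesis using True that by (auto simp: ram_fps_def B_def ram_index_def intro: poly_funs.coord)
  qed (simp add: ram_fps_def poly_funs.const)
  have mat_lo: "(\<lambda>w. ram_matrix m w i j) \<in> poly_funs (lo (i, k))"
    if "j < i" "(i, k) \<in> B" "ram_ord m j < k" for i j k
  proof -
    have "(i, ram_ord m j) \<in> lo (i, k)"
      using that by (auto simp: lo_def B_def ram_index_def \<rho>_row)
    then show ?thesis using that by (simp add: ram_matrix_def poly_funs.coord)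
  qed
  have row: "\<exists>j0<i. k = ram_ord m j0" if "(i, k) \<in> B" "\<not> ram_ord m i \<le> k" for i k
    using that by (auto simp: B_def ram_index_def)
  have "\<exists>w. P (ram_map n m d w) \<noteq> 0"
  proof (rule triangular_dominant[where \<rho> = \<rho> and u = u and v = v and B = B and \<phi> = "ram_map n m d" and P = P])
    show "finite B" unfolding B_def by (rule finite_subset[OF ram_index_subset]) auto
    show "inj_on \<rho> B"
    proof (rule inj_onI, clarify)
      fix i k i' k' assume h: "(i, k) \<in> B" "(i', k') \<in> B" "\<rho> (i, k) = \<rho> (i', k')"
      then have "k \<le> d" "k' \<le> d" by (auto simp: B_def ram_index_def)
      then have "i = i'" using h(3) \<rho>_lex[of i i' k k'] \<rho>_lex[of i' i k' k] by (metis nat_neq_iff)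
      then show "i = i' \<and> k = k'" using h(3) by (simp add: \<rho>_def)
    qed
    fix b assume b: "b \<in> B"
    obtain i k where ik: "b = (i, k)" by force
    have B: "(i, k) \<in> B" using b ik by simp
    have ik': "i \<le> n" "k \<le> d" using B by (auto simp: B_def ram_index_def)
    have pu: "u b \<in> poly_funs (lo b) \<and> v b \<in> poly_funs (lo b) \<and> (\<exists>w. u b w \<noteq> 0) \<and>
        (\<forall>w. ram_map n m d w b = u b w * w b + v b w)"
    proof (cases "ram_ord m i \<le> k")
      case True
      have "ram_ord m j < k" if "j < i" for j using ram_ord_mono[OF m that] True by simp
      then have "(\<lambda>w. \<Sum>j<i. ram_matrix m w i j * ram_fps m d w j $ k) \<in> poly_funs (lo (i, k))"
        using B by (intro poly_funs_sum poly_funs.mult mat_lo fps_lo) auto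
      moreover have "ram_map n m d w (i, k) = w (i, k) + (\<Sum>j<i. ram_matrix m w i j * ram_fps m d w j $ k)" for w
      proof -
        have "{..i} = insert i {..<i}" by auto
        then show ?thesis using ik' True by (simp add: ram_map_def ram_matrix_def[of m w i i] ram_fps_def[of m d w i])
      qed
      ultimately show ?thesis using True by (simp add: ik u_def v_def poly_funs.const)
    next
      case False
      then obtain j0 where j0: "j0 < i" "k = ram_ord m j0" using row[OF B] by blast
      have sj: "(SOME j. j < i \<and> k = ram_ord m j) = j0" unfolding j0(2) by (rule some[OF j0(1)])
      have "ram_ord m j < k" if "j < j0" for j using ram_ord_mono[OF m that] j0 by simp
      then have "(\<lambda>w. \<Sum>j<j0. ram_matrix m w i j * ram_fps m d w j $ k) \<in> poly_funs (lo (i, k))"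
        using B j0(1) by (intro poly_funs_sum poly_funs.mult mat_lo fps_lo) auto
      moreover have "(j0, k) \<in> lo (i, k)"
        using B j0 ik' \<rho>_lex[of j0 i k k] by (auto simp: lo_def B_def ram_index_def)
      then have "(\<lambda>w. w (j0, k)) \<in> poly_funs (lo (i, k))" by (rule poly_funs.coord)
      moreover have "ram_map n m d w (i, k) = w (j0, k) * w (i, k) + (\<Sum>j<j0. ram_matrix m w i j * ram_fps m d w j $ k)" for w
      proof -
        have "ram_fps m d w j $ k = 0" if "j0 < j" for j
          using ram_ord_mono[OF m that] j0 by (simp add: ram_fps_def)
        then have "(\<Sum>j\<le>i. ram_matrix m w i j * ram_fps m d w j $ k) = (\<Sum>j\<in>insert j0 {..<j0}. ram_matrix m w i j * ram_fps m d w j $ k)"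
          using j0(1) by (intro sum.mono_neutral_right) auto
        then show ?thesis using ik' j0 by (simp add: ram_map_def ram_matrix_def[of m w i j0] ram_fps_def[of m d w j0])
      qed
      moreover have "\<exists>w. w (j0, k) \<noteq> (0 :: complex)" by (rule exI[of _ "\<lambda>_. 1"]) simp
      ultimately show ?thesis using False by (simp add: ik u_def v_def sj)
    qed
    show "u b \<in> poly_funs {b' \<in> B. \<rho> b' < \<rho> b}" "v b \<in> poly_funs {b' \<in> B. \<rho> b' < \<rho> b}" "\<exists>w. u b w \<noteq> 0"
      using pu by (auto simp: lo_def)
    fix w
    show "ram_map n m d w b = u b w * w b + v b w" using pu by blast
  qed (use P in \<open>auto simp: B_def\<close>)
  then show ?thesis .
qed

text \<open>In row \<open>i\<close> the missing positions are those before \<open>ram_ord m i\<close>, except \<open>ram_ord m j\<close> for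
  \<open>j < i\<close>: there are \<open>ram_ord m i - i\<close> of them.\<close>

lemma card_ram_index:
  assumes m: "m > 0" and d: "ram_ord m n \<le> d"
  shows "2 * (card ({..n} \<times> {..d}) - card (ram_index n m d)) = n * (4 * m + n - 3)"
proof -
  have "card ({..n} \<times> {..d}) - card (ram_index n m d) = card ({..n} \<times> {..d} - ram_index n m d)"
    using finite_subset[OF ram_index_subset[of n m d]] ram_index_subset[of n m d]
    by (intro card_Diff_subset[symmetric]) auto
  also have "{..n} \<times> {..d} - ram_index n m d = (SIGMA i:{..n}. {..<ram_ord m i} - ram_ord m ` {..<i})"
  proof -
    have "k \<le> d" if "k < ram_ord m i" "i \<le> n" for i k
    proof -
      have "ram_ord m i \<le> ram_ord m n" using ram_ord_mono[OF m, of i n] that by (cases "i = n") auto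
      then show ?thesis using that d by simp
    qed
    then show ?thesis by (auto simp: ram_index_def not_le)
  qed
  also have "card \<dots> = (\<Sum>i\<le>n. ram_ord m i - i)"
  proof (subst card_SigmaI)
    have "card ({..<ram_ord m i} - ram_ord m ` {..<i}) = ram_ord m i - i" for i
    proof -
      have "inj_on (ram_ord m) {..<i}" using ram_ord_inj[OF m] by (auto simp: inj_on_def)
      then have "card (ram_ord m ` {..<i}) = i" by (simp add: card_image)
      moreover have "ram_ord m ` {..<i} \<subseteq> {..<ram_ord m i}" using ram_ord_mono[OF m] by auto
      ultimately show ?thesis by (simp add: card_Diff_subset)
    qed
    then show "(\<Sum>i\<le>n. card ({..<ram_ord m i} - ram_ord m ` {..<i})) = (\<Sum>i\<le>n. ram_ord m i - i)" by simp
  qed auto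
  also have "2 * (\<Sum>i\<le>n. ram_ord m i - i) = n * (4 * m + n - 3)"
  proof (induction n)
    case (Suc n)
    obtain m' where m': "m = Suc m'" using m by (cases m) auto
    have "int (2 * (\<Sum>i\<le>Suc n. ram_ord m i - i)) = int (n * (4 * m + n - 3)) + 2 * int (ram_ord m (Suc n) - Suc n)"
      using Suc by simp
    also have "\<dots> = int (Suc n * (4 * m + Suc n - 3))"
      by (auto simp: m' ram_ord_def cusp_ord_def algebra_simps)
    finally show ?case by (simp only: of_nat_eq_iff)
  qed (simp add: ram_ord_def)
  finally show ?thesis .
qed

section \<open>Good parameters are dense\<close>

lemma value_semigroup_cong:
  assumes "\<And>i. i \<in> I \<Longrightarrow> f i = h i"
  shows "value_semigroup I f = value_semigroup I h"
proof -
  have "mps_subst I f = mps_subst I h"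
    unfolding mps_subst_def using assms by (auto intro!: ext sum.cong arg_cong[of _ _ Abs_fps])
  then show ?thesis by (simp add: value_semigroup_def)
qed

lemma forms_cong:
  assumes "\<And>i. i \<le> n \<Longrightarrow> F i = H i"
  shows "forms n F k = forms n H k"
proof -
  have "monomial {..n} F a = monomial {..n} H a" for a
    unfolding monomial_def using assms by (intro prod.cong) auto
  then have "monomial {..n} F = monomial {..n} H" by blast
  then show ?thesis by (simp add: forms_def)
qed

lemma vanishes_mult_lead: "vanishes N x \<Longrightarrow> (x * y) $ N = x $ N * y $ 0"
proof -
  assume "vanishes N x"
  then have "(\<Sum>i=0..N. x $ i * y $ (N - i)) = (\<Sum>i\<in>{N}. x $ i * y $ (N - i))"
    by (intro sum.mono_neutral_right) (auto simp: vanishes_def)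
  then show ?thesis by (simp add: fps_mult_nth)
qed

text \<open>The parameters to which the criterion of \<open>cusp_map\<close> applies.\<close>

definition good_params :: "nat \<Rightarrow> nat \<Rightarrow> nat \<Rightarrow> nat set \<Rightarrow> (nat \<times> nat \<Rightarrow> complex) set" where
  "good_params n m d S = {w. (\<forall>j\<le>n. w (j, ram_ord m j) \<noteq> 0) \<and>
     value_semigroup {1..n} (\<lambda>j. ram_fps m d w j / ram_fps m d w 0) = S \<and>
     (\<exists>k1\<ge>2. \<forall>k. k1 \<le> k \<longrightarrow> k \<le> 2 * k1 + 1 \<longrightarrow>
        d * k + 1 \<le> card (orders (forms n (coeff_fps (ram_map n m d w)) k) \<inter> {..<d * k + 1}) + card (UNIV - S))}"

lemma ram_ord_le: "m > 0 \<Longrightarrow> i \<le> j \<Longrightarrow> ram_ord m i \<le> ram_ord m j"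
  by (cases "i = j") (auto dest: ram_ord_mono[of m i j])

lemma ram_map_in_severi:
  assumes n: "3 \<le> n" and m: "0 < m" and nm: "n \<le> m" and d: "ram_ord m n \<le> d" "C \<le> d" "2 \<le> d"
    and cond: "\<And>s. C \<le> s \<Longrightarrow> s \<in> S" and w: "w \<in> good_params n m d S"
  shows "ram_map n m d w \<in> severi n d (card (UNIV - S)) S"
proof -
  obtain k1 where k1: "2 \<le> k1" "\<And>k. k1 \<le> k \<Longrightarrow> k \<le> 2 * k1 + 1 \<Longrightarrow>
      d * k + 1 \<le> card (orders (forms n (coeff_fps (ram_map n m d w)) k) \<inter> {..<d * k + 1}) + card (UNIV - S)"
    using w unfolding good_params_def by blast
  have le: "ram_ord m j \<le> d" if "j \<le> n" for j using ram_ord_le[OF m that] d by simp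
  have lead: "w (j, ram_ord m j) \<noteq> 0" if "j \<le> n" for j using w that by (simp add: good_params_def)
  have sem: "value_semigroup {1..n} (\<lambda>j. ram_fps m d w j / ram_fps m d w 0) = S"
    using w by (simp add: good_params_def)
  interpret cusp_map n m d k1 C "card (UNIV - S)" "ram_matrix m w" "ram_fps m d w" "ram_map n m d w" S
  proof
    show "ram_fps m d w 0 $ 0 \<noteq> 0" using lead[of 0] by (simp add: ram_fps_def ram_ord_def)
    show "deg_le d (ram_fps m d w j)" for j by (simp add: deg_le_def ram_fps_def)
    show "vanishes (cusp_ord m j) (ram_fps m d w j)" if "j \<in> {1..n}" for j
      using that by (auto simp: vanishes_def ram_fps_def ram_ord_def)
    show "ram_fps m d w j $ cusp_ord m j \<noteq> 0" if "j \<in> {1..n}" for j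
      using that lead[of j] le[of j] by (auto simp: ram_fps_def ram_ord_def)
  qed (use n m nm d cond k1 sem in \<open>auto simp: ram_matrix_def ram_map_def\<close>)
  show ?thesis by (rule in_severi)
qed

text \<open>The rank conditions are open in the parameters, and they hold for a curve with \<open>f 0 = 1\<close> and the
  generic jets \<open>c0\<close>. The semigroup condition is generic in the quotients \<open>f j / f 0\<close>, which are
  linear in the parameters once \<open>f 0\<close> is fixed. So one first moves to a point where the polynomials
  for \<open>P\<close> and the ranks are nonzero, and from there, with the same \<open>f 0\<close>, towards a point where
  the quotients have the jets of \<open>c0\<close>.\<close>

lemma good_params_dense:
  assumes n: "n \<ge> 4" and m: "m > 0"
  shows "\<exists>d0. \<forall>d\<ge>d0. \<forall>P\<in>poly_funs (ram_index n m d). \<forall>w. P w \<noteq> 0 \<longrightarrow>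
    (\<exists>w'\<in>good_params n m d (S_gen m n). P w' \<noteq> 0)"
proof -
  define S where "S = S_gen m n"
  define CP where "CP = cusp_params n (cusp_ord m)"
  obtain G c0 where G: "G \<in> poly_funs ({1..n} \<times> UNIV)" "c0 \<in> CP" "G c0 \<noteq> 0"
    "\<And>c. c \<in> CP \<Longrightarrow> G c \<noteq> 0 \<Longrightarrow> value_semigroup {1..n} (coeff_fps c) = S \<and> odd_coeff m c \<noteq> 0"
    using S_gen_generic[of n m] n m unfolding S_def CP_def by auto
  define C where "C = 2 * m * m + 4 * m + 5"
  have cond: "s \<in> S" if "C \<le> s" for s
    using cusp_semigroup_cofinite[of n m c0 s] G(2,3) G(4)[of c0] n m that unfolding CP_def C_def by auto
  obtain J where J: "finite J" "J \<subseteq> {1..n} \<times> UNIV" "G \<in> poly_funs J"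
    using poly_funs_finite_support[OF G(1)] by blast
  define N where "N = Suc (Max (insert (ram_ord m n) (snd ` J)))"
  have JN: "k < N" if "(i, k) \<in> J" for i k
  proof -
    have "k \<in> insert (ram_ord m n) (snd ` J)" using that by force
    then show ?thesis unfolding N_def using J(1) by (simp add: less_Suc_eq_le)
  qed
  have rN: "ram_ord m j < N" if "j \<le> n" for j
    using ram_ord_le[OF m that] J(1) unfolding N_def by (auto simp: less_Suc_eq_le intro: le_trans)
  have c0van: "c0 (i, k) = 0" if "i \<in> {1..n}" "k < cusp_ord m i" for i k
    using G(2) that unfolding CP_def cusp_params_iff cusp_space_def by blast
  have c0lead: "c0 (i, cusp_ord m i) \<noteq> 0" if "i \<in> {1..n}" for i
    using G(2) that unfolding CP_def cusp_params_iff by blast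
  have c00: "c0 (i, 0) = 0" for i
  proof (cases "i \<in> {1..n}")
    case True
    then show ?thesis using c0van[of i 0] m by (simp add: cusp_ord_def)
  next
    case False
    then show ?thesis using G(2) unfolding CP_def cusp_params_def affine_space_def by auto
  qed
  obtain d0 where d0: "\<And>d. d0 \<le> d \<Longrightarrow> \<exists>f :: nat \<Rightarrow> complex fps. f 0 = 1 \<and>
    (\<forall>i\<in>{1..n}. deg_le d (f i) \<and> (\<forall>\<kappa><N. f i $ \<kappa> = c0 (i, \<kappa>))) \<and>
    (\<exists>k1. \<forall>k\<ge>k1. orders (subalg fps_const (f ` {1..n})) \<inter> {..<d * k + 1} \<subseteq> orders (forms n f k))"
    using curve_with_full_orders[of n N c0] n c00 by (auto simp: N_def)
  have "\<exists>w'\<in>good_params n m d S. P w' \<noteq> 0"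
    if d: "d0 + N + C + 2 \<le> d" and P: "P \<in> poly_funs (ram_index n m d)" "P wP \<noteq> 0" for d P wP
  proof -
    have "d0 \<le> d" using d by simp
    from d0[OF this] obtain e
      where ek': "\<exists>k1. \<forall>k\<ge>k1. orders (subalg fps_const (e ` {1..n})) \<inter> {..<d * k + 1} \<subseteq> orders (forms n e k)"
        and e0: "e 0 = 1" and e': "\<forall>i\<in>{1..n}. deg_le d (e i) \<and> (\<forall>\<kappa><N. e i $ \<kappa> = c0 (i, \<kappa>))"
      by blast
    obtain k1' where ek: "\<And>k. k1' \<le> k \<Longrightarrow> orders (subalg fps_const (e ` {1..n})) \<inter> {..<d * k + 1} \<subseteq> orders (forms n e k)"
      using ek' by blast
    have edeg: "deg_le d (e i)" if "i \<in> {1..n}" for i using e' that by blast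
    have eN: "e i $ \<kappa> = c0 (i, \<kappa>)" if "i \<in> {1..n}" "\<kappa> < N" for i \<kappa> using e' that by blast
    have Nd: "N \<le> d" using d by simp
    have evan: "e i $ \<kappa> = 0" if "i \<le> n" "\<kappa> < ram_ord m i" for i \<kappa>
    proof -
      have i: "i \<in> {1..n}" using that by (cases "i = 0") (auto simp: ram_ord_def)
      then show ?thesis using eN[of i \<kappa>] c0van[of i \<kappa>] rN[of i] that by (auto simp: ram_ord_def)
    qed
    have elead: "e i $ ram_ord m i \<noteq> 0" if "i \<le> n" for i
    proof (cases "i = 0")
      case False
      then show ?thesis using that eN[of i "ram_ord m i"] c0lead[of i] rN[of i] by (auto simp: ram_ord_def)
    qed (simp add: e0 ram_ord_def)
    have edeg': "e i $ \<kappa> = 0" if "i \<le> n" "d < \<kappa>" for i \<kappa>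
      using edeg[of i] that by (cases "i = 0") (auto simp: e0 deg_le_def)
    \<comment> \<open>The curve \<open>e\<close> itself, with the identity matrix: the entries of \<open>e i\<close> at \<open>ram_ord m j\<close>, \<open>j < i\<close>, are zero.\<close>
    define w1 where "w1 = (\<lambda>(i, k). e i $ k)"
    have fps1: "ram_fps m d w1 j = e j" if "j \<le> n" for j
      using evan[OF that] edeg'[OF that] by (auto simp: fps_eq_iff ram_fps_def w1_def not_le)
    have map1: "coeff_fps (ram_map n m d w1) i = e i" if i: "i \<le> n" for i
    proof -
      have "ram_matrix m w1 i j = 0" if "j < i" for j
        using that evan[OF i ram_ord_mono[OF m that]] by (simp add: ram_matrix_def w1_def)
      then have "(\<Sum>j\<le>i. ram_matrix m w1 i j * ram_fps m d w1 j $ k) = (\<Sum>j\<in>{i}. ram_matrix m w1 i j * ram_fps m d w1 j $ k)" for k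
        by (intro sum.mono_neutral_right) auto
      then show ?thesis using i edeg'[OF i]
        by (auto simp: fps_eq_iff coeff_fps_def ram_map_def ram_matrix_def[of m w1 i i] fps1[OF i] not_le)
    qed
    define ce where "ce = (\<lambda>(i, k). if i \<in> {1..n} then e i $ k else 0)"
    have ce: "coeff_fps ce i = e i" if "i \<in> {1..n}" for i
      using that by (simp add: fps_eq_iff coeff_fps_def ce_def)
    have "e i $ cusp_ord m i \<noteq> 0" "\<kappa> < cusp_ord m i \<Longrightarrow> e i $ \<kappa> = 0" if "i \<in> {1..n}" for i \<kappa>
      using evan[of i \<kappa>] elead[of i] that by (auto simp: ram_ord_def)
    then have "ce \<in> CP"
      unfolding CP_def cusp_params_iff cusp_space_def affine_space_def by (auto simp: ce_def)
    moreover have "G ce = G c0"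
      by (rule poly_funs_cong[OF J(3)]) (use J(2) JN eN in \<open>auto simp: ce_def\<close>)
    ultimately have "value_semigroup {1..n} e = S"
      using G(3) G(4)[of ce] value_semigroup_cong[of "{1..n}" "coeff_fps ce" e] ce by simp
    moreover have "e i $ 0 = 0" if "i \<in> {1..n}" for i
      using evan[of i 0] that m by (auto simp: ram_ord_def cusp_ord_def)
    ultimately have Se: "orders (subalg fps_const (e ` {1..n})) = S"
      using value_semigroup_eq_orders[of "{1..n}" e] by auto
    define k1 where "k1 = max 2 k1'"
    have rank1: "d * k + 1 \<le> card (orders (forms n (coeff_fps (ram_map n m d w1)) k) \<inter> {..<d * k + 1}) + card (UNIV - S)"
      if k: "k1 \<le> k" for k
    proof -
      have "orders (forms n (coeff_fps (ram_map n m d w1)) k) = orders (forms n e k)"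
        using forms_cong[of n "coeff_fps (ram_map n m d w1)" e k] map1 by simp
      then have "card (S \<inter> {..<d * k + 1}) \<le> card (orders (forms n (coeff_fps (ram_map n m d w1)) k) \<inter> {..<d * k + 1})"
        using ek[of k] k unfolding Se k1_def by (intro card_mono) auto
      moreover have "d \<le> d * k" using k by (simp add: k1_def)
      then have "C \<le> d * k + 1" using d by linarith
      then have "card (S \<inter> {..<d * k + 1}) + card (UNIV - S) = d * k + 1"
        using card_Int_lessThan_add_gaps[of C S "d * k + 1", OF cond] by blast
      ultimately show ?thesis by simp
    qed
    define B where "B = ram_index n m d"
    have rd: "ram_ord m n \<le> d" using rN[of n] Nd by simp
    have coeffs: "poly_fps B (\<lambda>w. coeff_fps (ram_map n m d w) i)" for i
      unfolding poly_fps_def coeff_fps_def B_def using ram_map_poly[OF m rd] by simp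
    have "\<exists>p\<in>poly_funs B. p w1 \<noteq> 0 \<and> (\<forall>w. p w \<noteq> 0 \<longrightarrow>
        card (orders (forms n (coeff_fps (ram_map n m d w1)) k) \<inter> {..<d * k + 1})
        \<le> card (orders (forms n (coeff_fps (ram_map n m d w)) k) \<inter> {..<d * k + 1}))" for k
      unfolding forms_def
      using card_orders_semicontinuous[of "form_exponents n k" "\<lambda>w. monomial {..n} (coeff_fps (ram_map n m d w))"
          B w1 "d * k + 1", OF finite_form_exponents poly_fps_monomial[OF coeffs, unfolded poly_fps_def, rule_format]]
      by simp
    then obtain p where p: "\<And>k. p k \<in> poly_funs B" "\<And>k. p k w1 \<noteq> 0" "\<And>k w. p k w \<noteq> 0 \<Longrightarrow>
        card (orders (forms n (coeff_fps (ram_map n m d w1)) k) \<inter> {..<d * k + 1})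
        \<le> card (orders (forms n (coeff_fps (ram_map n m d w)) k) \<inter> {..<d * k + 1})"
      by metis
    define R where "R w = (\<Prod>k\<in>{k1..2 * k1 + 1}. p k w) * (\<Prod>j\<le>n. w (j, ram_ord m j))" for w
    have "(j, ram_ord m j) \<in> B" if "j \<le> n" for j
      using ram_ord_le[OF m that] rd that by (auto simp: B_def ram_index_def)
    then have R: "R \<in> poly_funs B"
      unfolding R_def using p(1) by (intro poly_funs.mult poly_funs_prod poly_funs.coord) auto
    have "R w1 \<noteq> 0" using p(2) elead by (auto simp: R_def w1_def)
    then obtain ws where ws: "P ws \<noteq> 0" "R ws \<noteq> 0"
      using poly_funs_avoid[OF P(1) R[unfolded B_def] P(2)] by blast
    define f0 where "f0 = ram_fps m d ws 0"
    have "ws (j, ram_ord m j) \<noteq> 0" if "j \<le> n" for j using ws(2) that by (auto simp: R_def)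
    from this[of 0] have f00: "f0 $ 0 \<noteq> 0" by (simp add: f0_def ram_fps_def ram_ord_def)
    \<comment> \<open>The endpoint of the line: up to order \<open>d\<close> the quotients by \<open>f0\<close> are the series of \<open>c0\<close>.\<close>
    define w2 where "w2 = (\<lambda>(j, k). if j = 0 then ws (0, k) else (f0 * coeff_fps c0 j) $ k)"
    define q where "q w = (\<lambda>(j, k). if j \<in> {1..n} then (ram_fps m d w j * inverse f0) $ k else 0)" for w
    have "(\<lambda>w. ram_fps m d w j $ i) \<in> poly_funs UNIV" for i j
      unfolding ram_fps_def by (cases "ram_ord m j \<le> i \<and> i \<le> d") (auto intro: poly_funs.coord poly_funs.const)
    then have "(\<lambda>w. q w b) \<in> poly_funs UNIV" if "b \<in> {1..n} \<times> UNIV" for b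
      using that unfolding q_def fps_mult_nth
      by (auto intro!: poly_funs_sum poly_funs.mult poly_funs.const)
    then have H: "(\<lambda>w. G (q w)) \<in> poly_funs UNIV" by (rule poly_funs_subst[OF G(1)])
    have "G (q w2) = G c0"
    proof (rule poly_funs_cong[OF J(3)], clarify)
      fix j k assume jk: "(j, k) \<in> J"
      then have j: "j \<in> {1..n}" and k: "k \<le> d" using J(2) JN[OF jk] Nd by auto
      have "ram_fps m d w2 j $ i = (f0 * coeff_fps c0 j) $ i" if "i \<le> d" for i
      proof (cases "ram_ord m j \<le> i")
        case True
        then show ?thesis using that j by (simp add: ram_fps_def w2_def)
      next
        case False
        have "vanishes (cusp_ord m j) (coeff_fps c0 j)" using c0van[OF j] by (simp add: vanishes_def coeff_fps_def)
        then have "vanishes (0 + cusp_ord m j) (f0 * coeff_fps c0 j)"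
          by (intro vanishes_mult) (simp add: vanishes_def)
        then show ?thesis using False j by (auto simp: ram_fps_def vanishes_def ram_ord_def)
      qed
      then have "(ram_fps m d w2 j * inverse f0) $ k = ((f0 * coeff_fps c0 j) * inverse f0) $ k"
        unfolding fps_mult_nth[of _ "inverse f0"] using k by (intro sum.cong) auto
      also have "(f0 * coeff_fps c0 j) * inverse f0 = coeff_fps c0 j"
        using inverse_mult_eq_1'[OF f00] by (simp add: mult.commute mult.left_commute)
      finally show "q w2 (j, k) = c0 (j, k)" using j by (simp add: q_def coeff_fps_def)
    qed
    then have "G (q w2) \<noteq> 0" using G(3) by simp
    moreover have PR: "(\<lambda>w. P w * R w) \<in> poly_funs UNIV"
      using poly_funs.mult[OF P(1) R[unfolded B_def]] by (rule poly_funs_mono) simp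
    ultimately obtain h where h: "P (line ws w2 h) * R (line ws w2 h) \<noteq> 0" "G (q (line ws w2 h)) \<noteq> 0"
      using poly_funs_avoid[OF PR H, of ws w2] ws by auto
    define w3 where "w3 = line ws w2 h"
    have row0: "ram_fps m d w3 0 = f0"
      by (simp add: fps_eq_iff ram_fps_def f0_def w3_def line_def w2_def)
    have lead3: "w3 (j, ram_ord m j) \<noteq> 0" if "j \<le> n" for j
      using h(1) that by (auto simp: w3_def[symmetric] R_def)
    have "q w3 \<in> CP"
      unfolding CP_def cusp_params_iff cusp_space_def mem_Collect_eq
    proof (intro conjI ballI allI impI)
      show "q w3 \<in> affine_space ({1..n} \<times> UNIV)" by (auto simp: affine_space_def q_def)
      fix j assume j: "j \<in> {1..n}"
      have van: "vanishes (cusp_ord m j) (ram_fps m d w3 j)"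
        using j by (auto simp: vanishes_def ram_fps_def ram_ord_def)
      then have "vanishes (cusp_ord m j + 0) (ram_fps m d w3 j * inverse f0)"
        by (intro vanishes_mult) (simp_all add: vanishes_def)
      then show "q w3 (j, k) = 0" if "k < cusp_ord m j" for k using that j by (simp add: q_def vanishes_def)
      have "cusp_ord m j < N" using rN[of j] j by (auto simp: ram_ord_def)
      then have "ram_fps m d w3 j $ cusp_ord m j \<noteq> 0"
        using lead3[of j] j Nd by (auto simp: ram_fps_def ram_ord_def)
      then show "q w3 (j, cusp_ord m j) \<noteq> 0"
        using j f00 by (simp add: q_def vanishes_mult_lead[OF van])
    qed
    then have "value_semigroup {1..n} (coeff_fps (q w3)) = S" using G(4)[of "q w3"] h(2) by (simp add: w3_def)
    moreover have "value_semigroup {1..n} (coeff_fps (q w3)) =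
        value_semigroup {1..n} (\<lambda>j. ram_fps m d w3 j / ram_fps m d w3 0)"
    proof (rule value_semigroup_cong)
      fix j assume "j \<in> {1..n}"
      then show "coeff_fps (q w3) j = ram_fps m d w3 j / ram_fps m d w3 0"
        unfolding row0 fps_divide_unit[OF f00] by (simp add: fps_eq_iff coeff_fps_def q_def)
    qed
    moreover have "d * k + 1 \<le> card (orders (forms n (coeff_fps (ram_map n m d w3)) k) \<inter> {..<d * k + 1}) + card (UNIV - S)"
      if "k1 \<le> k" "k \<le> 2 * k1 + 1" for k
    proof -
      have "p k w3 \<noteq> 0"
      proof
        assume "p k w3 = 0"
        then have "(\<Prod>k\<in>{k1..2 * k1 + 1}. p k w3) = 0"
          using that by (intro prod_zero bexI[of _ k]) simp_all
        then show False using h(1) unfolding w3_def[symmetric] R_def by (simp only: mult_zero_left mult_zero_right)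
      qed
      from p(3)[OF this] rank1[OF that(1)] show ?thesis by linarith
    qed
    moreover have "2 \<le> k1" by (simp add: k1_def)
    ultimately have "w3 \<in> good_params n m d S" unfolding good_params_def using lead3 by auto
    moreover have "P w3 \<noteq> 0" using h(1) by (simp add: w3_def)
    ultimately show ?thesis by blast
  qed
  then show ?thesis unfolding S_def by (intro exI[of _ "d0 + N + C + 2"]) auto
qed

section \<open>Counting gaps\<close>

definition unit_exp :: "nat \<Rightarrow> nat \<Rightarrow> nat" where
  "unit_exp i = (\<lambda>j. if j = i \<and> i > 0 then 1 else 0)"

lemma exponent_peel:
  assumes a: "\<forall>i. i \<notin> {1..n} \<longrightarrow> a i = 0" and s: "(\<Sum>i\<in>{1..n}. a i) = Suc t"
  shows "\<exists>i a'. i \<in> {1..n} \<and> (\<forall>i. i \<notin> {1..n} \<longrightarrow> a' i = 0) \<and> (\<Sum>i\<in>{1..n}. a' i) = t \<and>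
    (\<Sum>i\<in>{1..n}. a i * k i) = (\<Sum>i\<in>{1..n}. a' i * k i) + k i \<and> a = (\<lambda>j. a' j + unit_exp i j)"
proof -
  have "\<exists>i\<in>{1..n}. a i \<noteq> 0" using s by (metis sum.neutral nat.distinct(1))
  then obtain i where i: "i \<in> {1..n}" "a i \<noteq> 0" by blast
  define a' where "a' = a(i := a i - 1)"
  have aa: "a j = a' j + unit_exp i j" for j using i by (auto simp: a'_def unit_exp_def)
  have u: "(\<Sum>j\<in>{1..n}. unit_exp i j * f j) = f i" for f :: "nat \<Rightarrow> nat"
  proof -
    have "(\<Sum>j\<in>{1..n}. unit_exp i j * f j) = (\<Sum>j\<in>{i}. unit_exp i j * f j)"
      by (rule sum.mono_neutral_right) (use i in \<open>auto simp: unit_exp_def\<close>)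
    also have "\<dots> = f i" using i by (simp add: unit_exp_def)
    finally show ?thesis .
  qed
  have "(\<Sum>j\<in>{1..n}. a j * f j) = (\<Sum>j\<in>{1..n}. a' j * f j) + f i" for f :: "nat \<Rightarrow> nat"
    unfolding aa by (simp add: distrib_right sum.distrib u[unfolded One_nat_def])
  note sum_eq = this
  have "(\<Sum>i\<in>{1..n}. a' i) = t" using sum_eq[of "\<lambda>_. 1"] s by simp
  moreover have "\<forall>i. i \<notin> {1..n} \<longrightarrow> a' i = 0" using a i by (simp add: a'_def)
  moreover have "a = (\<lambda>j. a' j + unit_exp i j)" by (rule ext) (rule aa)
  ultimately show ?thesis using i(1) sum_eq[of k] by blast
qed

lemma weight_ge: "2 * m * (\<Sum>i\<in>{1..n}. a i) \<le> (\<Sum>i\<in>{1..n}. a i * cusp_ord m i)"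
  unfolding sum_distrib_left by (rule sum_mono) (auto simp: cusp_ord_def)

lemma exponent_zero:
  fixes a :: "nat \<Rightarrow> nat"
  assumes "\<forall>i. i \<notin> {1..n} \<longrightarrow> a i = 0" "(\<Sum>i\<in>{1..n}. a i) = 0"
  shows "a = (\<lambda>_. 0 :: nat)"
proof
  fix i
  show "a i = 0" using assms by (cases "i \<in> {1..n}") auto
qed

text \<open>Every variable has weight at least \<open>2 m\<close>, so that the degree is at most two, and in degree two only
  \<open>f_1^2\<close> and \<open>f_1 f_2\<close> are light enough.\<close>

lemma small_exponents:
  assumes m: "m \<ge> 2" and a: "\<forall>i. i \<notin> {1..n} \<longrightarrow> a i = 0"
    and w: "(\<Sum>i\<in>{1..n}. a i * cusp_ord m i) < 4 * m + 4"
  shows "a \<in> unit_exp ` {..n} \<union> {\<lambda>j. unit_exp 1 j + unit_exp 1 j, \<lambda>j. unit_exp 1 j + unit_exp 2 j}"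
proof -
  have u0: "unit_exp 0 = (\<lambda>_. 0)" by (simp add: unit_exp_def)
  define t where "t = (\<Sum>i\<in>{1..n}. a i)"
  have "t < 3"
  proof (rule ccontr)
    assume "\<not> t < 3"
    then have "2 * m * 3 \<le> 2 * m * t" by (intro mult_le_mono2) simp
    then show False using weight_ge[of m a n] w m unfolding t_def by linarith
  qed
  then consider "t = 0" | "t = Suc 0" | "t = Suc (Suc 0)" by linarith
  then show ?thesis
  proof cases
    case 1
    then have "a = unit_exp 0" using exponent_zero[OF a] by (simp add: t_def u0)
    then show ?thesis by auto
  next
    case 2
    obtain i a' where i: "i \<in> {1..n}" "\<forall>i. i \<notin> {1..n} \<longrightarrow> a' i = 0" "(\<Sum>i\<in>{1..n}. a' i) = 0"
      "a = (\<lambda>j. a' j + unit_exp i j)"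
      using exponent_peel[OF a, of 0 "cusp_ord m"] 2 unfolding t_def by blast
    then have "a = unit_exp i" using exponent_zero[of n a'] by simp
    then show ?thesis using i by auto
  next
    case 3
    obtain i a' where i: "i \<in> {1..n}" "\<forall>i. i \<notin> {1..n} \<longrightarrow> a' i = 0" "(\<Sum>i\<in>{1..n}. a' i) = Suc 0"
      "(\<Sum>i\<in>{1..n}. a i * cusp_ord m i) = (\<Sum>i\<in>{1..n}. a' i * cusp_ord m i) + cusp_ord m i" "a = (\<lambda>j. a' j + unit_exp i j)"
      using exponent_peel[OF a, of "Suc 0" "cusp_ord m"] 3 unfolding t_def by blast
    obtain l a'' where l: "l \<in> {1..n}" "\<forall>i. i \<notin> {1..n} \<longrightarrow> a'' i = 0" "(\<Sum>i\<in>{1..n}. a'' i) = 0"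
      "(\<Sum>i\<in>{1..n}. a' i * cusp_ord m i) = (\<Sum>i\<in>{1..n}. a'' i * cusp_ord m i) + cusp_ord m l" "a' = (\<lambda>j. a'' j + unit_exp l j)"
      using exponent_peel[OF i(2), of 0 "cusp_ord m"] i(3) by blast
    have a'': "a'' = (\<lambda>_. 0)" by (rule exponent_zero[OF l(2,3)])
    have "cusp_ord m l + cusp_ord m i < 4 * m + 4" using w unfolding i(4) l(4) a'' by simp
    then have "i + l < 4" "i \<ge> 1" "l \<ge> 1" using i(1) l(1) by (auto simp: cusp_ord_def)
    then have "(i = 1 \<and> l = 1) \<or> (i = 1 \<and> l = 2) \<or> (i = 2 \<and> l = 1)" by linarith
    moreover have "a = (\<lambda>j. unit_exp l j + unit_exp i j)" using i(5) l(5) a'' by simp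
    ultimately show ?thesis by (auto simp: add.commute)
  qed
qed

text \<open>Every variable has weight at least \<open>2 m\<close>, so that the degree is at most three, and in degree three
  only \<open>f_1^3\<close> and \<open>f_1^2 f_2\<close> are light enough.\<close>

lemma medium_exponents:
  assumes m: "m \<ge> 2" and a: "\<forall>i. i \<notin> {1..n} \<longrightarrow> a i = 0"
    and w: "(\<Sum>i\<in>{1..n}. a i * cusp_ord m i) < 6 * m + 4"
  shows "a \<in> (\<lambda>(i, l). \<lambda>j. unit_exp l j + unit_exp i j) ` (SIGMA i:{..n}. {..i}) \<union>
    {\<lambda>j. unit_exp 1 j + unit_exp 1 j + unit_exp 1 j, \<lambda>j. unit_exp 1 j + unit_exp 1 j + unit_exp 2 j}"
proof -
  have pair: "(\<lambda>j. unit_exp l j + unit_exp i j) \<in> (\<lambda>(i, l). \<lambda>j. unit_exp l j + unit_exp i j) ` (SIGMA i:{..n}. {..i})"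
    if "i \<le> n" "l \<le> n" for i l
  proof (cases "l \<le> i")
    case True
    then show ?thesis using that by (intro image_eqI[of _ _ "(i, l)"]) auto
  next
    case False
    then show ?thesis using that by (intro image_eqI[of _ _ "(l, i)"]) (auto simp: add.commute)
  qed
  have u0: "unit_exp 0 = (\<lambda>_. 0)" by (simp add: unit_exp_def)
  define t where "t = (\<Sum>i\<in>{1..n}. a i)"
  have "t < 4"
  proof (rule ccontr)
    assume "\<not> t < 4"
    then have "2 * m * 4 \<le> 2 * m * t" by (intro mult_le_mono2) simp
    then show False using weight_ge[of m a n] w m unfolding t_def by linarith
  qed
  then consider "t = 0" | "\<exists>t'. t = Suc t' \<and> t' < 3" by (cases t) auto
  then show ?thesis
  proof cases
    case 1
    then have "a = (\<lambda>j. unit_exp 0 j + unit_exp 0 j)" using exponent_zero[OF a] by (simp add: t_def u0)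
    then show ?thesis using pair[of 0 0] by simp
  next
    case 2
    then obtain t' where t': "t = Suc t'" "t' < 3" by blast
    obtain i a' where i: "i \<in> {1..n}" "\<forall>i. i \<notin> {1..n} \<longrightarrow> a' i = 0" "(\<Sum>i\<in>{1..n}. a' i) = t'"
      "(\<Sum>i\<in>{1..n}. a i * cusp_ord m i) = (\<Sum>i\<in>{1..n}. a' i * cusp_ord m i) + cusp_ord m i" "a = (\<lambda>j. a' j + unit_exp i j)"
      using exponent_peel[OF a, of t' "cusp_ord m"] t'(1) unfolding t_def by blast
    consider "t' = 0" | "\<exists>s. t' = Suc s \<and> s < 2" using t'(2) by (cases t') auto
    then show ?thesis
    proof cases
      case 1
      then have "a = (\<lambda>j. unit_exp 0 j + unit_exp i j)" using exponent_zero[of n a'] i by (simp add: u0)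
      then show ?thesis using pair[of i 0] i(1) by simp
    next
      case 2
      then obtain s where s: "t' = Suc s" "s < 2" by blast
      obtain l a'' where l: "l \<in> {1..n}" "\<forall>i. i \<notin> {1..n} \<longrightarrow> a'' i = 0" "(\<Sum>i\<in>{1..n}. a'' i) = s"
        "(\<Sum>i\<in>{1..n}. a' i * cusp_ord m i) = (\<Sum>i\<in>{1..n}. a'' i * cusp_ord m i) + cusp_ord m l" "a' = (\<lambda>j. a'' j + unit_exp l j)"
        using exponent_peel[OF i(2), of s "cusp_ord m"] i(3) s(1) by blast
      consider "s = 0" | "s = Suc 0" using s(2) by linarith
      then show ?thesis
      proof cases
        case 1
        then have "a = (\<lambda>j. unit_exp l j + unit_exp i j)" using exponent_zero[of n a''] i(5) l by simp
        then show ?thesis using pair[of i l] i(1) l(1) by simp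
      next
        case 2
        obtain r b where r: "r \<in> {1..n}" "\<forall>i. i \<notin> {1..n} \<longrightarrow> b i = 0" "(\<Sum>i\<in>{1..n}. b i) = 0"
          "(\<Sum>i\<in>{1..n}. a'' i * cusp_ord m i) = (\<Sum>i\<in>{1..n}. b i * cusp_ord m i) + cusp_ord m r" "a'' = (\<lambda>j. b j + unit_exp r j)"
          using exponent_peel[OF l(2), of 0 "cusp_ord m"] l(3) 2 by blast
        have b0: "b = (\<lambda>_. 0)" by (rule exponent_zero[OF r(2,3)])
        have "cusp_ord m r + cusp_ord m l + cusp_ord m i < 6 * m + 4" using w unfolding i(4) l(4) r(4) b0 by simp
        then have "i + l + r < 5" "i \<ge> 1" "l \<ge> 1" "r \<ge> 1" using i(1) l(1) r(1) by (auto simp: cusp_ord_def)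
        then have "(i = 1 \<and> l = 1 \<and> r = 1) \<or> (i = 1 \<and> l = 1 \<and> r = 2) \<or> (i = 1 \<and> l = 2 \<and> r = 1) \<or> (i = 2 \<and> l = 1 \<and> r = 1)"
          by linarith
        moreover have "a = (\<lambda>j. unit_exp r j + unit_exp l j + unit_exp i j)" using i(5) l(5) r(5) b0 by simp
        ultimately show ?thesis by (auto simp: add_ac)
      qed
    qed
  qed
qed

lemma gaps_ge:
  assumes c: "c \<in> cusp_params n (cusp_ord m)" and m: "m > 0"
    and S: "S = value_semigroup {1..n} (coeff_fps c)" and cond: "\<And>s. C \<le> s \<Longrightarrow> s \<in> S"
    and T: "finite T" "\<And>a. (\<forall>i. i \<notin> {1..n} \<longrightarrow> a i = 0) \<Longrightarrow> (\<Sum>i\<in>{1..n}. a i * cusp_ord m i) < j \<Longrightarrow> a \<in> T"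
  shows "j \<le> card (UNIV - S) + card T"
proof -
  have "card (S \<inter> {..<j}) \<le> card T"
    unfolding S by (rule card_value_semigroup_le[where k = "cusp_ord m"])
      (use T m cusp_params_vanishes[OF c] in \<open>auto simp: cusp_ord_def\<close>)
  moreover have "card ({..<j} \<inter> S) + card ({..<j} - S) = card {..<j}"
    using card_Int_Diff[of "{..<j}" S] by simp
  moreover have "card ({..<j} - S) \<le> card (UNIV - S)"
  proof (rule card_mono)
    have "UNIV - S \<subseteq> {..<C}" using cond not_less by auto
    then show "finite (UNIV - S)" by (rule finite_subset) simp
  qed auto
  ultimately show ?thesis by (simp add: Int_commute)
qed

text \<open>Below \<open>4 m + 4\<close> the semigroup has at most as many elements as there are monomials of weight less
  than \<open>4 m + 4\<close>, and similarly for \<open>6 m + 4\<close> if \<open>n = 4\<close>, where there are 15 monomials of degree at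
  most two and two more.\<close>

lemma S_gen_gaps:
  assumes n: "n \<ge> 4" and m: "m \<ge> 2"
  shows "4 * m + 1 \<le> card (UNIV - S_gen m n) + n" and "n = 4 \<Longrightarrow> 6 * m \<le> card (UNIV - S_gen m n) + 13"
    and "\<And>s. 2 * m * m + 4 * m + 5 \<le> s \<Longrightarrow> s \<in> S_gen m n"
proof -
  obtain G c where c: "c\<in>cusp_params n (cusp_ord m)" "G c \<noteq> (0::complex)"
    "value_semigroup {1..n} (coeff_fps c) = S_gen m n" "odd_coeff m c \<noteq> 0"
    using S_gen_generic[of n m] n m by auto
  show cond: "s \<in> S_gen m n" if "2 * m * m + 4 * m + 5 \<le> s" for s
    using cusp_semigroup_cofinite[of n m c s] c that n m by auto
  have m0: "m > 0" using m by simp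
  note ge = gaps_ge[OF c(1) m0 c(3)[symmetric] cond]
  define T where "T = unit_exp ` {..n} \<union> {\<lambda>j. unit_exp 1 j + unit_exp 1 j, \<lambda>j. unit_exp 1 j + unit_exp 2 j}"
  have "finite T" unfolding T_def by simp
  then have "4 * m + 4 \<le> card (UNIV - S_gen m n) + card T"
    using small_exponents[OF m] unfolding T_def by (intro ge) auto
  moreover have "card T \<le> card (unit_exp ` {..n}) + card {\<lambda>j. unit_exp 1 j + unit_exp 1 j, \<lambda>j. unit_exp 1 j + unit_exp 2 j}"
    unfolding T_def by (rule card_Un_le)
  moreover have "card (unit_exp ` {..n}) \<le> Suc n" using card_image_le[of "{..n}" unit_exp] by simp
  moreover have "card {\<lambda>j. unit_exp 1 j + unit_exp 1 j, \<lambda>j. unit_exp 1 j + unit_exp 2 j} \<le> 2"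
    by (rule order_trans[OF card_insert_le_m1]) auto
  ultimately show "4 * m + 1 \<le> card (UNIV - S_gen m n) + n" by linarith
  assume n4: "n = 4"
  define T1 where "T1 = (\<lambda>(i, l). \<lambda>j. unit_exp l j + unit_exp i j) ` (SIGMA i:{..n}. {..i})"
  define T2 where "T2 = {\<lambda>j. unit_exp 1 j + unit_exp 1 j + unit_exp 1 j, \<lambda>j. unit_exp 1 j + unit_exp 1 j + unit_exp 2 j}"
  have "finite (T1 \<union> T2)" unfolding T1_def T2_def by simp
  then have "6 * m + 4 \<le> card (UNIV - S_gen m n) + card (T1 \<union> T2)"
    using medium_exponents[OF m] unfolding T1_def T2_def by (intro ge) auto
  moreover have "card (T1 \<union> T2) \<le> card T1 + card T2" by (rule card_Un_le)
  moreover have "card T1 \<le> card (SIGMA i:{..n}. {..i})" unfolding T1_def by (rule card_image_le) simp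
  moreover have "card (SIGMA i:{..n}. {..i}) = 15" by (simp add: n4 eval_nat_numeral)
  moreover have "card T2 \<le> 2" unfolding T2_def by (rule order_trans[OF card_insert_le_m1]) auto
  ultimately show "6 * m \<le> card (UNIV - S_gen m n) + 13" by linarith
qed

text \<open>For \<open>n \<ge> 5\<close> the gaps below \<open>4 m + 4\<close> are enough. For \<open>n = 4\<close> they are not, since both sides then
  grow like \<open>16 m\<close>; the gaps below \<open>6 m + 4\<close> are needed, and the inequality becomes \<open>m > 7\<close>.\<close>

lemma codim_less_bound:
  fixes n m g :: nat
  assumes n: "n \<ge> 4" and m: "real m > 7 / 6 * real n + 26 / 9"
    and g: "4 * m + 1 \<le> g + n" "n = 4 \<Longrightarrow> 6 * m \<le> g + 13"
  shows "n * (4 * m + n - 3) < 2 * ((n - 2) * g)"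
proof (cases "n = 4")
  case True
  then have "m \<ge> 8" using m by simp
  then show ?thesis using g(2) True by simp
next
  case False
  obtain l where l: "n = l + 5" using n False by (metis Suc_leI add.commute le_Suc_ex le_neq_implies_less eval_nat_numeral(3) numeral_eq_Suc pred_numeral_simps(3))
  \<comment> \<open>The hypothesis on \<open>m\<close> with denominators cleared.\<close>
  have m': "18 * m \<ge> 21 * n + 53"
  proof -
    have "real (18 * m) > real (21 * n + 52)" using m by simp
    then show ?thesis by linarith
  qed
  have g': "4 * m \<le> g + (l + 4)" using g(1) l by simp
  have "18 * (n * (4 * m + n - 3)) < 18 * (2 * ((n - 2) * g))"
  proof -
    have "18 * (int n * (4 * int m + int n - 3)) < 18 * (2 * ((int n - 2) * int g))"
    proof -
      have "int g \<ge> 4 * int m - int l - 4" using g' by linarith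
      then have "(int l + 3) * (4 * int m - int l - 4) \<le> (int l + 3) * int g"
        by (intro mult_left_mono) auto
      moreover have e: "int n - 2 = int l + 3" using l by simp
      ultimately have 1: "2 * ((int n - 2) * int g) \<ge> 2 * ((int l + 3) * (4 * int m - int l - 4))"
        unfolding e by linarith
      have "18 * int m \<ge> 21 * int l + 158" using m' l by linarith
      then have "(int l + 1) * (18 * int m) \<ge> (int l + 1) * (21 * int l + 158)"
        by (intro mult_left_mono) auto
      then have "4 * ((int l + 1) * (18 * int m)) \<ge> 4 * ((int l + 1) * (21 * int l + 158))" by linarith
      moreover have "18 * (2 * ((int l + 3) * (4 * int m - int l - 4))) - 18 * ((int l + 5) * (4 * int m + int l + 2))
          = 4 * ((int l + 1) * (18 * int m)) - 54 * (int l * int l) - 378 * int l - 612"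
        by (simp add: algebra_simps)
      moreover have "4 * ((int l + 1) * (21 * int l + 158)) = 84 * (int l * int l) + 716 * int l + 632"
        by (simp add: algebra_simps)
      moreover have "int l * int l \<ge> 0" by simp
      ultimately have "18 * ((int l + 5) * (4 * int m + int l + 2)) < 18 * (2 * ((int l + 3) * (4 * int m - int l - 4)))"
        by linarith
      moreover have "int n * (4 * int m + int n - 3) = (int l + 5) * (4 * int m + int l + 2)"
        using l by simp
      ultimately show ?thesis using 1 by linarith
    qed
    moreover have "int (4 * m + n - 3) = 4 * int m + int n - 3" "int (n - 2) = int n - 2" using n by auto
    ultimately show ?thesis by (metis (no_types, lifting) of_nat_less_iff of_nat_mult of_nat_numeral)
  qed
  then show ?thesis by linarith
qed

section \<open>The theorem\<close>

lemma severi_codim_less: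
  assumes n: "n \<ge> 4" and m: "real m > 7 / 6 * real n + 26 / 9"
  shows "\<exists>d0. \<forall>d\<ge>d0. codim (morphism_topology n d) (severi n d (card (UNIV - S_gen m n)) (S_gen m n))
    < enat ((n - 2) * card (UNIV - S_gen m n))"
proof -
  have nm: "n \<le> m" and m2: "m \<ge> 2" and m0: "m > 0" using m n by linarith+
  define S where "S = S_gen m n"
  define C where "C = 2 * m * m + 4 * m + 5"
  obtain d0 where d0: "\<And>d P w. d0 \<le> d \<Longrightarrow> P \<in> poly_funs (ram_index n m d) \<Longrightarrow> P w \<noteq> 0 \<Longrightarrow>
    \<exists>w'\<in>good_params n m d S. P w' \<noteq> 0"
    using good_params_dense[OF n m0] unfolding S_def by blast
  show ?thesis
  proof (rule exI[of _ "d0 + ram_ord m n + C"], intro allI impI)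
    fix d assume "d0 + ram_ord m n + C \<le> d"
    then have d: "d0 \<le> d" "ram_ord m n \<le> d" "C \<le> d" "2 \<le> d" by (auto simp: C_def)
    have sev: "ram_map n m d w \<in> severi n d (card (UNIV - S)) S" if "w \<in> good_params n m d S" for w
      by (rule ram_map_in_severi[OF _ m0 nm d(2,3,4) _ that])
        (use n S_gen_gaps(3)[OF n m2] in \<open>auto simp: S_def C_def\<close>)
    have "codim (morphism_topology n d) (severi n d (card (UNIV - S)) S)
        \<le> enat (card ({..n} \<times> {..d}) - card (ram_index n m d))"
      unfolding morphism_topology_def
    proof (rule codim_le_parametrized[where \<phi> = "ram_map n m d" and W = "good_params n m d S"])
      show "P1_morphisms n d \<subseteq> affine_space ({..n} \<times> {..d})" by (auto simp: P1_morphisms_def)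
      show "(\<lambda>w. ram_map n m d w i) \<in> poly_funs (ram_index n m d)" for i
        using ram_map_poly[OF m0 d(2), of "fst i" "snd i"] by simp
      show "severi n d (card (UNIV - S)) S \<subseteq> P1_morphisms n d"
        by (auto simp: severi_def P1_morphisms_genus_def)
    qed (use ram_index_subset d0[OF d(1)] ram_map_dominant[OF m0 d(2)] sev in auto)
    also have "card ({..n} \<times> {..d}) - card (ram_index n m d) < (n - 2) * card (UNIV - S)"
      using card_ram_index[OF m0 d(2)] codim_less_bound[OF n m S_gen_gaps(1,2)[OF n m2]]
      unfolding S_def by linarith
    finally show "codim (morphism_topology n d) (severi n d (card (UNIV - S_gen m n)) (S_gen m n))
      < enat ((n - 2) * card (UNIV - S_gen m n))" by (simp add: S_def)
  qed
qed

theorem corollary3p15: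
  shows "\<exists>D :: nat \<Rightarrow> nat. \<forall>n m g d :: nat.
    n \<ge> 4 \<and> m > 0 \<and> real m > 7 / 6 * real n + 26 / 9 \<and>
    g = card (UNIV - S_gen m n) \<and> d \<ge> D g \<longrightarrow>
      codim (morphism_topology n d) (severi n d g (S_gen m n)) < enat ((n - 2) * g)"
proof -
  have "\<exists>d0. n \<ge> 4 \<longrightarrow> real m > 7 / 6 * real n + 26 / 9 \<longrightarrow>
     (\<forall>d\<ge>d0. codim (morphism_topology n d) (severi n d (card (UNIV - S_gen m n)) (S_gen m n))
    < enat ((n - 2) * card (UNIV - S_gen m n)))" for n m
    using severi_codim_less by blast
  then obtain d0 where d0: "\<And>n m d. n \<ge> 4 \<Longrightarrow> real m > 7 / 6 * real n + 26 / 9 \<Longrightarrow> d0 n m \<le> d \<Longrightarrow>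
     codim (morphism_topology n d) (severi n d (card (UNIV - S_gen m n)) (S_gen m n))
    < enat ((n - 2) * card (UNIV - S_gen m n))"
    by metis
  \<comment> \<open>Only finitely many pairs have a given number of gaps, as \<open>n \<le> m \<le> g\<close>.\<close>
  define D where "D g = (\<Sum>(n, m)\<in>{..g} \<times> {..g}. d0 n m)" for g
  show ?thesis
  proof (rule exI[of _ D], intro allI impI)
    fix n m g d :: nat
    assume h: "n \<ge> 4 \<and> m > 0 \<and> real m > 7 / 6 * real n + 26 / 9 \<and> g = card (UNIV - S_gen m n) \<and> d \<ge> D g"
    then have n: "n \<ge> 4" and m: "real m > 7 / 6 * real n + 26 / 9" and g: "g = card (UNIV - S_gen m n)"
      and d: "D g \<le> d" by auto
    have "m \<ge> 2" "n \<le> m" using m n by linarith+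
    then have "n \<le> g" "m \<le> g" using S_gen_gaps(1)[OF n, of m] unfolding g by linarith+
    then have "d0 n m \<le> D g"
      unfolding D_def using member_le_sum[of "(n, m)" "{..g} \<times> {..g}" "\<lambda>(n, m). d0 n m"] by auto
    with d have "d0 n m \<le> d" by linarith
    from d0[OF n m this] show "codim (morphism_topology n d) (severi n d g (S_gen m n)) < enat ((n - 2) * g)"
      unfolding g .
  qed
qed

end
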